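(* Every (finite) outerplanar graph has distance number at most $13$.
   Context: A linear embedding of a graph $G=(V,E)$ is a map $\psi:V\to\mathbb{C}$ (the plane); the image of an edge $(u,v)\in E$ is the open segment $(\psi(u),\psi(v))=\{\alpha\psi(u)+(1-\alpha)\psi(v):\alpha\in(0,1)\}$, and its edge length is $|\psi(u)-\psi(v)|$. A drawing of $G$ is a linear embedding in which the images of all vertices are distinct and the image of every edge is disjoint from the image of every vertex (edges are allowed to cross each other). The distance number of $G$ is the minimum, over all drawings of $G$, of the number of distinct edge lengths. A graph is outerplanar if it can be embedded in the plane without edge crossings so that all vertices lie on the boundary of the unbounded face. *)

theory Defs
  imports "HOL-Analysis.Analysis" "HOL-Library.Extended_Nat"
begin

definition finite_simple_graph :: "'a set \<Rightarrow> 'a set set \<Rightarrow> bool" where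
  "finite_simple_graph V E \<longleftrightarrow> finite V \<and> (\<forall>e\<in>E. e \<subseteq> V \<and> card e = 2)"

(* open_segment a b is closed_segment a b - {a, b}; as \<psi> is injective on V, on edges this is
   the set of all \<alpha> \<psi>(u) + (1 - \<alpha>) \<psi>(v) with 0 < \<alpha> < 1. *)
definition is_drawing :: "'a set \<Rightarrow> 'a set set \<Rightarrow> ('a \<Rightarrow> complex) \<Rightarrow> bool" where
  "is_drawing V E \<psi> \<longleftrightarrow>
     inj_on \<psi> V \<and>
     (\<forall>u v w. {u, v} \<in> E \<longrightarrow> w \<in> V \<longrightarrow> \<psi> w \<notin> open_segment (\<psi> u) (\<psi> v))"

definition edge_lengths :: "'a set set \<Rightarrow> ('a \<Rightarrow> complex) \<Rightarrow> real set" where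
  "edge_lengths E \<psi> = {cmod (\<psi> u - \<psi> v) |u v. {u, v} \<in> E}"

(* The minimum is taken in enat, where an infimum over the empty set is \<infinity>: a finite bound
   therefore asserts that a drawing exists, and every nonempty infimum is attained. *)
definition distance_number :: "'a set \<Rightarrow> 'a set set \<Rightarrow> enat" where
  "distance_number V E = (INF \<psi>\<in>{\<psi>. is_drawing V E \<psi>}. enat (card (edge_lengths E \<psi>)))"

(* Edges are arbitrary simple arcs (not necessarily straight); distinct edges meet at most in
   the images of their common endpoints. *)
definition plane_embedding ::
  "'a set \<Rightarrow> 'a set set \<Rightarrow> ('a \<Rightarrow> complex) \<Rightarrow> ('a set \<Rightarrow> real \<Rightarrow> complex) \<Rightarrow> bool" where
  "plane_embedding V E f \<gamma> \<longleftrightarrow>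
     inj_on f V \<and>
     (\<forall>e\<in>E. arc (\<gamma> e) \<and> {pathstart (\<gamma> e), pathfinish (\<gamma> e)} = f ` e \<and>
             path_image (\<gamma> e) \<inter> f ` V = f ` e) \<and>
     (\<forall>e\<in>E. \<forall>e'\<in>E. e \<noteq> e' \<longrightarrow> path_image (\<gamma> e) \<inter> path_image (\<gamma> e') \<subseteq> f ` (e \<inter> e'))"

definition embedding_image ::
  "'a set \<Rightarrow> 'a set set \<Rightarrow> ('a \<Rightarrow> complex) \<Rightarrow> ('a set \<Rightarrow> real \<Rightarrow> complex) \<Rightarrow> complex set" where
  "embedding_image V E f \<gamma> = f ` V \<union> (\<Union>e\<in>E. path_image (\<gamma> e))"

(* For a finite graph the image is compact, so its outside is the unique unbounded component
   of the complement, that is, the unbounded face. *)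
definition outerplanar :: "'a set \<Rightarrow> 'a set set \<Rightarrow> bool" where
  "outerplanar V E \<longleftrightarrow>
     (\<exists>f \<gamma>. plane_embedding V E f \<gamma> \<and> f ` V \<subseteq> frontier (outside (embedding_image V E f \<gamma>)))"

end

theory Submission
  imports Defs "HOL-Library.Multiset" "HOL-Library.Sublist"
begin

text \<open>
  \<^bold>\<open>From topology to combinatorics.\<close> Of the three arcs of a theta curve, one lies inside the closed curve
  formed by the other two. When all vertices lie on the boundary of the unbounded face, this excludes
  three internally disjoint paths with inner vertices between two vertices, and crossing chords of a
  cycle. Hence 2-connected pieces have a Hamiltonian cycle, and the vertices can be listed so that
  no two edges cross.

  \<^bold>\<open>The drawing.\<close> A triangulation compatible with such an order is a tree of triangles, which is drawn
  inside a tree of parallelograms: over an edge from \<open>u\<close> to \<open>u + z\<close> stands the parallelogram with the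
  opposite edge from \<open>u + zx\<close> to \<open>u + z + zx\<close> and the diagonal from \<open>u + z\<close> to \<open>u + zx\<close>. The factors \<open>x\<close>
  are taken from ten colours, and the sides alternate between the lengths \<open>1\<close> and \<open>s\<close>, so that there are
  two side lengths and ten diagonal lengths. If the parameters are generic, a vertex \<open>w\<close> lies on the
  line through an edge based at \<open>b\<close> with direction \<open>z\<close> only if \<open>(w - b) / z\<close> is invariant, as a formal Laurent
  polynomial, under inversion of all colours. The colouring is chosen such that only integer
  constants are invariant, and these correspond to points outside the open edge.
\<close>

subsection \<open>Theta graphs in the plane\<close>

text \<open>Conjugation inverts numbers of modulus 1, so \<open>(w - b) / z\<close> being real
  turns, for generic parameters, into a symmetry of a Laurent polynomial. The obstacle is the finite
  palette: different walks share monomials, and unwanted symmetries have to be refuted by the order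
  of the colours. The parity of the level keeps the palettes of consecutive levels disjoint;
  therefore two monomials of \<open>b\<close> with product \<open>z * z\<close> both equal
  \<open>z\<close>. Within a parity, the indices 0 and 1 are reserved for the first parallelogram of
  a ladder and record the turn by which it was entered, while the other three separate nearby rungs.
  What remains ambiguous is degree one: a right turn on the next level contributes the same term as
  one more rung. Most case distinctions come from this. The second side length \<open>s\<close>
  serves the diagonals. Their direction \<open>r' * x - r\<close> is not a monomial, and a generic
  \<open>s\<close> splits the reality of the quotient into separate conditions on the parts of even
  and of odd degree.\<close>

definition theta :: "(real \<Rightarrow> complex) \<Rightarrow> (real \<Rightarrow> complex) \<Rightarrow> (real \<Rightarrow> complex) \<Rightarrow> complex \<Rightarrow> complex \<Rightarrow> bool" where
  "theta c1 c2 c3 a b \<longleftrightarrow> (\<forall>c\<in>{c1,c2,c3}. arc c \<and> pathstart c = a \<and> pathfinish c = b) \<and>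
     path_image c1 \<inter> path_image c2 = {a,b} \<and> path_image c1 \<inter> path_image c3 = {a,b} \<and>
     path_image c2 \<inter> path_image c3 = {a,b}"

lemma theta_ne: "theta c1 c2 c3 a b \<Longrightarrow> a \<noteq> b"
  by (auto simp: theta_def dest: arc_distinct_ends)

lemma theta_simple_path:
  assumes "theta c1 c2 c3 a b"
  shows "simple_path (c1 +++ reversepath c2)"
    and "pathfinish (c1 +++ reversepath c2) = pathstart (c1 +++ reversepath c2)"
    and "path_image (c1 +++ reversepath c2) = path_image c1 \<union> path_image c2"
  using assms by (auto simp: theta_def path_image_join intro!: simple_path_join_loop arc_reversepath)

lemma theta_Jordan:
  assumes "theta c1 c2 c3 a b"
  defines "K \<equiv> path_image c1 \<union> path_image c2"
  shows "inside K \<noteq> {}" "open (inside K)" "connected (inside K)" "open (outside K)"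
    "connected (outside K)" "frontier (inside K) = K"
  using Jordan_inside_outside[OF theta_simple_path(1,2)[OF assms(1)]] theta_simple_path(3)[OF assms(1)]
  unfolding K_def by auto

lemma arc_inner_point:
  assumes "arc c" "pathstart c = a" "pathfinish c = b"
  shows "\<exists>x\<in>path_image c. x \<noteq> a \<and> x \<noteq> b"
proof -
  have "inj_on c {0..1}" using assms(1) by (simp add: arc_def)
  then have "c (1/2) \<noteq> c 0" "c (1/2) \<noteq> c 1" by (auto dest!: inj_onD)
  moreover have "c (1/2) \<in> path_image c" by (auto simp: path_image_def)
  ultimately show ?thesis using assms by (auto simp: pathstart_def pathfinish_def)
qed

text \<open>If the two insides met, each would be a connected set that misses the other curve, so
  each would contain the other. Equal insides have equal frontiers, hence the curves would coincide,
  although \<open>c2\<close> has an inner point on neither of the other arcs.\<close>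

lemma theta_inside_disjoint:
  assumes th: "theta c1 c2 c3 a b"
    and "path_image c3 \<inter> inside (path_image c1 \<union> path_image c2) = {}"
    and "path_image c2 \<inter> inside (path_image c1 \<union> path_image c3) = {}"
  shows "inside (path_image c1 \<union> path_image c2) \<inter> inside (path_image c1 \<union> path_image c3) = {}"
proof (rule ccontr)
  let ?A = "path_image c1 \<union> path_image c2" and ?B = "path_image c1 \<union> path_image c3"
  assume ne: "inside ?A \<inter> inside ?B \<noteq> {}"
  have thA: "theta c1 c2 c3 a b" and thB: "theta c1 c3 c2 a b"
    using th by (auto simp: theta_def)
  note A = theta_Jordan[OF thA] and B = theta_Jordan[OF thB]
  have sub: "inside X \<subseteq> inside Y" if "connected (inside X)" "open (inside Y)" "open (outside Y)"
      "inside X \<inter> inside Y \<noteq> {}" "inside X \<inter> Y = {}" for X Y :: "complex set"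
  proof -
    have "inside X \<subseteq> inside Y \<union> outside Y" using that(5) by auto
    with connectedD[OF that(1) that(2) that(3)] that(4) show ?thesis
      using inside_Int_outside[of Y] by blast
  qed
  have "inside ?A \<inter> ?A = {}" "inside ?B \<inter> ?B = {}" by auto
  then have d: "inside ?A \<inter> ?B = {}" "inside ?B \<inter> ?A = {}"
    using assms(2,3) by blast+
  have "inside ?A = inside ?B"
    using sub[OF A(3) B(2) B(4) ne d(1)] sub[OF B(3) A(2) A(4) _ d(2)] ne by blast
  then have "?A = ?B" using A(6) B(6) by metis
  moreover obtain x where "x \<in> path_image c2" "x \<noteq> a" "x \<noteq> b"
    using arc_inner_point[of c2 a b] th by (auto simp: theta_def)
  ultimately show False using th unfolding theta_def by blast
qed

text \<open>
  Otherwise the inside of two of the arcs lies outside both other closed curves, and Janiszewski's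
  theorem connects it with the unbounded face, as these two curves intersect in an arc.
\<close>

lemma theta_one_inside:
  assumes th: "theta c1 c2 c3 a b"
  shows "path_image c3 \<inter> inside (path_image c1 \<union> path_image c2) \<noteq> {} \<or>
         path_image c2 \<inter> inside (path_image c1 \<union> path_image c3) \<noteq> {} \<or>
         path_image c1 \<inter> inside (path_image c2 \<union> path_image c3) \<noteq> {}"
proof (rule ccontr)
  let ?A1 = "path_image c1" and ?A2 = "path_image c2" and ?A3 = "path_image c3"
  assume "\<not> ?thesis"
  then have e: "?A3 \<inter> inside (?A1 \<union> ?A2) = {}" "?A2 \<inter> inside (?A1 \<union> ?A3) = {}"
    "?A1 \<inter> inside (?A2 \<union> ?A3) = {}" by auto
  have th': "theta c2 c1 c3 a b" "theta c1 c3 c2 a b" "theta c2 c3 c1 a b"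
    using th by (auto simp: theta_def)
  have d13: "inside (?A1 \<union> ?A2) \<inter> inside (?A1 \<union> ?A3) = {}"
    by (rule theta_inside_disjoint[OF th e(1,2)])
  have d23: "inside (?A1 \<union> ?A2) \<inter> inside (?A2 \<union> ?A3) = {}"
    using theta_inside_disjoint[OF th'(1)] e by (simp add: Un_commute)
  obtain w where w: "w \<in> inside (?A1 \<union> ?A2)" using theta_Jordan(1)[OF th] by auto
  have bd: "bounded (?A1 \<union> ?A2 \<union> ?A3)"
    using th by (auto simp: theta_def bounded_arc_image)
  then obtain z where z: "z \<in> outside (?A1 \<union> ?A2 \<union> ?A3)"
    using outside_bounded_nonempty by blast
  have z13: "z \<in> outside (?A1 \<union> ?A3)" and z23: "z \<in> outside (?A2 \<union> ?A3)" and z12: "z \<in> outside (?A1 \<union> ?A2)"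
    using z outside_mono[of _ "?A1 \<union> ?A2 \<union> ?A3"] by blast+
  have "w \<notin> ?A1 \<union> ?A2" using w inside_no_overlap by blast
  then have w3: "w \<notin> ?A1 \<union> ?A2 \<union> ?A3" using w e by auto
  have w13: "w \<in> outside (?A1 \<union> ?A3)"
    using w w3 d13 inside_Un_outside[of "?A1 \<union> ?A3"] by blast
  have w23: "w \<in> outside (?A2 \<union> ?A3)"
    using w w3 d23 inside_Un_outside[of "?A2 \<union> ?A3"] by blast
  have cc13: "connected_component (- (?A1 \<union> ?A3)) w z"
    using theta_Jordan(5)[OF th'(2)] w13 z13 outside_no_overlap[of "?A1 \<union> ?A3"]
    unfolding connected_component_def by blast
  have cc23: "connected_component (- (?A2 \<union> ?A3)) w z"
    using theta_Jordan(5)[OF th'(3)] w23 z23 outside_no_overlap[of "?A2 \<union> ?A3"]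
    unfolding connected_component_def by blast
  have i: "(?A1 \<union> ?A3) \<inter> (?A2 \<union> ?A3) = ?A3"
    using th unfolding theta_def by blast
  have "connected_component (- ((?A1 \<union> ?A3) \<union> (?A2 \<union> ?A3))) w z"
  proof (rule Janiszewski[OF _ _ _ cc13 cc23])
    show "compact (?A1 \<union> ?A3)" "closed (?A2 \<union> ?A3)"
      using th by (auto simp: theta_def compact_arc_image closed_arc_image)
    show "connected ((?A1 \<union> ?A3) \<inter> (?A2 \<union> ?A3))"
      unfolding i using th by (auto simp: theta_def connected_arc_image)
  qed
  then have "connected_component (- (?A1 \<union> ?A2)) w z"
    by (rule connected_component_of_subset) auto
  then have "w \<in> outside (?A1 \<union> ?A2)"
    using outside_same_component[OF _ z12] connected_component_sym by blast
  then show False using w by (meson disjoint_iff inside_Int_outside)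
qed

text \<open>The third arc is a crosscut of the Jordan domain bounded by the other two.\<close>

lemma theta_split:
  assumes th: "theta c1 c2 c3 a b"
    and ne: "path_image c3 \<inter> inside (path_image c1 \<union> path_image c2) \<noteq> {}"
  shows "path_image c3 - {a,b} \<subseteq> inside (path_image c1 \<union> path_image c2)"
    and "inside (path_image c1 \<union> path_image c2) - path_image c3 \<subseteq>
       inside (path_image c1 \<union> path_image c3) \<union> inside (path_image c2 \<union> path_image c3)"
    and "inside (path_image c1 \<union> path_image c3) \<inter> inside (path_image c2 \<union> path_image c3) = {}"
proof -
  have s: "simple_path c1" "pathstart c1 = a" "pathfinish c1 = b"
    "simple_path c2" "pathstart c2 = a" "pathfinish c2 = b"
    "simple_path c3" "pathstart c3 = a" "pathfinish c3 = b"
    "path_image c1 \<inter> path_image c2 = {a, b}"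
    "path_image c1 \<inter> path_image c3 = {a, b}"
    "path_image c2 \<inter> path_image c3 = {a, b}"
    using th by (auto simp: theta_def arc_imp_simple_path)
  obtain q: "inside (path_image c1 \<union> path_image c3) \<inter> inside (path_image c2 \<union> path_image c3) = {}"
     "inside (path_image c1 \<union> path_image c3) \<union> inside (path_image c2 \<union> path_image c3) \<union>
           (path_image c3 - {a,b}) = inside (path_image c1 \<union> path_image c2)"
    using split_inside_simple_closed_curve[OF s(1-9) theta_ne[OF th] s(10-12) ne] by metis
  then show "path_image c3 - {a,b} \<subseteq> inside (path_image c1 \<union> path_image c2)"
    "inside (path_image c1 \<union> path_image c2) - path_image c3 \<subseteq>
       inside (path_image c1 \<union> path_image c3) \<union> inside (path_image c2 \<union> path_image c3)"
     "inside (path_image c1 \<union> path_image c3) \<inter> inside (path_image c2 \<union> path_image c3) = {}"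
    by blast+
qed

text \<open>A larger set has a smaller outside, so \<open>outside M\<close> misses the open set
  \<open>inside K\<close>, and then so does its closure.\<close>

lemma frontier_outside_not_inside:
  fixes K :: "complex set"
  assumes "x \<in> frontier (outside M)" "K \<subseteq> M" "closed K"
  shows "x \<notin> inside K"
proof
  assume x: "x \<in> inside K"
  have "outside M \<inter> inside K = {}"
    using outside_mono[OF assms(2)] inside_Int_outside[of K] by blast
  then have "closure (outside M) \<inter> inside K = {}"
    using open_inside[OF assms(3)] open_Int_closure_eq_empty by blast
  then show False using x assms(1) by (auto simp: frontier_def)
qed


section \<open>Edges along a list of vertices\<close>

fun pedges :: "'a list \<Rightarrow> 'a set set" where
  "pedges (x # y # p) = insert {x, y} (pedges (y # p))"
| "pedges _ = {}"

lemma pedges_append: "pedges (p @ x # q) = pedges (p @ [x]) \<union> pedges (x # q)"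
proof (induction p)
  case (Cons a p)
  then show ?case by (cases p) auto
qed auto

lemma pedges_rev: "pedges (rev p) = pedges p"
proof (induction p rule: pedges.induct)
  case (1 x y p)
  then show ?case using pedges_append[of "rev p" y "[x]"] by (simp add: insert_commute)
qed auto

lemma pedges_subset: "e \<in> pedges p \<Longrightarrow> e \<subseteq> set p"
  by (induction p rule: pedges.induct) auto

lemma Union_pedges: "p = x # y # q \<Longrightarrow> \<Union> (pedges p) = set p"
proof (induction p arbitrary: x y q rule: pedges.induct)
  case (1 u v r)
  then show ?case
    by (cases r) (force simp: insert_commute)+
qed auto

lemma pedges_ends:
  assumes "distinct (a # A @ [b])" "{a, b} \<in> pedges (a # A @ [b])"
  shows "A = []"
proof (cases A)
  case (Cons y B)
  then have "{a, b} = {a, y} \<or> {a, b} \<in> pedges (y # B @ [b])" using assms by auto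
  then show ?thesis
    using assms(1) Cons pedges_subset[of "{a,b}" "y # B @ [b]"] by (auto simp: doubleton_eq_iff)
qed auto

text \<open>A common edge could only be \<open>{a, b}\<close>, which is not an edge of a list with
  inner vertices.\<close>

lemma pedges_ends_disjoint:
  assumes "distinct (a # A @ [b])" "distinct (a # B @ [b])" "set A \<inter> set B = {}" "A \<noteq> []"
    and "\<And>e. e \<in> pedges (a # A @ [b]) \<Longrightarrow> card e = 2"
  shows "pedges (a # A @ [b]) \<inter> pedges (a # B @ [b]) = {}"
proof (rule ccontr)
  assume "\<not> ?thesis"
  then obtain e where e: "e \<in> pedges (a # A @ [b])" "e \<in> pedges (a # B @ [b])" by auto
  have "e \<subseteq> {a, b}" using pedges_subset[OF e(1)] pedges_subset[OF e(2)] assms(3) by auto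
  moreover have "card e = 2" using assms(5) e(1) by auto
  moreover have "card {a, b} \<le> 2" by (simp add: card_insert_if)
  ultimately have "e = {a, b}" by (metis card_seteq finite.emptyI finite.insertI)
  then show False using pedges_ends[OF assms(1)] e assms(4) by auto
qed

section \<open>Cycles and chords of an embedded outerplanar graph\<close>

locale outerplane =
  fixes V :: "'a set" and E :: "'a set set" and f :: "'a \<Rightarrow> complex"
    and \<gamma> :: "'a set \<Rightarrow> real \<Rightarrow> complex"
  assumes graph: "finite_simple_graph V E"
    and embedding: "plane_embedding V E f \<gamma>"
    and outer: "f ` V \<subseteq> frontier (outside (embedding_image V E f \<gamma>))"
begin

abbreviation im :: "'a set set \<Rightarrow> complex set" where
  "im F \<equiv> (\<Union>e\<in>F. path_image (\<gamma> e))"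

lemma edgeD: "e \<in> E \<Longrightarrow> e \<subseteq> V \<and> card e = 2"
  using graph by (auto simp: finite_simple_graph_def)

lemma arc_edge: "e \<in> E \<Longrightarrow> arc (\<gamma> e)"
  using embedding by (auto simp: plane_embedding_def)

lemma edge_ends: "e \<in> E \<Longrightarrow> {pathstart (\<gamma> e), pathfinish (\<gamma> e)} = f ` e"
  using embedding by (auto simp: plane_embedding_def)

lemma inj_f: "inj_on f V"
  using embedding by (auto simp: plane_embedding_def)

lemma vertex_on_edge: "e \<in> E \<Longrightarrow> v \<in> V \<Longrightarrow> f v \<in> path_image (\<gamma> e) \<longleftrightarrow> v \<in> e"
proof -
  assume a: "e \<in> E" "v \<in> V"
  then have "path_image (\<gamma> e) \<inter> f ` V = f ` e"
    using embedding by (auto simp: plane_embedding_def)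
  then show ?thesis using a edgeD[of e] inj_f by (auto simp: inj_on_def)
qed

lemma vertex_on_im: "F \<subseteq> E \<Longrightarrow> v \<in> V \<Longrightarrow> f v \<in> im F \<longleftrightarrow> v \<in> \<Union> F"
  using vertex_on_edge by auto

lemma im_Int:
  assumes "F \<subseteq> E" "G \<subseteq> E" "F \<inter> G = {}"
  shows "im F \<inter> im G = f ` (\<Union> F \<inter> \<Union> G)"
proof
  have "path_image (\<gamma> e) \<inter> path_image (\<gamma> e') \<subseteq> f ` (e \<inter> e')" if "e \<in> F" "e' \<in> G" for e e'
  proof -
    have "e \<in> E" "e' \<in> E" "e \<noteq> e'" using that assms by auto
    then show ?thesis using embedding unfolding plane_embedding_def by simp
  qed
  then show "im F \<inter> im G \<subseteq> f ` (\<Union> F \<inter> \<Union> G)" by blast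
  show "f ` (\<Union> F \<inter> \<Union> G) \<subseteq> im F \<inter> im G"
  proof
    fix p assume "p \<in> f ` (\<Union> F \<inter> \<Union> G)"
    then obtain v e e' where "p = f v" "v \<in> e" "e \<in> F" "v \<in> e'" "e' \<in> G" by blast
    moreover from this have "v \<in> V" "e \<in> E" "e' \<in> E" using edgeD[of e] assms by blast+
    ultimately show "p \<in> im F \<inter> im G" using vertex_on_edge by blast
  qed
qed

lemma list_arc:
  assumes "pedges p \<subseteq> E" "distinct p" "p = x # y # q"
  shows "\<exists>g. arc g \<and> pathstart g = f x \<and> pathfinish g = f (last p) \<and> path_image g = im (pedges p)"
  using assms
proof (induction p arbitrary: x y q rule: pedges.induct)
  case (1 u v r)
  have e: "{x, y} \<in> E" using 1 by auto
  have "\<exists>g. arc g \<and> pathstart g = f x \<and> pathfinish g = f y \<and> path_image g = path_image (\<gamma> {x,y})"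
  proof (cases "pathstart (\<gamma> {x,y}) = f x")
    case True
    moreover have "pathfinish (\<gamma> {x,y}) = f y"
      using edge_ends[OF e] True arc_distinct_ends[OF arc_edge[OF e]] by (auto simp: doubleton_eq_iff)
    ultimately show ?thesis using arc_edge[OF e] by blast
  next
    case False
    then have "pathstart (\<gamma> {x,y}) = f y" "pathfinish (\<gamma> {x,y}) = f x"
      using edge_ends[OF e] by (auto simp: doubleton_eq_iff)
    then show ?thesis using arc_edge[OF e]
      by (intro exI[of _ "reversepath (\<gamma> {x,y})"]) (auto simp: arc_reversepath)
  qed
  then obtain g where g: "arc g" "pathstart g = f x" "pathfinish g = f y"
    "path_image g = im {{x,y}}" by auto
  show ?case
  proof (cases r)
    case Nil
    then show ?thesis using g 1 by auto
  next
    case (Cons z r')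
    have p: "pedges (y # r) \<subseteq> E" "distinct (y # r)" "y # r = y # z # r'"
      using 1 Cons by auto
    have "\<exists>h. arc h \<and> pathstart h = f y \<and> pathfinish h = f (last (y # r)) \<and> path_image h = im (pedges (y # r))"
      using "1.IH"[of y z r'] p "1.prems"(3) by blast
    then obtain h where h: "arc h" "pathstart h = f y" "pathfinish h = f (last (y # r))"
      "path_image h = im (pedges (y # r))" by auto
    have xn: "x \<notin> set (y # r)" using 1 by auto
    then have "{x,y} \<notin> pedges (y # r)" using pedges_subset[of "{x,y}" "y # r"] by auto
    then have "path_image g \<inter> path_image h = f ` (\<Union> {{x,y}} \<inter> \<Union> (pedges (y # r)))"
      unfolding g h using im_Int[of "{{x,y}}" "pedges (y # r)"] e p by auto
    also have "\<dots> \<subseteq> {f y}" using xn Union_pedges[OF p(3)] by auto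
    finally have "arc (g +++ h)"
      using arc_join[OF g(1) h(1)] g(3) h(2) by auto
    then show ?thesis
      using g h "1.prems"(3) path_image_join[of g h] by (intro exI[of _ "g +++ h"]) simp
  qed
qed auto

text \<open>The only place where \<open>outer\<close> enters: no cycle encloses a vertex.\<close>

lemma vertex_not_inside:
  assumes "v \<in> V" "F \<subseteq> E"
  shows "f v \<notin> inside (im F)"
proof (rule frontier_outside_not_inside)
  show "f v \<in> frontier (outside (embedding_image V E f \<gamma>))" using assms outer by auto
  show "im F \<subseteq> embedding_image V E f \<gamma>" using assms by (auto simp: embedding_image_def)
  have "finite E" using graph
    by (metis Pow_iff finite_Pow_iff finite_simple_graph_def finite_subset subsetI)
  then show "closed (im F)"
    using assms arc_edge closed_arc_image by (intro closed_UN) (auto intro: finite_subset)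
qed

text \<open>\<open>C\<close> may be empty; the third arc is then a single edge, such as a chord of
  the cycle formed by the other two.\<close>

lemma theta_lists:
  assumes "distinct (a # A @ [b])" "distinct (a # B @ [b])" "distinct (a # C @ [b])"
    and "pedges (a # A @ [b]) \<subseteq> E" "pedges (a # B @ [b]) \<subseteq> E" "pedges (a # C @ [b]) \<subseteq> E"
    and "set A \<inter> set B = {}" "set A \<inter> set C = {}" "set B \<inter> set C = {}" "A \<noteq> []" "B \<noteq> []"
  obtains c1 c2 c3 where "theta c1 c2 c3 (f a) (f b)"
    "path_image c1 = im (pedges (a # A @ [b]))" "path_image c2 = im (pedges (a # B @ [b]))"
    "path_image c3 = im (pedges (a # C @ [b]))"
proof -
  have ex: "\<exists>g. arc g \<and> pathstart g = f a \<and> pathfinish g = f b \<and> path_image g = im (pedges (a # X @ [b]))"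
    if "distinct (a # X @ [b])" "pedges (a # X @ [b]) \<subseteq> E" for X
  proof -
    obtain y q where "a # X @ [b] = a # y # q" by (cases X) auto
    from list_arc[OF that(2,1) this] show ?thesis by simp
  qed
  have un: "\<Union> (pedges (a # X @ [b])) = insert a (insert b (set X))" for X
  proof -
    obtain y q where "a # X @ [b] = a # y # q" by (cases X) auto
    from Union_pedges[OF this] show ?thesis by auto
  qed
  have it: "im (pedges (a # X @ [b])) \<inter> im (pedges (a # Y @ [b])) = {f a, f b}"
    if "distinct (a # X @ [b])" "pedges (a # X @ [b]) \<subseteq> E" "distinct (a # Y @ [b])" "pedges (a # Y @ [b]) \<subseteq> E"
      "set X \<inter> set Y = {}" "X \<noteq> []" for X Y
  proof -
    have "pedges (a # X @ [b]) \<inter> pedges (a # Y @ [b]) = {}"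
      using pedges_ends_disjoint[OF that(1,3,5,6)] that edgeD by blast
    from im_Int[OF that(2,4) this]
    have "im (pedges (a # X @ [b])) \<inter> im (pedges (a # Y @ [b])) = f ` (insert a (insert b (set X)) \<inter> insert a (insert b (set Y)))"
      unfolding un .
    also have "insert a (insert b (set X)) \<inter> insert a (insert b (set Y)) = {a, b}" using that(1,3,5) by auto
    finally show ?thesis by simp
  qed
  obtain c1 where c1:
    "arc c1 \<and> pathstart c1 = f a \<and> pathfinish c1 = f b \<and> path_image c1 = im (pedges (a # A @ [b]))"
    using ex[OF assms(1,4)] by blast
  obtain c2 where c2:
    "arc c2 \<and> pathstart c2 = f a \<and> pathfinish c2 = f b \<and> path_image c2 = im (pedges (a # B @ [b]))"
    using ex[OF assms(2,5)] by blast
  obtain c3 where c3: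
    "arc c3 \<and> pathstart c3 = f a \<and> pathfinish c3 = f b \<and> path_image c3 = im (pedges (a # C @ [b]))"
    using ex[OF assms(3,6)] by blast
  have "theta c1 c2 c3 (f a) (f b)"
    using it[OF assms(1,4,2,5,7,10)] it[OF assms(1,4,3,6,8,10)] it[OF assms(2,5,3,6,9,11)] c1 c2 c3
    by (simp add: theta_def)
  then show thesis using c1 c2 c3 that by blast
qed

text \<open>An arc that enters the inside of the other two lies there entirely, apart from its ends,
  and would take the vertex \<open>v\<close> with it.\<close>

lemma theta_middle:
  assumes th: "theta c1 c2 c3 (f a) (f b)"
    and F: "F1 \<subseteq> E" "F2 \<subseteq> E" "path_image c1 = im F1" "path_image c2 = im F2"
    and v: "v \<in> V" "f v \<in> path_image c3" "f v \<noteq> f a" "f v \<noteq> f b"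
  shows "path_image c3 \<inter> inside (path_image c1 \<union> path_image c2) = {}"
proof (rule ccontr)
  assume "\<not> ?thesis"
  from theta_split(1)[OF th this] v have "f v \<in> inside (im (F1 \<union> F2))"
    using F by (auto simp: UN_Un)
  with vertex_not_inside[OF v(1), of "F1 \<union> F2"] F show False by auto
qed


lemma inner_vertex:
  assumes "X \<noteq> []" "distinct (a # X @ [b])" "pedges (a # X @ [b]) \<subseteq> E"
  shows "\<exists>v\<in>V. f v \<in> im (pedges (a # X @ [b])) \<and> f v \<noteq> f a \<and> f v \<noteq> f b"
proof -
  obtain x X' where X: "X = x # X'" using assms(1) by (cases X) auto
  have "\<Union> (pedges (a # X @ [b])) = set (a # X @ [b])" by (rule Union_pedges) (simp add: X)
  moreover from this have "set (a # X @ [b]) \<subseteq> V" using edgeD assms(3) by blast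
  ultimately show ?thesis
    using vertex_on_im[OF assms(3), of x] inj_f assms(2) X by (intro bexI[of _ x]) (auto simp: inj_on_def)
qed

text \<open>One of the three arcs has to enter the inside of the other two, but each of them carries
  an inner vertex.\<close>

lemma no_three_paths:
  assumes "distinct (a # A @ [b])" "distinct (a # B @ [b])" "distinct (a # C @ [b])"
    and "pedges (a # A @ [b]) \<subseteq> E" "pedges (a # B @ [b]) \<subseteq> E" "pedges (a # C @ [b]) \<subseteq> E"
    and "set A \<inter> set B = {}" "set A \<inter> set C = {}" "set B \<inter> set C = {}" "A \<noteq> []" "B \<noteq> []" "C \<noteq> []"
  shows False
proof -
  obtain c1 c2 c3 where th: "theta c1 c2 c3 (f a) (f b)"
    and im: "path_image c1 = im (pedges (a # A @ [b]))" "path_image c2 = im (pedges (a # B @ [b]))"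
    "path_image c3 = im (pedges (a # C @ [b]))"
    using theta_lists[OF assms(1-11)] by blast
  have th2: "theta c1 c3 c2 (f a) (f b)" "theta c2 c3 c1 (f a) (f b)" using th by (auto simp: theta_def)
  show False
    using theta_one_inside[OF th] theta_middle[OF th assms(4,5) im(1,2)] theta_middle[OF th2(1) assms(4,6) im(1,3)]
      theta_middle[OF th2(2) assms(5,6) im(2,3)] inner_vertex[OF assms(10,1,4)] inner_vertex[OF assms(11,2,5)] inner_vertex[OF assms(12,3,6)] im
    by metis
qed

text \<open>Both arcs of the cycle carry inner vertices, so the chord is the one of the three arcs
  that runs inside.\<close>

lemma cycle_chord:
  assumes "distinct (a # X @ c # Y)" "pedges (a # X @ [c]) \<subseteq> E" "pedges (c # Y @ [a]) \<subseteq> E"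
    and "{a, c} \<in> E" "X \<noteq> []" "Y \<noteq> []"
  obtains c1 c2 c3 where "theta c1 c2 c3 (f a) (f c)"
    "path_image c1 = im (pedges (a # X @ [c]))" "path_image c2 = im (pedges (c # Y @ [a]))"
    "path_image c3 = path_image (\<gamma> {a, c})" "path_image c3 \<inter> inside (path_image c1 \<union> path_image c2) \<noteq> {}"
proof -
  have rev: "pedges (a # rev Y @ [c]) = pedges (c # Y @ [a])"
    using pedges_rev[of "c # Y @ [a]"] by simp
  obtain c1 c2 c3 where th: "theta c1 c2 c3 (f a) (f c)"
    and im: "path_image c1 = im (pedges (a # X @ [c]))" "path_image c2 = im (pedges (c # Y @ [a]))"
    "path_image c3 = im (pedges (a # [] @ [c]))"
  proof (rule theta_lists[of a X c "rev Y" "[]"], unfold rev)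
    show "distinct (a # X @ [c])" "distinct (a # rev Y @ [c])" "distinct (a # [] @ [c])"
      "set X \<inter> set (rev Y) = {}" using assms(1) by auto
  qed (use assms in auto)
  have e3: "pedges (a # [] @ [c]) \<subseteq> E" using assms by simp
  have th2: "theta c1 c3 c2 (f a) (f c)" "theta c2 c3 c1 (f a) (f c)" using th by (auto simp: theta_def)
  have "path_image c2 \<inter> inside (path_image c1 \<union> path_image c3) = {}"
    using theta_middle[OF th2(1) assms(2) e3 im(1,3)] inner_vertex[OF assms(6) _ assms(3)] assms(1) im by auto
  moreover have "path_image c1 \<inter> inside (path_image c2 \<union> path_image c3) = {}"
    using theta_middle[OF th2(2) assms(3) e3 im(2,3)] inner_vertex[OF assms(5) _ assms(2)] assms(1) im by auto
  ultimately have "path_image c3 \<inter> inside (path_image c1 \<union> path_image c2) \<noteq> {}"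
    using theta_one_inside[OF th] by blast
  then show thesis using that th im by simp
qed

text \<open>The chord from \<open>b\<close> to \<open>d\<close> runs inside the cycle and misses the
  other chord, so by connectedness it stays in one of the two halves cut off by the latter. Its ends
  would then lie on the boundary of that half, but \<open>d\<close> is not on the boundary of the
  first half and \<open>b\<close> is not on that of the second.\<close>

lemma no_crossing_chords:
  assumes dist: "distinct (a # P @ b # Q @ c # R @ d # S)"
    and cyc: "pedges (a # P @ b # Q @ c # R @ d # S @ [a]) \<subseteq> E"
    and chords: "{a, c} \<in> E" "{b, d} \<in> E"
  shows False
proof -
  let ?cyc = "pedges (a # P @ [b]) \<union> pedges (b # Q @ [c]) \<union> pedges (c # R @ [d]) \<union> pedges (d # S @ [a])"
  have split: "pedges (x # X @ y # Y @ [z]) = pedges (x # X @ [y]) \<union> pedges (y # Y @ [z])"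
    for x y z :: 'a and X Y
    using pedges_append[of "x # X" y "Y @ [z]"] by simp
  have "pedges (a # P @ b # Q @ c # R @ d # S @ [a]) = ?cyc"
    using split[of a P b "Q @ c # R @ d # S" a] split[of b Q c "R @ d # S" a] split[of c R d S a] by auto
  with cyc have cE: "?cyc \<subseteq> E" by simp
  note sp = split[of a P b Q c] split[of c R d S a] split[of b Q c R d] split[of d S a P b]
  have V: "{a, b, c, d} \<subseteq> V" using chords edgeD by blast
  obtain c1 c2 c3 where th: "theta c1 c2 c3 (f a) (f c)"
    and im: "path_image c1 = im (pedges (a # (P @ b # Q) @ [c]))" "path_image c2 = im (pedges (c # (R @ d # S) @ [a]))"
    "path_image c3 = path_image (\<gamma> {a, c})" and ins: "path_image c3 \<inter> inside (path_image c1 \<union> path_image c2) \<noteq> {}"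
  proof (rule cycle_chord[of a "P @ b # Q" c "R @ d # S"])
    show "distinct (a # (P @ b # Q) @ c # R @ d # S)" using dist by auto
    show "pedges (a # (P @ b # Q) @ [c]) \<subseteq> E" "pedges (c # (R @ d # S) @ [a]) \<subseteq> E" using cE sp by auto
  qed (use chords in auto)
  obtain d1 d2 d3 where thd: "theta d1 d2 d3 (f b) (f d)"
    and imd: "path_image d1 = im (pedges (b # (Q @ c # R) @ [d]))" "path_image d2 = im (pedges (d # (S @ a # P) @ [b]))"
    "path_image d3 = path_image (\<gamma> {b, d})" and insd: "path_image d3 \<inter> inside (path_image d1 \<union> path_image d2) \<noteq> {}"
  proof (rule cycle_chord[of b "Q @ c # R" d "S @ a # P"])
    show "distinct (b # (Q @ c # R) @ d # S @ a # P)" using dist by auto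
    show "pedges (b # (Q @ c # R) @ [d]) \<subseteq> E" "pedges (d # (S @ a # P) @ [b]) \<subseteq> E" using cE sp by auto
  qed (use chords in auto)
  let ?K = "im ?cyc"
  have K: "path_image c1 \<union> path_image c2 = ?K" "path_image d1 \<union> path_image d2 = ?K"
    unfolding im imd using sp by auto
  have d3K: "path_image d3 - {f b, f d} \<subseteq> inside ?K"
    using theta_split(1)[OF thd insd] unfolding K .
  have "path_image c3 \<inter> path_image d3 = {}"
    using im_Int[of "{{a,c}}" "{{b,d}}"] chords dist unfolding im imd by (auto simp: doubleton_eq_iff)
  then have cover: "path_image d3 - {f b, f d} \<subseteq>
      inside (path_image c1 \<union> path_image c3) \<union> inside (path_image c2 \<union> path_image c3)"
    using theta_split(2)[OF th ins] d3K unfolding K by blast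
  have arcd: "arc d3" "pathstart d3 = f b" "pathfinish d3 = f d" using thd by (auto simp: theta_def)
  have d3: "path_image d3 - {f b, f d} = d3 ` {0<..<1}"
    using simple_path_endless[OF arc_imp_simple_path[OF arcd(1)]] arcd by simp
  have conn: "connected (path_image d3 - {f b, f d})"
    using connected_simple_path_endless[OF arc_imp_simple_path[OF arcd(1)]] arcd by simp
  have ths: "theta c1 c3 c2 (f a) (f c)" "theta c2 c3 c1 (f a) (f c)" using th by (auto simp: theta_def)
  have un: "\<Union> (pedges (x # X @ [y])) = set (x # X @ [y])" for x y :: 'a and X :: "'a list"
  proof -
    obtain z q where "x # X @ [y] = x # z # q" by (cases X) auto
    from Union_pedges[OF this] show ?thesis .
  qed
  \<comment> \<open>By continuity of \<open>d3\<close> its ends lie in the closure of the half; as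
    vertices they are not inside, which leaves the boundary curve.\<close>
  have hit: "f v \<in> L"
    if sub: "path_image d3 - {f b, f d} \<subseteq> inside L" and L: "L = im F" "F \<subseteq> E"
      "open (inside L)" "frontier (inside L) = L" and v: "v \<in> {b, d}" for v L F
  proof -
    have "d3 ` closure {0<..<1} \<subseteq> closure (inside L)"
    proof (rule image_closure_subset)
      show "continuous_on (closure {0<..<1}) d3" using arcd(1) by (simp add: arc_def path_def)
      show "d3 ` {0<..<1} \<subseteq> closure (inside L)"
        using sub closure_subset unfolding d3 by blast
    qed simp
    then have "d3 0 \<in> closure (inside L)" "d3 1 \<in> closure (inside L)" by auto
    then have "f v \<in> closure (inside L)"
      using v arcd(2,3) by (auto simp: pathstart_def pathfinish_def)
    moreover have "f v \<notin> inside L"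
      unfolding L(1) using vertex_not_inside[OF _ L(2), of v] v V by auto
    ultimately show ?thesis
      using L(3,4) by (metis DiffI frontier_def interior_open)
  qed
  have hit1: "path_image d3 - {f b, f d} \<subseteq> inside (path_image c1 \<union> path_image c3) \<Longrightarrow>
      f d \<in> path_image c1 \<union> path_image c3"
    using cE sp chords theta_Jordan(2,6)[OF ths(1)]
    by (intro hit[where F = "pedges (a # (P @ b # Q) @ [c]) \<union> {{a,c}}"]) (auto simp: im)
  have hit2: "path_image d3 - {f b, f d} \<subseteq> inside (path_image c2 \<union> path_image c3) \<Longrightarrow>
      f b \<in> path_image c2 \<union> path_image c3"
    using cE sp chords theta_Jordan(2,6)[OF ths(2)]
    by (intro hit[where F = "pedges (c # (R @ d # S) @ [a]) \<union> {{a,c}}"]) (auto simp: im)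
  have "f d \<notin> path_image c1 \<union> path_image c3"
  proof -
    have "f d \<notin> path_image c1" unfolding im using vertex_on_im[of "pedges (a # (P @ b # Q) @ [c])" d]
      un[of a "P @ b # Q" c] cE sp V dist by auto
    then show ?thesis using vertex_on_edge[OF chords(1), of d] V dist unfolding im by auto
  qed
  moreover have "f b \<notin> path_image c2 \<union> path_image c3"
  proof -
    have "f b \<notin> path_image c2" unfolding im using vertex_on_im[of "pedges (c # (R @ d # S) @ [a])" b]
      un[of c "R @ d # S" a] cE sp V dist by auto
    then show ?thesis using vertex_on_edge[OF chords(1), of b] V dist unfolding im by auto
  qed
  moreover have "path_image d3 - {f b, f d} \<subseteq> inside (path_image c1 \<union> path_image c3) \<or>
      path_image d3 - {f b, f d} \<subseteq> inside (path_image c2 \<union> path_image c3)"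
    using connectedD[OF conn theta_Jordan(2)[OF ths(1)] theta_Jordan(2)[OF ths(2)] _ cover]
      theta_split(3)[OF th ins] cover by blast
  ultimately show False using hit1 hit2 by blast
qed

end

subsection \<open>Non-crossing vertex orders\<close>

definition no_theta :: "'a set set \<Rightarrow> bool" where
  "no_theta E \<longleftrightarrow> (\<forall>a b A B C. distinct (a # A @ [b]) \<and> distinct (a # B @ [b]) \<and> distinct (a # C @ [b]) \<and>
     pedges (a # A @ [b]) \<subseteq> E \<and> pedges (a # B @ [b]) \<subseteq> E \<and> pedges (a # C @ [b]) \<subseteq> E \<and>
     set A \<inter> set B = {} \<and> set A \<inter> set C = {} \<and> set B \<inter> set C = {} \<longrightarrow> A = [] \<or> B = [] \<or> C = [])"

definition no_crossing_in_cycle :: "'a set set \<Rightarrow> bool" where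
  "no_crossing_in_cycle E \<longleftrightarrow> (\<forall>a b c d P Q R S. distinct (a # P @ b # Q @ c # R @ d # S) \<and>
     pedges (a # P @ b # Q @ c # R @ d # S @ [a]) \<subseteq> E \<longrightarrow> {a, c} \<notin> E \<or> {b, d} \<notin> E)"

text \<open>A book embedding with one page: with the vertices on a circle in this order, the edges
  are pairwise non-crossing chords.\<close>

definition noncrossing :: "'a set set \<Rightarrow> 'a list \<Rightarrow> bool" where
  "noncrossing E vs \<longleftrightarrow> (\<forall>a b c d. subseq [a,b,c,d] vs \<longrightarrow> {a, c} \<notin> E \<or> {b, d} \<notin> E)"

text \<open>Connectedness of the induced subgraph, stated by cuts: deleting a vertex only means a
  smaller \<open>S\<close>, and a failure directly yields the two sides for an induction.\<close>

definition cut_connected :: "'a set set \<Rightarrow> 'a set \<Rightarrow> bool" where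
  "cut_connected E S \<longleftrightarrow> (\<forall>X. X \<subset> S \<and> X \<noteq> {} \<longrightarrow> (\<exists>x\<in>X. \<exists>y\<in>S - X. {x, y} \<in> E))"

lemma no_thetaD:
  assumes "no_theta E" "distinct (a # A @ [b])" "distinct (a # B @ [b])" "distinct (a # C @ [b])"
    "pedges (a # A @ [b]) \<subseteq> E" "pedges (a # B @ [b]) \<subseteq> E" "pedges (a # C @ [b]) \<subseteq> E"
    "set A \<inter> set B = {}" "set A \<inter> set C = {}" "set B \<inter> set C = {}"
  shows "A = [] \<or> B = [] \<or> C = []"
  using assms(1)[unfolded no_theta_def, rule_format, of a A b B C] assms(2-10) by simp

lemma no_crossing_in_cycleD:
  assumes "no_crossing_in_cycle E" "distinct (a # P @ b # Q @ c # R @ d # S)"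
    "pedges (a # P @ b # Q @ c # R @ d # S @ [a]) \<subseteq> E"
  shows "{a, c} \<notin> E \<or> {b, d} \<notin> E"
  using assms(1)[unfolded no_crossing_in_cycle_def, rule_format, of a P b Q c R d S] assms(2,3) by simp

lemma subseq_set: "subseq xs ys \<Longrightarrow> x \<in> set xs \<Longrightarrow> x \<in> set ys"
  by (auto dest: list_emb_set)

lemma subseq_Cons_tail: "subseq (a # l) (v # xs) \<Longrightarrow> x \<in> set l \<Longrightarrow> x \<in> set xs"
  by (auto simp: subseq_Cons2_iff split: if_splits dest: subseq_set)

lemma subseq_ConsE:
  assumes "subseq (a # l) xs"
  obtains P Q where "xs = P @ a # Q" "subseq l Q"
  using list_emb_ConsD[OF assms] by blast

lemma subseq4_append:
  assumes "subseq [a,b,c,d] (xs @ ys)"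
  obtains "subseq [a,b,c,d] xs" | "subseq [a,b,c] xs" "d \<in> set ys" | "subseq [a,b] xs" "subseq [c,d] ys"
    | "a \<in> set xs" "subseq [b,c,d] ys" | "subseq [a,b,c,d] ys"
proof -
  obtain us vs where l: "[a,b,c,d] = us @ vs" "subseq us xs" "subseq vs ys"
    using assms by (elim subseq_appendE)
  have "us = [] \<or> us = [a] \<or> us = [a,b] \<or> us = [a,b,c] \<or> us = [a,b,c,d]"
    using l(1) by (auto simp: Cons_eq_append_conv)
  then show thesis using l that by (auto simp: subseq_singleton_left)
qed

text \<open>Crossing depends on the cyclic order only; rotating a quadruple at most exchanges the
  two edges.\<close>

lemma noncrossing_rotate:
  assumes "noncrossing E (xs @ ys)"
  shows "noncrossing E (ys @ xs)"
  unfolding noncrossing_def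
proof (intro allI impI)
  fix a b c d assume s: "subseq [a,b,c,d] (ys @ xs)"
  have nc: "{p, r} \<notin> E \<or> {q, s} \<notin> E" if "subseq A xs" "subseq B ys" "A @ B = [p,q,r,s]" for p q r s A B
  proof -
    have "subseq [p,q,r,s] (xs @ ys)" using list_emb_append_mono[OF that(1,2)] that(3) by simp
    then show ?thesis using assms unfolding noncrossing_def by blast
  qed
  from s show "{a, c} \<notin> E \<or> {b, d} \<notin> E"
  proof (cases rule: subseq4_append)
    case 1 then show ?thesis using nc[of "[]" "[a,b,c,d]" a b c d] by simp
  next
    case 2 then show ?thesis using nc[of "[d]" "[a,b,c]" d a b c]
      by (simp add: insert_commute subseq_singleton_left) blast
  next
    case 3 then show ?thesis using nc[of "[c,d]" "[a,b]" c d a b] by (simp add: insert_commute)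
  next
    case 4 then show ?thesis using nc[of "[b,c,d]" "[a]" b c d a]
      by (simp add: insert_commute subseq_singleton_left) blast
  next
    case 5 then show ?thesis using nc[of "[a,b,c,d]" "[]" a b c d] by simp
  qed
qed

lemma noncrossing_start:
  assumes "noncrossing E vs" "distinct vs" "v \<in> set vs"
  obtains xs where "noncrossing E (v # xs)" "distinct (v # xs)" "set (v # xs) = set vs"
proof -
  obtain p q where "vs = p @ v # q" using assms(3) by (meson split_list)
  then show thesis using that[of "q @ p"] noncrossing_rotate[of E p "v # q"] assms by auto
qed

text \<open>In a quadruple not contained in \<open>v # xs\<close>, the vertex \<open>v\<close> can
  only come first. Hence one of the two pairs joins \<open>xs\<close> to \<open>ys\<close>, or the
  quadruple lies in \<open>v # ys\<close>.\<close>

lemma noncrossing_cut_vertex: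
  assumes nc: "noncrossing E (v # xs)" "noncrossing E (v # ys)"
    and dist: "distinct (v # xs)" "distinct (v # ys)"
    and sep: "\<And>x y. x \<in> set xs \<Longrightarrow> y \<in> set ys \<Longrightarrow> {x, y} \<notin> E"
  shows "noncrossing E (v # xs @ ys)"
  unfolding noncrossing_def
proof (intro allI impI)
  fix a b c d assume "subseq [a,b,c,d] (v # xs @ ys)"
  then have "subseq [a,b,c,d] ((v # xs) @ ys)" by simp
  then show "{a, c} \<notin> E \<or> {b, d} \<notin> E"
  proof (cases rule: subseq4_append)
    case 1 then show ?thesis using nc(1) unfolding noncrossing_def by blast
  next
    case 2
    then have "b \<in> set xs" using subseq_Cons_tail[of a "[b,c]" v xs b] by simp
    then show ?thesis using sep 2 by auto
  next
    case 3
    then have "b \<in> set xs" "d \<in> set ys"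
      using subseq_Cons_tail[of a "[b]" v xs b] subseq_set[of "[c,d]" ys d] by simp_all
    then show ?thesis using sep by auto
  next
    case 4
    then have c: "c \<in> set ys" using subseq_set[of "[b,c,d]" ys c] by simp
    show ?thesis
    proof (cases "a = v")
      case True
      then have "subseq [a,b,c,d] (v # ys)" using 4 by auto
      then show ?thesis using nc(2) unfolding noncrossing_def by blast
    next
      case False then show ?thesis using 4 sep c by auto
    qed
  next
    case 5
    then have "subseq [a,b,c,d] (v # ys)" by (rule list_emb_Cons)
    then show ?thesis using nc(2) unfolding noncrossing_def by blast
  qed
qed

lemma noncrossing_disjoint:
  assumes nc: "noncrossing E xs" "noncrossing E ys"
    and sep: "\<And>x y. x \<in> set xs \<Longrightarrow> y \<in> set ys \<Longrightarrow> {x, y} \<notin> E"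
  shows "noncrossing E (xs @ ys)"
  unfolding noncrossing_def
proof (intro allI impI)
  fix a b c d assume "subseq [a,b,c,d] (xs @ ys)"
  then show "{a, c} \<notin> E \<or> {b, d} \<notin> E"
  proof (cases rule: subseq4_append)
    case 1 then show ?thesis using nc(1) unfolding noncrossing_def by blast
  next
    case 2
    then have "b \<in> set xs" using subseq_set[of "[a,b,c]" xs b] by simp
    then show ?thesis using sep 2 by auto
  next
    case 3
    then have "b \<in> set xs" "d \<in> set ys"
      using subseq_set[of "[a,b]" xs b] subseq_set[of "[c,d]" ys d] by simp_all
    then show ?thesis using sep by auto
  next
    case 4
    then have "c \<in> set ys" using subseq_set[of "[b,c,d]" ys c] by simp
    then show ?thesis using sep 4 by auto
  next
    case 5 then show ?thesis using nc(2) unfolding noncrossing_def by blast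
  qed
qed

text \<open>As long as the set of vertices reached from \<open>v\<close> misses \<open>T\<close>,
  the cut condition provides an edge that enlarges it.\<close>

lemma path_to_set:
  assumes conn: "cut_connected E S" and v: "v \<in> S - T" and T: "S \<inter> T \<noteq> {}"
  obtains p t where "distinct (v # p @ [t])" "set (v # p) \<subseteq> S - T" "t \<in> S \<inter> T" "pedges (v # p @ [t]) \<subseteq> E"
proof -
  define X where "X = {y \<in> S. \<exists>p. distinct (p @ [y]) \<and> hd (p @ [y]) = v \<and> set p \<subseteq> S - T \<and> pedges (p @ [y]) \<subseteq> E}"
  have "v \<in> X" using v unfolding X_def by (auto intro!: exI[of _ "[]"])
  have "X \<inter> T \<noteq> {}"
  proof
    assume XT: "X \<inter> T = {}"
    then have "X \<subset> S" using T unfolding X_def by auto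
    then obtain x y where xy: "x \<in> X" "y \<in> S - X" "{x, y} \<in> E"
      using conn \<open>v \<in> X\<close> unfolding cut_connected_def by blast
    then obtain p where p: "distinct (p @ [x])" "hd (p @ [x]) = v" "set p \<subseteq> S - T" "pedges (p @ [x]) \<subseteq> E"
      unfolding X_def by auto
    have "y \<notin> set p"
    proof
      assume "y \<in> set p"
      then obtain p1 p2 where pp: "p = p1 @ y # p2" by (meson split_list)
      then have "distinct (p1 @ [y]) \<and> hd (p1 @ [y]) = v \<and> set p1 \<subseteq> S - T \<and> pedges (p1 @ [y]) \<subseteq> E"
        using p pedges_append[of p1 y "p2 @ [x]"] by (cases p1) auto
      then show False using xy(2) unfolding X_def by blast
    qed
    moreover have "y \<noteq> x" using xy by auto
    moreover have "pedges ((p @ [x]) @ [y]) \<subseteq> E" using p(4) xy(3) pedges_append[of p x "[y]"] by auto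
    moreover have "hd ((p @ [x]) @ [y]) = v" using p(2) by (cases p) auto
    moreover have "set (p @ [x]) \<subseteq> S - T" using p(3) xy(1) XT X_def by auto
    ultimately have "y \<in> X" using xy(2) p(1) unfolding X_def by (intro CollectI conjI exI[of _ "p @ [x]"]) auto
    then show False using xy by auto
  qed
  then obtain t p where tp: "t \<in> S \<inter> T" "distinct (p @ [t])" "hd (p @ [t]) = v" "set p \<subseteq> S - T" "pedges (p @ [t]) \<subseteq> E"
    unfolding X_def by auto
  have "p \<noteq> []" using tp v by auto
  then obtain p' where "p = v # p'" using tp(3) by (cases p) auto
  then show thesis using that[of p' t] tp by auto
qed

abbreviation cycle_edges :: "'a list \<Rightarrow> 'a set set" where
  "cycle_edges cs \<equiv> pedges (cs @ [hd cs])"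

lemma cycle_edges_rotate: "cycle_edges (p @ x # q) = cycle_edges (x # q @ p)"
proof (cases p)
  case (Cons y r)
  then show ?thesis using pedges_append[of "y # r" x "q @ [y]"] pedges_append[of "x # q" y "r @ [x]"] by auto
qed simp

text \<open>
  A longest cycle is Hamiltonian: an ear with inner vertices attached to it either yields a longer
  cycle or three internally disjoint paths with inner vertices. Two adjacent vertices count as a cycle here.
\<close>

lemma hamiltonian_cycle:
  assumes fin: "finite V" and nt: "no_theta E" and c: "cut_connected E V"
    and c2: "\<And>v. v \<in> V \<Longrightarrow> cut_connected E (V - {v})" and card: "2 \<le> card V"
  obtains cs where "distinct cs" "set cs = V" "cycle_edges cs \<subseteq> E"
proof -
  define good where "good cs \<longleftrightarrow> distinct cs \<and> set cs \<subseteq> V \<and> 2 \<le> length cs \<and> cycle_edges cs \<subseteq> E" for cs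
  have "V \<noteq> {}" using card by auto
  then obtain v where v: "v \<in> V" by blast
  have "{v} \<subset> V" using v card by (auto simp: card_1_singleton_iff)
  then obtain w where "w \<in> V" "w \<noteq> v" "{v, w} \<in> E"
    using c unfolding cut_connected_def by blast
  then have "good [v, w]" using v by (auto simp: good_def insert_commute)
  have bound: "length cs \<le> card V" if "good cs" for cs
    using that fin by (metis card_mono distinct_card good_def)
  have "\<exists>cs. good cs \<and> (\<forall>cs'. good cs' \<longrightarrow> length cs' \<le> length cs)"
    by (rule ex_has_greatest_nat[of good "[v, w]" length "Suc (card V)", OF \<open>good [v, w]\<close>])
      (use bound in \<open>auto simp: less_Suc_eq_le\<close>)
  then obtain cs where cs: "good cs" and mx: "\<And>cs'. good cs' \<Longrightarrow> length cs' \<le> length cs" by blast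
  have "set cs = V"
  proof (rule ccontr)
    assume "set cs \<noteq> V"
    then have "set cs \<subset> V" "set cs \<noteq> {}" using cs by (auto simp: good_def)
    then obtain a u where a: "a \<in> set cs" and u: "u \<in> V" "u \<notin> set cs" and au: "{a, u} \<in> E"
      using c unfolding cut_connected_def by blast
    obtain p q where pq: "cs = p @ a # q" using a by (meson split_list)
    define C where "C = q @ p"
    have gC: "good (a # C)" using cs cycle_edges_rotate[of p a q] by (auto simp: good_def pq C_def)
    have sC: "set cs = set (a # C)" by (auto simp: pq C_def)
    have len: "length cs = length (a # C)" by (auto simp: pq C_def)
    have aV: "a \<in> V" using gC by (auto simp: good_def)
    \<comment> \<open>Deleting \<open>a\<close> keeps the graph connected, so a path leads from
      \<open>u\<close> back to the cycle at some \<open>b\<close> other than \<open>a\<close>, and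
      the ear has two distinct ends.\<close>
    have "(V - {a}) \<inter> set C \<noteq> {}" using gC by (cases C) (auto simp: good_def)
    moreover have "u \<in> (V - {a}) - set C" using u sC by auto
    ultimately obtain r b where r: "distinct (u # r @ [b])" "set (u # r) \<subseteq> V - {a} - set C"
      "b \<in> (V - {a}) \<inter> set C" "pedges (u # r @ [b]) \<subseteq> E"
      using path_to_set[OF c2[OF aV]] by metis
    obtain A B where AB: "C = A @ b # B" using r(3) by (meson IntD2 split_list)
    have ear: "pedges (a # (u # r) @ [b]) \<subseteq> E" using r(4) au by simp
    have "cycle_edges (a # C) = pedges (a # A @ [b]) \<union> pedges (b # B @ [a])"
      using pedges_append[of "a # A" b "B @ [a]"] by (simp add: AB)
    then have E12: "pedges (a # A @ [b]) \<subseteq> E" "pedges (b # B @ [a]) \<subseteq> E" using gC by (auto simp: good_def)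
    have dC: "distinct (a # A @ b # B)" using gC by (auto simp: good_def AB)
    have VC: "set (a # A @ b # B) \<subseteq> V" using gC by (auto simp: good_def AB)
    \<comment> \<open>If \<open>b\<close> follows \<open>a\<close> on the cycle, the ear can replace
      the edge between them.\<close>
    have "A \<noteq> []"
    proof
      assume "A = []"
      have "cycle_edges (a # (u # r) @ b # B) = pedges (a # (u # r) @ [b]) \<union> pedges (b # B @ [a])"
        using pedges_append[of "a # u # r" b "B @ [a]"] by simp
      then have "cycle_edges (a # (u # r) @ b # B) \<subseteq> E" using ear E12 by simp
      then have "good (a # (u # r) @ b # B)" using r dC VC \<open>A = []\<close> by (auto simp: good_def AB)
      from mx[OF this] show False using len AB \<open>A = []\<close> by simp
    qed
    moreover have "B \<noteq> []"
    proof
      assume "B = []"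
      have "cycle_edges (a # A @ b # rev (u # r)) = pedges (a # A @ [b]) \<union> pedges (b # rev (u # r) @ [a])"
        using pedges_append[of "a # A" b "rev (u # r) @ [a]"] by simp
      also have "pedges (b # rev (u # r) @ [a]) = pedges (a # (u # r) @ [b])"
        using pedges_rev[of "a # (u # r) @ [b]"] by simp
      finally have "cycle_edges (a # A @ b # rev (u # r)) \<subseteq> E" using ear E12 by simp
      then have "good (a # A @ b # rev (u # r))" using r dC VC \<open>B = []\<close> by (auto simp: good_def AB)
      from mx[OF this] show False using len AB \<open>B = []\<close> by simp
    qed
    moreover have "pedges (a # rev B @ [b]) \<subseteq> E" using E12(2) pedges_rev[of "b # B @ [a]"] by simp
    moreover have "distinct (a # A @ [b])" "distinct (a # rev B @ [b])" "distinct (a # (u # r) @ [b])"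
      "set A \<inter> set (rev B) = {}" "set A \<inter> set (u # r) = {}" "set (rev B) \<inter> set (u # r) = {}"
      using dC r AB by auto
    ultimately show False using no_thetaD[OF nt, of a A b "rev B" "u # r"] E12(1) ear by simp
  qed
  then show thesis using that cs by (auto simp: good_def)
qed

lemma subseq4E:
  assumes "subseq [a,b,c,d] xs"
  obtains P Q R S T where "xs = P @ a # Q @ b # R @ c # S @ d # T"
proof -
  obtain P xs1 where 1: "xs = P @ a # xs1" "subseq [b,c,d] xs1" using assms by (rule subseq_ConsE)
  obtain Q xs2 where 2: "xs1 = Q @ b # xs2" "subseq [c,d] xs2" using 1(2) by (rule subseq_ConsE)
  obtain R xs3 where 3: "xs2 = R @ c # xs3" "subseq [d] xs3" using 2(2) by (rule subseq_ConsE)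
  obtain S T where 4: "xs3 = S @ d # T" using 3(2) by (rule subseq_ConsE)
  show thesis using that 1 2 3 4 by simp
qed

text \<open>\<open>E\<close> stays fixed while \<open>V\<close> shrinks, as
  \<open>cut_connected\<close> only looks at edges within its set. Pieces separated by a vertex are
  merged at that vertex. If there is no such vertex, the order is that of a Hamiltonian cycle, where
  interleaving edges are crossing chords.\<close>

theorem noncrossing_order:
  assumes "no_theta E" "no_crossing_in_cycle E" "finite V"
  shows "\<exists>vs. distinct vs \<and> set vs = V \<and> noncrossing E vs"
  using assms(3)
proof (induction "card V" arbitrary: V rule: less_induct)
  case less
  have "card V \<le> 1 \<or> 2 \<le> card V" by linarith
  then consider "card V \<le> 1" | "2 \<le> card V" "\<not> cut_connected E V"
    | v where "v \<in> V" "\<not> cut_connected E (V - {v})"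
    | "2 \<le> card V" "cut_connected E V" "\<And>v. v \<in> V \<Longrightarrow> cut_connected E (V - {v})" by blast
  then show ?case
  proof cases
    case 1
    obtain vs where vs: "distinct vs" "set vs = V" using finite_distinct_list less.prems by blast
    then have l: "length vs \<le> 1" using 1 by (metis distinct_card)
    have "\<not> subseq [a,b,c,d] vs" for a b c d
      using list_emb_length[of "(=)" "[a,b,c,d]" vs] l by auto
    then show ?thesis using vs by (auto simp: noncrossing_def)
  next
    case 2
    then obtain X where X: "X \<subset> V" "X \<noteq> {}" and no: "\<And>x y. x \<in> X \<Longrightarrow> y \<in> V - X \<Longrightarrow> {x, y} \<notin> E"
      unfolding cut_connected_def by blast
    have "card X < card V" "card (V - X) < card V" "finite X" "finite (V - X)"
      using X less.prems by (auto intro!: psubset_card_mono simp: finite_subset)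
    then obtain xs ys where "distinct xs" "set xs = X" "noncrossing E xs" "distinct ys" "set ys = V - X" "noncrossing E ys"
      using less.hyps[of X] less.hyps[of "V - X"] by blast
    then show ?thesis using noncrossing_disjoint[of E xs ys] no X by (intro exI[of _ "xs @ ys"]) auto
  next
    case 3
    then obtain X where X: "X \<subset> V - {v}" "X \<noteq> {}" and no: "\<And>x y. x \<in> X \<Longrightarrow> y \<in> V - {v} - X \<Longrightarrow> {x, y} \<notin> E"
      unfolding cut_connected_def by blast
    have "insert v X \<subset> V" "V - X \<subset> V" using X 3(1) by auto
    then have "card (insert v X) < card V" "card (V - X) < card V" "finite (insert v X)" "finite (V - X)"
      using less.prems by (auto intro!: psubset_card_mono simp: finite_subset)
    then obtain xs ys where xs: "distinct xs" "set xs = insert v X" "noncrossing E xs"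
      and ys: "distinct ys" "set ys = V - X" "noncrossing E ys"
      using less.hyps[of "insert v X"] less.hyps[of "V - X"] by blast
    obtain xs' where xs': "noncrossing E (v # xs')" "distinct (v # xs')" "set (v # xs') = insert v X"
      using noncrossing_start[OF xs(3,1), of v] xs(2) by auto
    have "v \<in> set ys" using ys X 3(1) by auto
    then obtain ys' where ys': "noncrossing E (v # ys')" "distinct (v # ys')" "set (v # ys') = V - X"
      using noncrossing_start[OF ys(3,1), of v] ys(2) by auto
    have s: "set xs' = X" "set ys' = V - {v} - X" using xs' ys' X by auto
    have "noncrossing E (v # xs' @ ys')"
      using noncrossing_cut_vertex[OF xs'(1) ys'(1) xs'(2) ys'(2)] no unfolding s by blast
    then show ?thesis using s xs'(2) ys'(2) X 3(1) by (intro exI[of _ "v # xs' @ ys'"]) auto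
  next
    case 4
    obtain cs where cs: "distinct cs" "set cs = V" "cycle_edges cs \<subseteq> E"
      using hamiltonian_cycle[OF less.prems assms(1) 4(2,3,1)] by blast
    have "noncrossing E cs"
      unfolding noncrossing_def
    proof (intro allI impI)
      fix a b c d assume "subseq [a,b,c,d] cs"
      then obtain P Q R S T where e: "cs = P @ a # Q @ b # R @ c # S @ d # T" by (elim subseq4E)
      have "cycle_edges (a # Q @ b # R @ c # S @ d # T @ P) \<subseteq> E"
        using cs(3) cycle_edges_rotate[of P a "Q @ b # R @ c # S @ d # T"] unfolding e by simp
      moreover have "distinct ((a # Q @ b # R @ c # S @ d # T) @ P)"
        using cs(1) unfolding e by (metis distinct_append inf_commute)
      ultimately show "{a, c} \<notin> E \<or> {b, d} \<notin> E"
        using no_crossing_in_cycleD[OF assms(2), of a Q b R c S d "T @ P"] by simp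
    qed
    then show ?thesis using cs by blast
  qed
qed

subsection \<open>Formal positions in a tree of parallelograms\<close>

type_synonym colour = "bool \<times> nat"

text \<open>
  A list \<open>[(n\<^sub>0, e\<^sub>0), (n\<^sub>1, e\<^sub>1), \<dots>]\<close> is a walk in the tree of parallelograms: on level \<open>k\<close>, climb a ladder
  of \<open>n\<^sub>k\<close> parallelograms, then turn to the left (\<open>e\<^sub>k\<close> false) or right (\<open>e\<^sub>k\<close> true) side of the next one.
  A colour is a pair of the parity of the level and an index below 5. On ladders entered by a left turn
  the indices are \<open>0,2,3,4,2,3,4,\<dots>\<close> and on ladders entered by a right turn \<open>1,3,4,2,3,4,2,\<dots>\<close>: the first
  index of a ladder does not recur, and three consecutive ones are distinct. The value \<open>2\<close> comes late
  after a right turn, which settles the only delicate case of \<open>distinct_colours_impossible\<close>.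
\<close>

fun cycle3 :: "nat \<Rightarrow> nat" where
  "cycle3 0 = 2"
| "cycle3 (Suc 0) = 3"
| "cycle3 (Suc (Suc 0)) = 4"
| "cycle3 (Suc (Suc (Suc n))) = cycle3 n"

lemma cycle3_bounds: "2 \<le> cycle3 n \<and> cycle3 n < 5"
  by (induction n rule: cycle3.induct) auto

lemma cycle3_eqD: "cycle3 m = cycle3 n \<Longrightarrow> m = n \<or> m + 3 \<le> n \<or> n + 3 \<le> m"
proof (induction m arbitrary: n rule: cycle3.induct)
  case 1 then show ?case by (cases n rule: cycle3.cases) auto
next
  case 2
  show ?case
  proof (cases n rule: cycle3.cases)
    case (4 k) then show ?thesis using 2 by (cases k rule: cycle3.cases) auto
  qed (use 2 in auto)
next
  case 3
  show ?case
  proof (cases n rule: cycle3.cases)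
    case (4 k) then show ?thesis using 3 by (cases k rule: cycle3.cases) auto
  qed (use 3 in auto)
next
  case (4 m)
  then show ?case
  proof (cases n rule: cycle3.cases)
    case (4 k)
    then show ?thesis using "4.IH"[of k] "4.prems" by auto
  next
    case 2 then show ?thesis using "4.prems" by (cases m rule: cycle3.cases) auto
  next
    case 3 then show ?thesis using "4.prems" by (cases m rule: cycle3.cases) auto
  qed auto
qed

fun colour_index :: "bool \<Rightarrow> nat \<Rightarrow> nat" where
  "colour_index t 0 = of_bool t"
| "colour_index False (Suc n) = cycle3 n"
| "colour_index True (Suc n) = cycle3 (Suc n)"

lemma colour_index_less: "colour_index t n < 5"
  using cycle3_bounds by (cases "(t, n)" rule: colour_index.cases) (auto simp del: cycle3.simps)

lemma colour_index_le_1_iff: "colour_index t n \<le> 1 \<longleftrightarrow> n = 0"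
proof (cases n)
  case (Suc k)
  then show ?thesis using cycle3_bounds[of k] cycle3_bounds[of "Suc k"] by (cases t) (auto simp del: cycle3.simps)
qed simp

lemma colour_index_True_pos: "colour_index True n > 0"
  using colour_index_le_1_iff[of True n] by (cases n) (auto simp del: cycle3.simps)

lemma colour_index_eqD:
  assumes "colour_index t n = colour_index t n'"
  shows "n = n' \<or> n + 3 \<le> n' \<or> n' + 3 \<le> n"
proof (cases "n = 0 \<or> n' = 0")
  case True then show ?thesis using assms colour_index_le_1_iff[of t n] colour_index_le_1_iff[of t n'] colour_index_le_1_iff[of t 0] by auto
next
  case False
  then obtain m m' where "n = Suc m" "n' = Suc m'" using not0_implies_Suc by blast
  then show ?thesis using assms cycle3_eqD[of m m'] cycle3_eqD[of "Suc m" "Suc m'"] by (cases t) (auto simp del: cycle3.simps)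
qed

lemma colour_index_True_eq_2D: "colour_index True n = 2 \<Longrightarrow> 3 \<le> n"
  by (cases "(True, n)" rule: colour_index.cases; cases "n - 1" rule: cycle3.cases) auto

lemma colour_index_0: "colour_index t 0 = of_bool t"
  by simp

definition rung_colour :: "bool \<Rightarrow> bool \<Rightarrow> nat \<Rightarrow> colour" where
  "rung_colour c t n = (c, colour_index t n)"

definition rungs :: "bool \<Rightarrow> bool \<Rightarrow> nat \<Rightarrow> colour multiset multiset" where
  "rungs c t n = image_mset (\<lambda>i. {#rung_colour c t i#}) (mset_set {..<n})"

fun first_turn :: "(nat \<times> bool) list \<Rightarrow> bool" where
  "first_turn [] = False"
| "first_turn ((n, e) # ps) = e"

text \<open>
  Positions are polynomials in the colours with natural coefficients, represented as multisets of
  monomials, where a monomial is a multiset of colours. The arguments are the parity of the level and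
  the turn by which the ladder was entered. \<open>position_rest\<close> omits the constant term; \<open>direction\<close> is the
  direction of the edge reached by the walk.
\<close>

fun position :: "bool \<Rightarrow> bool \<Rightarrow> (nat \<times> bool) list \<Rightarrow> colour multiset multiset" where
  "position c t [] = {#}"
| "position c t ((n, e) # ps) = replicate_mset (of_bool e) {#} + rungs c t n +
     image_mset (add_mset (rung_colour c t n)) (position (\<not> c) e ps)"

fun position_rest :: "bool \<Rightarrow> bool \<Rightarrow> (nat \<times> bool) list \<Rightarrow> colour multiset multiset" where
  "position_rest c t [] = {#}"
| "position_rest c t ((n, e) # ps) = rungs c t (n + of_bool (first_turn ps)) + image_mset (add_mset (rung_colour c t n)) (position_rest (\<not> c) e ps)"

fun direction :: "bool \<Rightarrow> bool \<Rightarrow> (nat \<times> bool) list \<Rightarrow> colour multiset" where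
  "direction c t [] = {#}"
| "direction c t ((n, e) # ps) = add_mset (rung_colour c t n) (direction (\<not> c) e ps)"

lemma rungs_0 [simp]: "rungs c t 0 = {#}"
  by (simp add: rungs_def)

lemma rungs_Suc [simp]: "rungs c t (Suc n) = add_mset {#rung_colour c t n#} (rungs c t n)"
  by (simp add: rungs_def lessThan_Suc)

lemma size_rungs [simp]: "size (rungs c t n) = n"
  by (induction n) auto

lemma in_rungs_iff: "\<nu> \<in># rungs c t n \<longleftrightarrow> (\<exists>i<n. \<nu> = {#rung_colour c t i#})"
  by (auto simp: rungs_def)

text \<open>Colours recur along a ladder, so multiplicities have to be compared instead of
  membership.\<close>

lemma count_rungs_less:
  assumes "m \<le> i" "i < m'"
  shows "count (rungs c t m) {#rung_colour c t i#} < count (rungs c t m') {#rung_colour c t i#}"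
  using assms(2)
proof (induction m')
  case (Suc m')
  have mono: "count (rungs c t m) \<nu> \<le> count (rungs c t k) \<nu>" if "m \<le> k" for k \<nu>
    using that by (induction rule: dec_induct) auto
  show ?case using Suc assms(1) mono[of m' "{#rung_colour c t i#}"] by (cases "i = m'") auto
qed simp

text \<open>The constant term of the next level, multiplied by \<open>rung_colour c t n\<close>,
  looks like one further rung. So degree one shows \<open>n + of_bool (first_turn ps)\<close> rungs,
  not \<open>n\<close>.\<close>

lemma position_eq_position_rest: "position c t ps = replicate_mset (of_bool (first_turn ps)) {#} + position_rest c t ps"
proof (induction ps arbitrary: c t)
  case (Cons p ps)
  then show ?case by (cases p; cases "first_turn ps") (auto simp: algebra_simps)
qed simp

lemma position_rest_nonempty_mono: "\<nu> \<in># position_rest c t ps \<Longrightarrow> \<nu> \<noteq> {#}"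
  by (cases "(c, t, ps)" rule: position_rest.cases) (auto simp: in_rungs_iff)

lemma in_PsiE:
  assumes "\<nu> \<in># position_rest c t ((n, e) # ps)"
  obtains i where "i < n + of_bool (first_turn ps)" "\<nu> = {#rung_colour c t i#}"
  | \<nu>' where "\<nu>' \<in># position_rest (\<not> c) e ps" "\<nu> = add_mset (rung_colour c t n) \<nu>'"
  using assms by (auto simp: in_rungs_iff)

lemma position_rest_class:
  assumes "\<nu> \<in># position_rest c t ps"
  shows "\<exists>i. (c, colour_index t i) \<in># \<nu>"
  using assms by (cases "(c, t, ps)" rule: position_rest.cases) (auto simp: in_rungs_iff rung_colour_def)

lemma size_direction [simp]: "size (direction c t ps) = length ps"
  by (induction c t ps rule: direction.induct) auto

text \<open>Every monomial is a prefix of the direction times one colour of the ladder reached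
  there. Replacing this colour by the first one of the same ladder gives another monomial of the
  position; as first colours are reserved, this is what contradicts a symmetry later.\<close>

lemma position_rest_structure:
  assumes "\<nu> \<in># position_rest c t xs"
  shows "\<exists>j < length xs. \<exists>t' i. \<nu> = add_mset (rung_colour (c \<noteq> odd j) t' i) (direction c t (take j xs)) \<and>
    add_mset (rung_colour (c \<noteq> odd j) t' 0) (direction c t (take j xs)) \<in># position_rest c t xs"
  using assms
proof (induction xs arbitrary: c t \<nu>)
  case (Cons p xs)
  obtain n e where p: "p = (n, e)" by (cases p)
  from Cons.prems[unfolded p] show ?case
  proof (cases rule: in_PsiE)
    case (1 i)
    then have "{#rung_colour c t 0#} \<in># position_rest c t (p # xs)"
      by (auto simp: p in_rungs_iff simp del: colour_index.simps intro!: disjI1 exI[of _ 0])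
    then show ?thesis using 1 by (intro exI[of _ 0] conjI exI[of _ t] exI[of _ i]) (auto simp: p)
  next
    case (2 \<nu>')
    from Cons.IH[OF 2(1)] obtain j t' i where j: "j < length xs"
      "\<nu>' = add_mset (rung_colour ((\<not> c) \<noteq> odd j) t' i) (direction (\<not> c) e (take j xs))"
      "add_mset (rung_colour ((\<not> c) \<noteq> odd j) t' 0) (direction (\<not> c) e (take j xs)) \<in># position_rest (\<not> c) e xs" by blast
    have "((\<not> c) \<noteq> odd j) = (c \<noteq> odd (Suc j))" by auto
    moreover have "add_mset (rung_colour c t n) (add_mset (rung_colour ((\<not> c) \<noteq> odd j) t' 0) (direction (\<not> c) e (take j xs))) \<in># position_rest c t (p # xs)"
      using j(3) by (auto simp: p)
    ultimately show ?thesis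
      using j(1,2) 2(2) by (intro exI[of _ "Suc j"] conjI exI[of _ t'] exI[of _ i]) (auto simp: p add_mset_commute)
  qed
qed simp

section \<open>Mirror symmetry of a difference of two positions\<close>

definition coeff_diff :: "'a multiset \<Rightarrow> 'a multiset \<Rightarrow> 'a \<Rightarrow> int" where
  "coeff_diff w b \<nu> = int (count w \<nu>) - int (count b \<nu>)"

text \<open>Invariance of \<open>(w - b) / z\<close> under inversion of all colours, without negative exponents.\<close>

definition symmetric_about :: "'a multiset \<Rightarrow> 'a multiset multiset \<Rightarrow> 'a multiset multiset \<Rightarrow> bool" where
  "symmetric_about z w b \<longleftrightarrow> (\<forall>\<nu>. coeff_diff w b \<nu> \<noteq> 0 \<longrightarrow> (\<exists>\<kappa>. \<nu> + \<kappa> = z + z \<and> coeff_diff w b \<kappa> = coeff_diff w b \<nu>))"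

lemma coeff_diff_neg_mem: "coeff_diff w b \<nu> < 0 \<Longrightarrow> \<nu> \<in># b"
  by (auto simp: coeff_diff_def simp flip: count_greater_zero_iff)

lemma coeff_diff_pos_mem: "coeff_diff w b \<nu> > 0 \<Longrightarrow> \<nu> \<in># w"
  by (auto simp: coeff_diff_def simp flip: count_greater_zero_iff)

lemma direction_snoc_class: "\<exists>i t'. direction c t (ps @ [(n, e)]) = add_mset (rung_colour (c \<noteq> odd (length ps)) t' i) (direction c t ps)"
proof (induction ps arbitrary: c t)
  case (Cons p ps)
  obtain n' e' where p: "p = (n', e')" by (cases p)
  from Cons.IH[of "\<not> c" e'] show ?case by (auto simp: p add_mset_commute)
qed auto

lemma direction_take_Suc:
  assumes "j < length ps"
  shows "\<exists>i t'. direction c t (take (Suc j) ps) = add_mset (rung_colour (c \<noteq> odd j) t' i) (direction c t (take j ps))"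
  using direction_snoc_class[of c t "take j ps" "fst (ps ! j)" "snd (ps ! j)"] assms
  by (simp add: take_Suc_conv_app_nth)

lemma two_eq_iff: "{#a, b#} = {#c, d#} \<longleftrightarrow> a = c \<and> b = d \<or> a = d \<and> b = c"
proof
  assume eq: "{#a, b#} = {#c, d#}"
  then have "a \<in># {#c, d#}" by (metis union_single_eq_member)
  then show "a = c \<and> b = d \<or> a = d \<and> b = c" using eq by (auto simp: add_mset_commute)
qed (auto simp: add_mset_commute)
lemma edge_structure:
  assumes "\<nu> \<in># position c t (ps @ [(n, False)])"
  shows "\<nu> = {#} \<or> (\<exists>j \<le> length ps. \<exists>t' i. \<nu> = add_mset (rung_colour (c \<noteq> odd j) t' i) (direction c t (take j ps)))"
proof (cases "\<nu> = {#}")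
  case False
  then have "\<nu> \<in># position_rest c t (ps @ [(n, False)])" using assms by (auto simp: position_eq_position_rest split: if_splits)
  from position_rest_structure[OF this] show ?thesis by (force simp: less_Suc_eq_le)
qed simp

lemma edge_size: "\<nu> \<in># position c t (ps @ [(n, False)]) \<Longrightarrow> size \<nu> \<le> Suc (length ps)"
  using edge_structure by fastforce

text \<open>The degrees add up to twice that of \<open>z\<close> and exceed it by at most one. If
  they are equal, both monomials extend the same prefix of \<open>z\<close> by one colour, and the
  two colours must be the last one of \<open>z\<close>. If they differ by two, the two colours left
  over have the same parity, but the last two colours of \<open>z\<close> have different
  ones.\<close>

lemma edge_pair_eq:
  assumes b: "\<nu> \<in># position c t (ps @ [(n, False)])" "\<kappa> \<in># position c t (ps @ [(n, False)])"
    and z: "z = direction c t ps" and sum: "\<nu> + \<kappa> = z + z" and le: "size \<nu> \<le> size \<kappa>"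
  shows "\<nu> = z"
proof -
  let ?d = "length ps"
  have sz: "size \<nu> + size \<kappa> = 2 * ?d" using arg_cong[OF sum, of size] by (simp add: z)
  have ek: "\<kappa> = {#} \<or> (\<exists>j \<le> ?d. \<exists>t' i. \<kappa> = add_mset (rung_colour (c \<noteq> odd j) t' i) (direction c t (take j ps)))"
    by (rule edge_structure[OF b(2)])
  show ?thesis
  proof (cases "?d = 0")
    case True then show ?thesis using sz by (simp add: z)
  next
    case False
    then have "\<kappa> \<noteq> {#}" using sz le by auto
    then obtain j t1 i1 where k: "j \<le> ?d" "\<kappa> = add_mset (rung_colour (c \<noteq> odd j) t1 i1) (direction c t (take j ps))"
      using ek by blast
    have sk: "size \<kappa> = Suc j" using k by simp
    consider "\<nu> = {#}" | j' t2 i2 where "j' \<le> ?d" "\<nu> = add_mset (rung_colour (c \<noteq> odd j') t2 i2) (direction c t (take j' ps))"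
      using edge_structure[OF b(1)] by blast
    then show ?thesis
    proof cases
      case 1
      then have "Suc j = 2 * ?d" using sz sk by simp
      then have d1: "?d = 1" "j = 1" using k(1) False by linarith+
      then obtain n0 e0 where ps: "ps = [(n0, e0)]" by (cases ps) (auto simp: length_Suc_conv)
      have "\<kappa> = z + z" using sum 1 by simp
      then show ?thesis using k(2) by (simp add: d1 ps z rung_colour_def)
    next
      case (2 j' t2 i2)
      have sn: "size \<nu> = Suc j'" using 2 by simp
      have jj: "j + j' + 2 = 2 * ?d" "j' \<le> j" using sz sk sn le by auto
      then have "j = ?d - 1 \<and> j' = ?d - 1 \<or> j = ?d \<and> j' = ?d - 2 \<and> ?d \<ge> 2" using k(1) False by arith
      then consider "j = ?d - 1" "j' = ?d - 1" | "j = ?d" "j' = ?d - 2" "?d \<ge> 2" by blast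
      then show ?thesis
      proof cases
        case a: 1
        obtain i3 t3 where z3: "z = add_mset (rung_colour (c \<noteq> odd (?d - 1)) t3 i3) (direction c t (take (?d - 1) ps))"
          using direction_take_Suc[of "?d - 1" ps c t] False by (auto simp: z)
        then have "{#rung_colour (c \<noteq> odd j') t2 i2, rung_colour (c \<noteq> odd j) t1 i1#} =
            {#rung_colour (c \<noteq> odd (?d - 1)) t3 i3, rung_colour (c \<noteq> odd (?d - 1)) t3 i3#}"
          using sum unfolding 2 k a by (simp add: ac_simps)
        then have "rung_colour (c \<noteq> odd j') t2 i2 = rung_colour (c \<noteq> odd (?d - 1)) t3 i3" unfolding two_eq_iff by blast
        then show ?thesis using z3 2(2) a(2) by simp
      next
        case a: 2
        obtain d where d: "?d = Suc (Suc d)" using a(3) by (metis add_2_eq_Suc le_Suc_ex)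
        obtain i3 t3 where z3: "z = add_mset (rung_colour (c \<noteq> odd (Suc d)) t3 i3) (direction c t (take (Suc d) ps))"
          using direction_take_Suc[of "Suc d" ps c t] d by (auto simp: z)
        obtain i4 t4 where z4: "direction c t (take (Suc d) ps) = add_mset (rung_colour (c \<noteq> odd d) t4 i4) (direction c t (take d ps))"
          using direction_take_Suc[of d ps c t] d by auto
        have k': "\<kappa> = add_mset (rung_colour (c \<noteq> odd d) t1 i1) z" using k(2) a(1) d by (simp add: z)
        have n': "\<nu> = add_mset (rung_colour (c \<noteq> odd d) t2 i2) (direction c t (take d ps))" using 2(2) a(2) d by simp
        have "\<nu> + add_mset (rung_colour (c \<noteq> odd d) t1 i1) {#} = z" using sum unfolding k' by simp
        then have "{#rung_colour (c \<noteq> odd d) t2 i2, rung_colour (c \<noteq> odd d) t1 i1#} =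
            {#rung_colour (c \<noteq> odd (Suc d)) t3 i3, rung_colour (c \<noteq> odd d) t4 i4#}"
          unfolding n' z3 z4 by (simp add: ac_simps)
        then show ?thesis unfolding two_eq_iff rung_colour_def by auto
      qed
    qed
  qed
qed

lemma edge_pair_eq':
  assumes b: "\<nu> \<in># position c t (ps @ [(n, False)])" "\<kappa> \<in># position c t (ps @ [(n, False)])"
    and z: "z = direction c t ps" and sum: "\<nu> + \<kappa> = z + z"
  shows "\<nu> = z"
proof (cases "size \<nu> \<le> size \<kappa>")
  case False
  then have "\<kappa> = z" using edge_pair_eq[OF b(2,1) z] sum by (simp add: ac_simps)
  then show ?thesis using sum by simp
qed (use edge_pair_eq[OF assms] in simp)

text \<open>
  A negative coefficient of \<open>w - b\<close> and its mirror image both come from \<open>b\<close>, whose degree exceeds that of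
  \<open>z\<close> by at most one.
\<close>

lemma symmetric_about_nonneg:
  assumes "symmetric_about (direction c t ps) w (position c t (ps @ [(n, False)]))" "\<nu> \<noteq> direction c t ps"
  shows "coeff_diff w (position c t (ps @ [(n, False)])) \<nu> \<ge> 0"
proof (rule ccontr)
  assume neg: "\<not> ?thesis"
  then obtain \<kappa> where "\<nu> + \<kappa> = direction c t ps + direction c t ps"
    "coeff_diff w (position c t (ps @ [(n, False)])) \<kappa> = coeff_diff w (position c t (ps @ [(n, False)])) \<nu>"
    using assms(1) unfolding symmetric_about_def by force
  then show False using edge_pair_eq'[OF coeff_diff_neg_mem coeff_diff_neg_mem refl] neg assms(2) by (metis not_le)
qed

text \<open>
  The monomials of a walk that turns left at the first parallelogram of every ladder (except that the
  first turn is \<open>e\<close>). The first vertices of a walk that are visible in its position have such monomials.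
\<close>

fun lazy_monomial :: "bool \<Rightarrow> bool \<Rightarrow> bool \<Rightarrow> nat \<Rightarrow> colour multiset" where
  "lazy_monomial c t e 0 = {#}"
| "lazy_monomial c t e (Suc j) = add_mset (rung_colour c t 0) (lazy_monomial (\<not> c) e False j)"

lemma in_lazy_monomial: "y \<in># lazy_monomial c t e j \<Longrightarrow> y \<in> {(c, colour_index t 0), (c, 0), (\<not> c, colour_index e 0), (\<not> c, 0)}"
  by (induction c t e j rule: lazy_monomial.induct) (auto simp: rung_colour_def colour_index_0)

lemma lazy_monomial_in_position_rest: "position_rest c t xs \<noteq> {#} \<Longrightarrow> \<exists>j. lazy_monomial c t (first_turn xs) j \<in># position_rest c t xs"
proof (induction xs arbitrary: c t)
  case (Cons p xs)
  obtain n e where p: "p = (n, e)" by (cases p)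
  show ?case
  proof (cases "n + of_bool (first_turn xs) = 0")
    case True
    then have *: "n = 0" "first_turn xs = False" by (auto split: if_splits)
    then have "position_rest (\<not> c) e xs \<noteq> {#}" using Cons.prems by (auto simp: p)
    from Cons.IH[OF this] obtain j where "lazy_monomial (\<not> c) e (first_turn xs) j \<in># position_rest (\<not> c) e xs" by blast
    then show ?thesis using * by (intro exI[of _ "Suc j"]) (auto simp: p)
  next
    case False
    then show ?thesis by (intro exI[of _ 1]) (auto simp: p in_rungs_iff)
  qed
qed simp

text \<open>Once the walk climbs a rung or faces a right turn on the next level, the first colour of
  the current ladder completes a lazy monomial of the position. If this never happens before the
  last ladder, the direction itself is lazy.\<close>

lemma lazy_monomial_edge:
  fixes ps n defines "xs \<equiv> ps @ [(n, False)]"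
  shows "(\<exists>j. lazy_monomial c t (first_turn xs) j \<in># position_rest c t xs \<and> lazy_monomial c t (first_turn xs) j \<noteq> direction c t ps) \<or>
    direction c t ps = lazy_monomial c t (first_turn xs) (length ps)"
  unfolding xs_def
proof (induction ps arbitrary: c t)
  case (Cons p ps)
  obtain m e where p: "p = (m, e)" by (cases p)
  let ?h = "first_turn (ps @ [(n, False)])"
  show ?case
  proof (cases "m + of_bool ?h = 0")
    case True
    then have *: "m = 0" "?h = False" by (auto split: if_splits)
    from Cons.IH[of "\<not> c" e] show ?thesis
    proof
      assume "\<exists>j. lazy_monomial (\<not> c) e ?h j \<in># position_rest (\<not> c) e (ps @ [(n, False)]) \<and> lazy_monomial (\<not> c) e ?h j \<noteq> direction (\<not> c) e ps"
      then obtain j where "lazy_monomial (\<not> c) e ?h j \<in># position_rest (\<not> c) e (ps @ [(n, False)])" "lazy_monomial (\<not> c) e ?h j \<noteq> direction (\<not> c) e ps"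
        by blast
      then show ?thesis using * by (intro disjI1 exI[of _ "Suc j"]) (auto simp: p)
    qed (use * p in auto)
  next
    case False
    have "{#rung_colour c t 0#} \<noteq> direction c t (p # ps)"
    proof
      assume "{#rung_colour c t 0#} = direction c t (p # ps)"
      then have "direction (\<not> c) e ps = {#}" "rung_colour c t m = rung_colour c t 0" by (auto simp: p)
      then have "ps = []" "colour_index t m \<le> 1"
        using size_direction[of "\<not> c" e ps] colour_index_le_1_iff[of t 0] by (auto simp: rung_colour_def simp del: size_direction)
      then have "ps = []" "m = 0" using colour_index_le_1_iff[of t m] by auto
      then show False using False by simp
    qed
    then show ?thesis using False by (intro disjI1 exI[of _ 1]) (auto simp: p in_rungs_iff)
  qed
qed simp

lemma in_PhiE:
  assumes "\<nu> \<in># position c t ((n, e) # ps)"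
  obtains "\<nu> = {#}" e | i where "i < n + of_bool (first_turn ps)" "\<nu> = {#rung_colour c t i#}"
  | \<nu>' where "\<nu>' \<in># position_rest (\<not> c) e ps" "\<nu> = add_mset (rung_colour c t n) \<nu>'"
proof (cases "\<nu> = {#} \<and> e")
  case False
  then have "\<nu> \<in># position_rest c t ((n, e) # ps)" using assms by (auto simp: position_eq_position_rest simp del: position_rest.simps split: if_splits)
  then show thesis using that by (elim in_PsiE) auto
qed (use that in auto)

lemma position_size_ge_2E:
  assumes "\<nu> \<in># position c t ((n, e) # ps)" "2 \<le> size \<nu>"
  obtains \<nu>' where "\<nu>' \<in># position_rest (\<not> c) e ps" "\<nu> = add_mset (rung_colour c t n) \<nu>'"
  using assms by (elim in_PhiE) auto

lemma position_rest_into_position: "\<nu> \<in># position_rest (\<not> c) e ps \<Longrightarrow> add_mset (rung_colour c t n) \<nu> \<in># position c t ((n, e) # ps)"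
  by (auto simp: position_eq_position_rest simp del: position.simps)

lemma count_position_empty: "count (position c t ((n, e) # ps)) {#} = of_bool e"
proof -
  have "count (position_rest c t ((n, e) # ps)) {#} = 0" using position_rest_nonempty_mono by (metis count_inI)
  then show ?thesis by (simp add: position_eq_position_rest del: position.simps position_rest.simps)
qed

lemma count_position_single:
  "count (position c t ((n, e) # ps)) {#y#} = count (rungs c t (n + of_bool (first_turn ps))) {#y#}"
proof -
  have "{#y#} \<notin># image_mset (add_mset (rung_colour c t n)) (position_rest (\<not> c) e ps)"
    using position_rest_nonempty_mono by auto
  then show ?thesis by (simp add: position_eq_position_rest count_eq_zero_iff del: position.simps)
qed

lemma symmetric_about_posE:
  assumes "symmetric_about z w b" "coeff_diff w b \<nu> > 0"
  obtains \<kappa> where "\<nu> + \<kappa> = z + z" "coeff_diff w b \<kappa> > 0"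
  using assms unfolding symmetric_about_def by (metis less_irrefl)

text \<open>By the constant terms, \<open>w\<close> turns right and \<open>b\<close> left. Every
  monomial of \<open>w\<close> of degree at least two then has a colour from a ladder entered by a
  right turn, of positive index, whereas in this parity a lazy monomial after a left turn only has
  index 0. But symmetry puts a monomial built from \<open>?x\<close> and lazy colours into
  \<open>w\<close>: one taken from \<open>b\<close>, or \<open>z + z\<close> if the direction is
  lazy.\<close>

lemma opposite_turns_impossible:
  fixes c t e e' :: bool and n ps n0 n0' q
  defines "r \<equiv> ps @ [(n, False)]"
  defines "b \<equiv> position c t ((n0, e) # r)" and "w \<equiv> position c t ((n0', e') # q)" and "z \<equiv> direction c t ((n0, e) # ps)"
  assumes s: "symmetric_about z w b" and e: "e \<noteq> e'"
  shows False
proof -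
  have nonneg: "coeff_diff w b \<nu> \<ge> 0" if "\<nu> \<noteq> z" for \<nu>
    using symmetric_about_nonneg[of c t "(n0, e) # ps" w n \<nu>] s that by (simp add: b_def r_def z_def del: position.simps)
  have "coeff_diff w b {#} \<ge> 0" by (rule nonneg) (simp add: z_def)
  then have ee: "\<not> e" "e'" using e by (auto simp: coeff_diff_def b_def w_def count_position_empty simp del: position.simps)
  let ?x = "rung_colour c t n0" and ?x' = "rung_colour c t n0'"
  have R: False if nw: "\<nu> \<in># w" "2 \<le> size \<nu>" "\<And>y. y \<in># \<nu> \<Longrightarrow> y = ?x \<or> y \<in># lazy_monomial (\<not> c) False (first_turn r) j" for \<nu> j
  proof -
    obtain \<nu>' where \<nu>': "\<nu>' \<in># position_rest (\<not> c) True q" "\<nu> = add_mset ?x' \<nu>'"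
      using position_size_ge_2E[of \<nu> c t n0' e' q] nw ee(2) unfolding w_def by (metis (full_types))
    obtain i where "(\<not> c, colour_index True i) \<in># \<nu>" using position_rest_class[OF \<nu>'(1)] \<nu>'(2) by auto
    from nw(3)[OF this] show False using in_lazy_monomial[of "(\<not> c, colour_index True i)" "\<not> c" False "first_turn r" j] colour_index_True_pos[of i]
      by (auto simp: rung_colour_def)
  qed
  from lazy_monomial_edge[of "\<not> c" False ps n, folded r_def] show False
  proof
    assume "\<exists>j. lazy_monomial (\<not> c) False (first_turn r) j \<in># position_rest (\<not> c) False r \<and> lazy_monomial (\<not> c) False (first_turn r) j \<noteq> direction (\<not> c) False ps"
    then obtain j where j: "lazy_monomial (\<not> c) False (first_turn r) j \<in># position_rest (\<not> c) False r" "lazy_monomial (\<not> c) False (first_turn r) j \<noteq> direction (\<not> c) False ps"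
      by blast
    let ?\<nu> = "add_mset ?x (lazy_monomial (\<not> c) False (first_turn r) j)"
    have "?\<nu> \<in># b" using position_rest_into_position[OF j(1)] ee by (simp add: b_def del: position.simps)
    moreover have "?\<nu> \<noteq> z" using j(2) ee by (simp add: z_def)
    ultimately have "?\<nu> \<in># w" using nonneg[of ?\<nu>] by (auto simp: coeff_diff_def simp flip: count_greater_zero_iff)
    moreover have "lazy_monomial (\<not> c) False (first_turn r) j \<noteq> {#}" using position_rest_nonempty_mono[OF j(1)] .
    ultimately show False using R[of ?\<nu> j] by (auto simp: Suc_le_eq nonempty_has_size)
  next
    assume z: "direction (\<not> c) False ps = lazy_monomial (\<not> c) False (first_turn r) (length ps)"
    have D: "coeff_diff w b {#} = 1" using ee by (auto simp: coeff_diff_def b_def w_def count_position_empty simp del: position.simps)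
    obtain \<kappa> where "{#} + \<kappa> = z + z" "coeff_diff w b \<kappa> > 0" by (rule symmetric_about_posE[OF s, of "{#}"]) (use D in auto)
    then have "z + z \<in># w" using coeff_diff_pos_mem[of w b "z + z"] by simp
    moreover have "2 \<le> size (z + z)" by (simp add: z_def)
    ultimately show False using R[of "z + z" "length ps"] z ee by (auto simp: z_def)
  qed
qed

text \<open>\<open>w\<close> has two surplus rungs with different colours \<open>a1\<close> and
  \<open>a2\<close>. Their mirror images have the same degree, so they extend the same prefix
  \<open>B\<close> by one colour each, which forces \<open>z + z = {#a1, a2#} + B\<close>.\<close>

lemma equal_colours_impossible:
  fixes c t e :: bool and n ps n0 n0' q
  defines "r \<equiv> ps @ [(n, False)]"
  defines "b \<equiv> position c t ((n0, e) # r)" and "w \<equiv> position c t ((n0', e) # q)" and "z \<equiv> direction c t ((n0, e) # ps)"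
  assumes s: "symmetric_about z w b" and nn: "n0 + 3 \<le> n0'" and rung_colour: "colour_index t n0 = colour_index t n0'" and d: "ps \<noteq> []"
  shows False
proof -
  have nonneg: "coeff_diff w b \<nu> \<ge> 0" if "\<nu> \<noteq> z" for \<nu>
    using symmetric_about_nonneg[of c t "(n0, e) # ps" w n \<nu>] s that by (simp add: b_def r_def z_def del: position.simps)
  define a1 where "a1 = rung_colour c t (n0 + 1)"
  define a2 where "a2 = rung_colour c t (n0 + 2)"
  have ne: "a1 \<noteq> a2" "a1 \<noteq> rung_colour c t n0" "a2 \<noteq> rung_colour c t n0"
    using colour_index_eqD[of t "n0 + 1" "n0 + 2"] colour_index_eqD[of t "n0 + 1" n0] colour_index_eqD[of t "n0 + 2" n0]
    by (auto simp: a1_def a2_def rung_colour_def)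
  have first: "fst a1 = c" "fst a2 = c" "snd a1 > 1" "snd a2 > 1"
    using colour_index_le_1_iff[of t "n0 + 1"] colour_index_le_1_iff[of t "n0 + 2"] by (auto simp: a1_def a2_def rung_colour_def)
  have pos: "coeff_diff w b {#a1#} > 0" "coeff_diff w b {#a2#} > 0"
    unfolding coeff_diff_def b_def w_def count_position_single a1_def a2_def
    using count_rungs_less[of "n0 + of_bool (first_turn r)" "n0 + 1" "n0' + of_bool (first_turn q)" c t]
      count_rungs_less[of "n0 + of_bool (first_turn r)" "n0 + 2" "n0' + of_bool (first_turn q)" c t] nn by auto
  obtain \<kappa>1 where k1: "{#a1#} + \<kappa>1 = z + z" "coeff_diff w b \<kappa>1 > 0"
    using symmetric_about_posE[OF s pos(1)] by blast
  obtain \<kappa>2 where k2: "{#a2#} + \<kappa>2 = z + z" "coeff_diff w b \<kappa>2 > 0"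
    using symmetric_about_posE[OF s pos(2)] by blast
  have len: "Suc (size \<kappa>1) = 2 * length ps + 2" "Suc (size \<kappa>2) = 2 * length ps + 2"
    using arg_cong[OF k1(1), of size] arg_cong[OF k2(1), of size] by (simp_all add: z_def)
  have ne0: "\<kappa>1 \<noteq> {#}" "\<kappa>2 \<noteq> {#}" using len d by auto
  have inPsi: "\<nu> \<in># position_rest c t ((n0', e) # q)" if "\<nu> \<in># w" "\<nu> \<noteq> {#}" for \<nu>
    using that by (auto simp: w_def position_eq_position_rest simp del: position_rest.simps position.simps split: if_splits)
  obtain j1 t1 i1 where s1: "\<kappa>1 = add_mset (rung_colour (c \<noteq> odd j1) t1 i1) (direction c t (take j1 ((n0', e) # q)))" "j1 < length ((n0', e) # q)"
     "add_mset (rung_colour (c \<noteq> odd j1) t1 0) (direction c t (take j1 ((n0', e) # q))) \<in># position_rest c t ((n0', e) # q)"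
    using position_rest_structure[OF inPsi[OF coeff_diff_pos_mem[OF k1(2)] ne0(1)]] by blast
  obtain j2 t2 i2 where s2: "\<kappa>2 = add_mset (rung_colour (c \<noteq> odd j2) t2 i2) (direction c t (take j2 ((n0', e) # q)))" "j2 < length ((n0', e) # q)"
    using position_rest_structure[OF inPsi[OF coeff_diff_pos_mem[OF k2(2)] ne0(2)]] by blast
  have sj: "Suc j1 = size \<kappa>1" "Suc j2 = size \<kappa>2" using s1(1,2) s2(1,2) by simp_all
  then have jj: "j1 = j2" using len by linarith
  define B where "B = direction c t (take j1 ((n0', e) # q))"
  have "{#a1, rung_colour (c \<noteq> odd j1) t1 i1#} + B = {#a2, rung_colour (c \<noteq> odd j2) t2 i2#} + B"
  proof -
    have "{#a1, rung_colour (c \<noteq> odd j1) t1 i1#} + B = {#a1#} + \<kappa>1" unfolding s1(1) B_def by simp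
    moreover have "{#a2, rung_colour (c \<noteq> odd j2) t2 i2#} + B = {#a2#} + \<kappa>2" unfolding s2(1) B_def jj by simp
    ultimately show ?thesis by (simp only: k1(1) k2(1))
  qed
  then have "{#a1, rung_colour (c \<noteq> odd j1) t1 i1#} = {#a2, rung_colour (c \<noteq> odd j2) t2 i2#}"
    by (simp only: add_right_cancel)
  then have "rung_colour (c \<noteq> odd j1) t1 i1 = a2" using ne unfolding two_eq_iff by auto
  then have "\<kappa>1 = add_mset a2 B" unfolding s1(1) B_def by simp
  then have zz: "z + z = {#a1, a2#} + B" unfolding k1(1)[symmetric] by simp
  \<comment> \<open>The first colour of the ladder that contributes \<open>\<kappa>1\<close>. A
    mirror image of \<open>?\<nu>\<close> would make this reserved colour equal to \<open>a1\<close>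
    or \<open>a2\<close>.\<close>
  let ?\<nu> = "add_mset (rung_colour (c \<noteq> odd j1) t1 0) B"
  have inw: "?\<nu> \<in># w" using s1(3) by (simp add: w_def position_eq_position_rest B_def del: position.simps position_rest.simps)
  show False
  proof (cases "coeff_diff w b ?\<nu> = 0")
    case False
    then obtain \<kappa> where "?\<nu> + \<kappa> = z + z" using s unfolding symmetric_about_def by blast
    then have "add_mset (rung_colour (c \<noteq> odd j1) t1 0) \<kappa> = {#a1, a2#}" unfolding zz by simp
    then have "rung_colour (c \<noteq> odd j1) t1 0 \<in># {#a1, a2#}" by (metis union_single_eq_member)
    then show False using first colour_index_le_1_iff[of t1 0] by (auto simp: rung_colour_def)
  next
    case True
    \<comment> \<open>Its degree is \<open>2 * length ps + 1\<close>, while \<open>b\<close> has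
      degree at most \<open>length ps + 2\<close>. This leaves \<open>length ps = 1\<close>, where
      \<open>z\<close> has only one colour of parity \<open>c\<close>, and that is not
      \<open>a1\<close>.\<close>
    then have "?\<nu> \<in># b" using inw by (auto simp: coeff_diff_def simp flip: count_greater_zero_iff)
    moreover have sz: "size ?\<nu> = Suc j1" using s1(2) by (simp add: B_def)
    ultimately have "Suc j1 \<le> Suc (Suc (length ps))"
      using edge_size[of ?\<nu> c t "(n0, e) # ps" n] by (simp add: b_def r_def del: position.simps)
    then have "length ps = 1" using sj len d by (cases ps) auto
    then obtain n1 e1 where "ps = [(n1, e1)]" by (cases ps) auto
    moreover have "a1 \<in># z + z" by (simp add: zz)
    ultimately show False using ne(2) first(1) by (auto simp: z_def rung_colour_def)
  qed
qed

text \<open>All monomials of \<open>w\<close> of degree at least two contain \<open>?x'\<close>.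
  Symmetry then puts \<open>?x'\<close> into a lazy monomial, so it is a first colour:
  \<open>w\<close> leaves the ladder at once and turns right next, whereas \<open>b\<close> climbs
  one rung and turns left next. These agree in degree one. They are told apart on the following
  ladder of \<open>w\<close>, entered by that right turn, where the index 2 of \<open>?x\<close>
  comes late.\<close>

lemma distinct_colours_impossible:
  fixes c t e :: bool and n ps n0 n0' q
  defines "r \<equiv> ps @ [(n, False)]"
  defines "b \<equiv> position c t ((n0, e) # r)" and "w \<equiv> position c t ((n0', e) # q)" and "z \<equiv> direction c t ((n0, e) # ps)"
  assumes s: "symmetric_about z w b" and rung_colour: "colour_index t n0 \<noteq> colour_index t n0'" and d: "ps \<noteq> []"
    and m: "n0 + of_bool (first_turn r) \<le> n0' + of_bool (first_turn q)"
    and nc: "\<nu>0 \<noteq> z" "coeff_diff w b \<nu>0 \<noteq> 0"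
  shows False
proof -
  have nonneg: "coeff_diff w b \<nu> \<ge> 0" if "\<nu> \<noteq> z" for \<nu>
    using symmetric_about_nonneg[of c t "(n0, e) # ps" w n \<nu>] s that by (simp add: b_def r_def z_def del: position.simps)
  let ?x = "rung_colour c t n0" and ?x' = "rung_colour c t n0'"
  have xx: "?x \<noteq> ?x'" using rung_colour by (simp add: rung_colour_def)
  have szz: "size z = Suc (length ps)" by (simp add: z_def)
  have in_w: "add_mset ?x \<nu> \<in># w" if "\<nu> \<in># position_rest (\<not> c) e r" "\<nu> \<noteq> direction (\<not> c) e ps" for \<nu>
  proof -
    have "add_mset ?x \<nu> \<in># b" using position_rest_into_position[OF that(1)] by (simp add: b_def del: position.simps)
    moreover have "add_mset ?x \<nu> \<noteq> z" using that(2) by (simp add: z_def)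
    ultimately show ?thesis using nonneg[of "add_mset ?x \<nu>"] by (auto simp: coeff_diff_def simp flip: count_greater_zero_iff)
  qed
  obtain \<kappa>0 where k0: "\<nu>0 + \<kappa>0 = z + z" "coeff_diff w b \<kappa>0 = coeff_diff w b \<nu>0" using s nc(2) unfolding symmetric_about_def by blast
  have p0: "coeff_diff w b \<nu>0 > 0" using nonneg[OF nc(1)] nc(2) by linarith
  obtain \<nu> \<kappa> where nk: "\<nu> + \<kappa> = z + z" "\<nu> \<in># w" "\<kappa> \<in># w" "size z \<le> size \<nu>"
  proof (cases "size z \<le> size \<nu>0")
    case True then show ?thesis using that[of \<nu>0 \<kappa>0] k0 p0 coeff_diff_pos_mem by metis
  next
    case False
    then have "size z \<le> size \<kappa>0" using arg_cong[OF k0(1), of size] by simp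
    then show ?thesis using that[of \<kappa>0 \<nu>0] k0 p0 coeff_diff_pos_mem by (metis union_commute)
  qed
  have "2 \<le> size \<nu>" using nk(4) szz d by (cases ps) auto
  then obtain \<nu>' where \<nu>': "\<nu>' \<in># position_rest (\<not> c) e q" "\<nu> = add_mset ?x' \<nu>'"
    using position_size_ge_2E nk(2) unfolding w_def by metis
  have "?x' \<in># z + z" unfolding nk(1)[symmetric] \<nu>'(2) by simp
  then have x'z: "?x' \<in># direction (\<not> c) e ps" using xx by (simp add: z_def)
  let ?lz = "\<lambda>j. lazy_monomial (\<not> c) e (first_turn r) j"
  note le = lazy_monomial_edge[of "\<not> c" e ps n, folded r_def]
  have "\<exists>j. ?x' \<in># ?lz j" using le
  proof
    assume "\<exists>j. ?lz j \<in># position_rest (\<not> c) e r \<and> ?lz j \<noteq> direction (\<not> c) e ps"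
    then obtain j where j: "?lz j \<in># position_rest (\<not> c) e r" "?lz j \<noteq> direction (\<not> c) e ps" by blast
    have "2 \<le> size (add_mset ?x (?lz j))" using position_rest_nonempty_mono[OF j(1)]
      by (simp add: Suc_le_eq nonempty_has_size)
    then obtain \<nu>2 where "add_mset ?x (?lz j) = add_mset ?x' \<nu>2"
      using position_size_ge_2E in_w[OF j] unfolding w_def by metis
    then have "?x' \<in># add_mset ?x (?lz j)" by simp
    then show ?thesis using xx by auto
  qed (use x'z in metis)
  then obtain j where "?x' \<in># ?lz j" by blast
  from in_lazy_monomial[OF this] have "colour_index t n0' \<le> 1" by (auto simp: rung_colour_def colour_index_0)
  then have n0': "n0' = 0" by (simp only: colour_index_le_1_iff)
  \<comment> \<open>By \<open>m\<close>, at least as many rungs are visible in \<open>w\<close> as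
    in \<open>b\<close>; with \<open>n0' = 0\<close>, only its right turn can count as one.\<close>
  then have n0: "n0 = 1" "\<not> first_turn r" "first_turn q" using m rung_colour
    by (cases "first_turn r"; cases "first_turn q"; cases "n0 = 0"; simp)+
  have tF: "\<not> t" using in_lazy_monomial[OF \<open>?x' \<in># ?lz j\<close>] n0 n0' by (auto simp: rung_colour_def colour_index_0)
  have x: "?x = (c, 2)" "?x' = (c, 0)" using n0 n0' tF by (auto simp: rung_colour_def)
  obtain n1 q2 where q: "q = (n1, True) # q2" using n0(3) by (cases q rule: first_turn.cases) auto
  let ?y = "rung_colour (\<not> c) e n1"
  \<comment> \<open>On a ladder entered by a right turn, the index 2 first appears at the fourth
    parallelogram and 0 never. So at least three rungs are visible, and the monomials
    \<open>?F i\<close> are in \<open>w\<close> but not in \<open>b\<close>, as they lack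
    \<open>?x\<close>.\<close>
  have X: False if \<nu>2: "\<nu>2 \<in># position_rest c True q2" "\<And>y. y \<in># \<nu>2 \<Longrightarrow> fst y = c \<Longrightarrow> y = (c, 2) \<or> y = (c, 0)" for \<nu>2
  proof -
    obtain n2 e2 q3 where q2: "q2 = (n2, e2) # q3" using \<nu>2(1) by (cases q2) auto
    have three: "3 \<le> i" if "(c, colour_index True i) \<in># \<nu>2" for i
      using \<nu>2(2)[OF that] colour_index_True_pos[of i] colour_index_True_eq_2D[of i] by auto
    have m2: "3 \<le> n2 + of_bool (first_turn q3)"
      using \<nu>2(1)[unfolded q2]
    proof (cases rule: in_PsiE)
      case (1 i) then show ?thesis using three[of i] by (auto simp: rung_colour_def)
    next
      case (2 \<nu>3) then show ?thesis using three[of n2] by (auto simp: rung_colour_def)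
    qed
    let ?F = "\<lambda>i. {#?x', ?y, rung_colour c True i#}"
    have Fw: "?F i \<in># w" if "i < 3" for i
    proof -
      have "{#rung_colour c True i#} \<in># rungs c True (n2 + of_bool (first_turn q3))"
        unfolding in_rungs_iff using that m2 by (intro exI[of _ i]) simp
      then have "{#rung_colour c True i#} \<in># position_rest c True q2" by (simp add: q2)
      then have "add_mset ?y {#rung_colour c True i#} \<in># position_rest (\<not> c) e q" by (simp add: q)
      from position_rest_into_position[OF this, of t n0'] show ?thesis by (simp add: w_def del: position.simps)
    qed
    have Fb: "?F i \<notin># b" if "i < 3" for i
    proof
      assume "?F i \<in># b"
      then obtain \<nu>3 where "?F i = add_mset ?x \<nu>3"
        using position_size_ge_2E[of "?F i" c t n0 e r] unfolding b_def by auto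
      then have "?x \<in># ?F i" by simp
      then have "colour_index True i = 2" unfolding x by (auto simp: rung_colour_def)
      then show False using colour_index_True_eq_2D[of i] that by simp
    qed
    define B where "B = direction c t (take (2 * length ps - 2) ((n0', e) # q))"
    have K: "\<exists>y'. {#?x', ?y#} + B + {#rung_colour c True i, y'#} = z + z" if "i < 3" for i
    proof -
      have "coeff_diff w b (?F i) > 0" using Fw[OF that] Fb[OF that] by (auto simp: coeff_diff_def not_in_iff)
      from symmetric_about_posE[OF s this] obtain \<kappa> where \<kappa>: "?F i + \<kappa> = z + z" "coeff_diff w b \<kappa> > 0" by blast
      have len: "size \<kappa> + 3 = 2 * length ps + 2" using arg_cong[OF \<kappa>(1), of size] by (simp add: szz)
      then have "\<kappa> \<noteq> {#}" using d by (cases ps) auto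
      then have "\<kappa> \<in># position_rest c t ((n0', e) # q)" using coeff_diff_pos_mem[OF \<kappa>(2)]
        by (auto simp: w_def position_eq_position_rest simp del: position_rest.simps position.simps split: if_splits)
      from position_rest_structure[OF this] obtain j1 t1 i1 where j1: "j1 < length ((n0', e) # q)"
        "\<kappa> = add_mset (rung_colour (c \<noteq> odd j1) t1 i1) (direction c t (take j1 ((n0', e) # q)))" by blast
      then have "Suc j1 = size \<kappa>" by simp
      then have "j1 = 2 * length ps - 2" using len by linarith
      then have "\<kappa> = add_mset (rung_colour (c \<noteq> odd j1) t1 i1) B" using j1(2) by (simp add: B_def)
      then have "{#?x', ?y#} + B + {#rung_colour c True i, rung_colour (c \<noteq> odd j1) t1 i1#} = z + z"
        unfolding \<kappa>(1)[symmetric] by (simp add: multiset_eq_iff)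
      then show ?thesis by blast
    qed
    obtain y0 y1 y2 where "{#?x', ?y#} + B + {#rung_colour c True 0, y0#} = z + z"
      "{#?x', ?y#} + B + {#rung_colour c True 1, y1#} = z + z" "{#?x', ?y#} + B + {#rung_colour c True 2, y2#} = z + z"
      using K[of 0] K[of 1] K[of 2] by auto
    \<comment> \<open>The mirror images share \<open>B\<close>, so one pair of colours would have to
      contain three different ones.\<close>
    then have "{#rung_colour c True 0, y0#} = {#rung_colour c True 1, y1#}" "{#rung_colour c True 0, y0#} = {#rung_colour c True 2, y2#}"
      by (metis add_left_imp_eq)+
    then show False unfolding two_eq_iff by (auto simp: rung_colour_def numeral_2_eq_2)
  qed
  from le show False
  proof
    assume "\<exists>j. ?lz j \<in># position_rest (\<not> c) e r \<and> ?lz j \<noteq> direction (\<not> c) e ps"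
    then obtain j where j: "?lz j \<in># position_rest (\<not> c) e r" "?lz j \<noteq> direction (\<not> c) e ps" by blast
    have "2 \<le> size (add_mset ?x (?lz j))" using position_rest_nonempty_mono[OF j(1)]
      by (simp add: Suc_le_eq nonempty_has_size)
    then obtain \<nu>2 where \<nu>2: "\<nu>2 \<in># position_rest (\<not> c) e q" "add_mset ?x (?lz j) = add_mset ?x' \<nu>2"
      using position_size_ge_2E in_w[OF j] unfolding w_def by metis
    from \<nu>2(1)[unfolded q] show False
    proof (cases rule: in_PsiE)
      case (1 i)
      have "?x \<in># add_mset ?x' \<nu>2" using \<nu>2(2) by (metis union_single_eq_member)
      then show False using 1(2) xx by (auto simp: rung_colour_def)
    next
      case (2 \<nu>3)
      show False
      proof (rule X[of \<nu>3])
        fix y' assume y': "y' \<in># \<nu>3" "fst y' = c"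
        then have "y' \<in># add_mset ?x' \<nu>2" by (simp add: 2(2))
        then have "y' = ?x \<or> y' \<in># ?lz j" unfolding \<nu>2(2)[symmetric] by auto
        then show "y' = (c, 2) \<or> y' = (c, 0)" using in_lazy_monomial[of y' "\<not> c" e "first_turn r" j] x y'(2) n0(2) by (auto simp: colour_index_0)
      qed (use 2(1) in simp)
    qed
  next
    assume z: "direction (\<not> c) e ps = ?lz (length ps)"
    from \<nu>'(1)[unfolded q] show False
    proof (cases rule: in_PsiE)
      case (1 i)
      then have "length ps = 1" using nk(4) szz \<nu>'(2) d by (cases ps) auto
      then show False using x'z z by (auto simp: rung_colour_def)
    next
      case (2 \<nu>3)
      show False
      proof (rule X[of \<nu>3])
        fix y' assume y': "y' \<in># \<nu>3" "fst y' = c"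
        then have "y' \<in># z + z" unfolding nk(1)[symmetric] \<nu>'(2) 2(2) by simp
        then have "y' = ?x \<or> y' \<in># ?lz (length ps)" using z by (simp add: z_def)
        then show "y' = (c, 2) \<or> y' = (c, 0)"
          using in_lazy_monomial[of y' "\<not> c" e "first_turn r" "length ps"] x y'(2) n0(2) by (auto simp: colour_index_0)
      qed (use 2(1) in simp)
    qed
  qed
qed

lemma image_add_mset_count: "count (image_mset (add_mset x) M) (add_mset x \<nu>) = count M \<nu>"
  by (induction M) auto

text \<open>Monomials without \<open>x\<close> have coefficient 0, so the mirror image of a multiple
  of \<open>x\<close> is again one and \<open>x\<close> can be divided out. This strips one level of
  a common prefix.\<close>

lemma symmetric_about_cancel:
  assumes s: "symmetric_about (add_mset x z) w b"
    and w: "w = M + image_mset (add_mset x) w'" and b: "b = M + image_mset (add_mset x) b'"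
  shows "symmetric_about z w' b'" "coeff_diff w b (add_mset x \<nu>) = coeff_diff w' b' \<nu>"
    and "x \<notin># \<nu>' \<Longrightarrow> coeff_diff w b \<nu>' = 0"
proof -
  show D: "coeff_diff w b (add_mset x \<nu>) = coeff_diff w' b' \<nu>" for \<nu>
    by (simp add: coeff_diff_def w b image_add_mset_count)
  show D0: "coeff_diff w b \<nu>' = 0" if "x \<notin># \<nu>'" for \<nu>'
  proof -
    have "\<nu>' \<notin># image_mset (add_mset x) w'" "\<nu>' \<notin># image_mset (add_mset x) b'" using that by auto
    then have "count (image_mset (add_mset x) w') \<nu>' = 0" "count (image_mset (add_mset x) b') \<nu>' = 0"
      by (simp_all only: not_in_iff)
    then show ?thesis by (simp add: coeff_diff_def w b)
  qed
  show "symmetric_about z w' b'"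
    unfolding symmetric_about_def
  proof (intro allI impI)
    fix \<nu> assume nz: "coeff_diff w' b' \<nu> \<noteq> 0"
    then obtain \<kappa> where k: "add_mset x \<nu> + \<kappa> = add_mset x z + add_mset x z" "coeff_diff w b \<kappa> = coeff_diff w' b' \<nu>"
      using s D[of \<nu>] unfolding symmetric_about_def by metis
    then have "x \<in># \<kappa>" using D0 nz by metis
    then obtain \<kappa>' where "\<kappa> = add_mset x \<kappa>'" by (meson multi_member_split)
    then show "\<exists>\<kappa>. \<nu> + \<kappa> = z + z \<and> coeff_diff w' b' \<kappa> = coeff_diff w' b' \<nu>"
      using k D[of \<kappa>'] by (intro exI[of _ \<kappa>']) auto
  qed
qed

text \<open>
  Strip the common prefix of both walks and compare their first difference: opposite turns, or exits
  from the same ladder by parallelograms of equal or of distinct colours.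
\<close>

theorem unit_edge_rigid:
  assumes "symmetric_about (direction c t ps) (position c t q) (position c t (ps @ [(n, False)]))" "\<nu> \<noteq> direction c t ps"
  shows "coeff_diff (position c t q) (position c t (ps @ [(n, False)])) \<nu> = 0"
  using assms
proof (induction ps arbitrary: c t q \<nu>)
  case Nil
  then show ?case unfolding symmetric_about_def by (metis direction.simps(1) union_eq_empty add.right_neutral)
next
  case (Cons p ps)
  obtain n0 e where p: "p = (n0, e)" by (cases p)
  obtain n0' e' q' where q: "position c t q = position c t ((n0', e') # q')"
  proof (cases q)
    case Nil then show ?thesis using that[of 0 False "[]"] by simp
  next
    case (Cons a q') then show ?thesis using that by (cases a) auto
  qed
  let ?r = "ps @ [(n, False)]"
  let ?w = "position c t ((n0', e') # q')" and ?b = "position c t ((n0, e) # ?r)" and ?z = "direction c t ((n0, e) # ps)"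
  have s: "symmetric_about ?z ?w ?b" and nz: "\<nu> \<noteq> ?z" using Cons.prems by (simp_all add: p q del: position.simps direction.simps)
  have goal: "coeff_diff ?w ?b \<nu> = 0"
  proof (cases "e = e'")
    case False then show ?thesis using opposite_turns_impossible[OF s] by blast
  next
    case e: True
    show ?thesis
    proof (cases "n0 = n0'")
      case True
      show ?thesis
      proof (cases "rung_colour c t n0 \<in># \<nu>")
        case False
        show ?thesis
          by (rule symmetric_about_cancel(3)[OF s[unfolded direction.simps] _ _ False, where M = "replicate_mset (of_bool e) {#} + rungs c t n0"]) (simp_all add: True e)
      next
        case xin: True
        then obtain \<nu>' where \<nu>': "\<nu> = add_mset (rung_colour c t n0) \<nu>'" by (meson multi_member_split)
        have w: "?w = (replicate_mset (of_bool e) {#} + rungs c t n0) + image_mset (add_mset (rung_colour c t n0)) (position (\<not> c) e q')"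
          by (simp add: True e)
        have b: "?b = (replicate_mset (of_bool e) {#} + rungs c t n0) + image_mset (add_mset (rung_colour c t n0)) (position (\<not> c) e ?r)"
          by simp
        have "coeff_diff (position (\<not> c) e q') (position (\<not> c) e ?r) \<nu>' = 0"
          by (rule Cons.IH[OF symmetric_about_cancel(1)[OF s[unfolded direction.simps] w b]]) (use nz \<nu>' in auto)
        then show ?thesis unfolding \<nu>' symmetric_about_cancel(2)[OF s[unfolded direction.simps] w b] .
      qed
    next
      case nn: False
      show ?thesis
      \<comment> \<open>Here \<open>z\<close> has degree one, so the degrees of a mirror pair are 0
        and 2 or both 1. The constant terms agree, and in the second case both monomials are
        \<open>z\<close>.\<close>
      proof (cases "ps = []")
        case True
        show ?thesis
        proof (rule ccontr)
          assume nzero: "coeff_diff ?w ?b \<nu> \<noteq> 0"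
          then obtain \<kappa> where k: "\<nu> + \<kappa> = {#rung_colour c t n0, rung_colour c t n0#}" "coeff_diff ?w ?b \<kappa> = coeff_diff ?w ?b \<nu>"
            using s unfolding symmetric_about_def by (force simp: True)
          have "coeff_diff ?w ?b {#} = 0" by (simp add: coeff_diff_def count_position_empty e del: position.simps)
          then have "\<nu> \<noteq> {#}" "\<kappa> \<noteq> {#}" using nzero k(2) by auto
          moreover have "size \<nu> + size \<kappa> = 2" using arg_cong[OF k(1), of size] by simp
          ultimately have "size \<nu> = 1" "size \<kappa> = 1" by (simp_all add: nonempty_has_size)
          then obtain y y' where "\<nu> = {#y#}" "\<kappa> = {#y'#}" by (meson size_1_singleton_mset)
          then have "\<nu> = ?z" using k(1) True by (simp add: two_eq_iff)
          then show False using nz by simp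
        qed
      next
        case d: False
        \<comment> \<open>Otherwise \<open>b\<close> would show a rung that \<open>w\<close> lacks,
          a negative coefficient.\<close>
        have m: "n0 + of_bool (first_turn ?r) \<le> n0' + of_bool (first_turn q')"
        proof (rule ccontr)
          assume "\<not> ?thesis"
          then have *: "n0' + of_bool (first_turn q') < n0 + of_bool (first_turn ?r)" by simp
          define i where "i = n0' + of_bool (first_turn q')"
          have "count (rungs c t i) {#rung_colour c t i#} < count (rungs c t (n0 + of_bool (first_turn ?r))) {#rung_colour c t i#}"
            by (rule count_rungs_less) (use * i_def in auto)
          then have "coeff_diff ?w ?b {#rung_colour c t i#} < 0" by (simp add: coeff_diff_def count_position_single i_def del: position.simps)
          moreover have "{#rung_colour c t i#} \<noteq> ?z" using d size_direction[of "\<not> c" e ps] by (metis length_0_conv direction.simps(2) single_eq_add_mset size_empty)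
          ultimately show False using symmetric_about_nonneg[of c t "(n0, e) # ps" ?w n "{#rung_colour c t i#}"] s by simp
        qed
        show ?thesis
        proof (cases "colour_index t n0 = colour_index t n0'")
          case True
          then have "n0 + 3 \<le> n0'" using colour_index_eqD[OF True] nn m
            by (cases "first_turn ?r"; cases "first_turn q'"; simp)
          then show ?thesis using equal_colours_impossible[OF s[folded e] _ True d] by blast
        next
          case False
          then show ?thesis using distinct_colours_impossible[OF s[folded e] False d m nz] unfolding e by blast
        qed
      qed
    qed
  qed
  then show ?case by (simp add: p q del: position.simps)
qed

section \<open>Extension of walks and the diagonals\<close>

lemma position_snoc_True: "position c t (ps @ [(n, True)]) = add_mset (direction c t ps) (position c t (ps @ [(n, False)]))"
  by (induction c t ps rule: direction.induct) auto

lemma position_snoc_Suc: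
  "position c t (ps @ [(Suc n, e)]) = add_mset (direction c t (ps @ [(n, e)])) (position c t (ps @ [(n, e)]))"
  by (induction c t ps rule: direction.induct) auto

lemma position_snoc_0_False: "position c t (ps @ [(n, e), (0, False)]) = position c t (ps @ [(n, e)])"
  by (induction c t ps rule: direction.induct) auto

lemma position_snoc_0_True: "position c t (ps @ [(n, e), (0, True)]) = position c t (ps @ [(Suc n, e)])"
  by (induction c t ps rule: direction.induct) auto

lemma edge_big:
  assumes "\<nu> \<in># position c t (ps @ [(n, False)])" "length ps < size \<nu>"
  obtains y where "\<nu> = add_mset y (direction c t ps)"
proof -
  obtain j t' i where j: "j \<le> length ps" "\<nu> = add_mset (rung_colour (c \<noteq> odd j) t' i) (direction c t (take j ps))"
    using edge_structure[OF assms(1)] assms(2) by auto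
  then have "j = length ps" using assms(2) by simp
  then show thesis using that j(2) by simp
qed

text \<open>
  \<open>w0\<close> and \<open>w1\<close> collect the monomials whose degree has the parity of \<open>z\<close> and of \<open>zx\<close>, respectively. The
  hypotheses say that \<open>w - b = z(1 - P) + zxP\<close> for a symmetric \<open>P\<close>; a non-constant monomial of \<open>P\<close> would
  make two distinct mirror monomials of \<open>b\<close> (or of \<open>b + z\<close>) negative.
\<close>

theorem diagonal_rigid:
  fixes c t ps n w
  defines "b \<equiv> position c t (ps @ [(n, False)])" and "z \<equiv> direction c t ps"
  assumes zx: "direction c t (ps @ [(n, False)]) = add_mset x z"
    and w0: "w0 = filter_mset (\<lambda>\<nu>. even (size \<nu>) = even (length ps)) w"
    and b0: "b0 = filter_mset (\<lambda>\<nu>. even (size \<nu>) = even (length ps)) b"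
    and w1: "w1 = filter_mset (\<lambda>\<nu>. even (size \<nu>) \<noteq> even (length ps)) w"
    and b1: "b1 = filter_mset (\<lambda>\<nu>. even (size \<nu>) \<noteq> even (length ps)) b"
    and s0: "symmetric_about z w0 (add_mset z b0)" and s1: "symmetric_about (add_mset x z) w1 b1"
    and eq: "image_mset (add_mset x) w0 + w1 = image_mset (add_mset x) (add_mset z b0) + b1"
    and k: "\<kappa> \<noteq> add_mset x z"
  shows "coeff_diff w1 b1 \<kappa> = 0"
proof (rule ccontr)
  assume nz: "coeff_diff w1 b1 \<kappa> \<noteq> 0"
  have szz: "size z = length ps" by (simp add: z_def)
  show False
  proof (cases "coeff_diff w1 b1 \<kappa> < 0")
    case True
    then obtain \<kappa>' where k': "\<kappa> + \<kappa>' = add_mset x z + add_mset x z" "coeff_diff w1 b1 \<kappa>' < 0"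
      using s1 unfolding symmetric_about_def by (metis nz)
    have mem: "\<kappa> \<in># b1" "\<kappa>' \<in># b1" by (rule coeff_diff_neg_mem[OF True], rule coeff_diff_neg_mem[OF k'(2)])
    then have memb: "\<kappa> \<in># b" "\<kappa>' \<in># b" by (simp_all add: b1)
    have "size \<kappa> + size \<kappa>' = 2 * length ps + 2" using arg_cong[OF k'(1), of size] by (simp add: szz)
    moreover have "size \<kappa> \<le> Suc (length ps)" "size \<kappa>' \<le> Suc (length ps)"
      using edge_size[OF memb(1)[unfolded b_def]] edge_size[OF memb(2)[unfolded b_def]] .
    \<comment> \<open>Both monomials have the largest possible degree, so each is \<open>z\<close>
      times one colour.\<close>
    ultimately have "length ps < size \<kappa>" "length ps < size \<kappa>'" by linarith+
    then obtain y y' where y: "\<kappa> = add_mset y z" "\<kappa>' = add_mset y' z"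
      using edge_big[OF memb(1)[unfolded b_def]] edge_big[OF memb(2)[unfolded b_def]] unfolding z_def by metis
    have "{#y, y'#} + (z + z) = \<kappa> + \<kappa>'" unfolding y by (simp only: union_mset_add_mset_left union_mset_add_mset_right) simp
    also have "\<dots> = {#x, x#} + (z + z)" unfolding k'(1) by simp
    finally have "{#y, y'#} + (z + z) = {#x, x#} + (z + z)" .
    then have "{#y, y'#} = {#x, x#}" by (simp only: add_right_cancel)
    then show False using k y(1) unfolding two_eq_iff by auto
  next
    case False
    \<comment> \<open>By \<open>eq\<close>, a positive coefficient of \<open>w1 - b1\<close> is
      compensated by a negative one of \<open>w0\<close> against
      \<open>add_mset z b0\<close>.\<close>
    have c: "count (image_mset (add_mset x) w0) \<kappa> + count w1 \<kappa> =
        count (image_mset (add_mset x) (add_mset z b0)) \<kappa> + count b1 \<kappa>"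
      using arg_cong[OF eq, of "\<lambda>M. count M \<kappa>"] by simp
    then have lt: "count (image_mset (add_mset x) w0) \<kappa> < count (image_mset (add_mset x) (add_mset z b0)) \<kappa>"
      using False nz by (simp add: coeff_diff_def)
    then have "\<kappa> \<in># image_mset (add_mset x) (add_mset z b0)" unfolding count_greater_zero_iff[symmetric] by linarith
    then obtain \<nu> where \<nu>: "\<kappa> = add_mset x \<nu>" by auto
    have neg: "coeff_diff w0 (add_mset z b0) \<nu> < 0"
      using lt unfolding \<nu> image_add_mset_count by (simp add: coeff_diff_def)
    have nuz: "\<nu> \<noteq> z" using k \<nu> by simp
    obtain \<nu>' where \<nu>': "\<nu> + \<nu>' = z + z" "coeff_diff w0 (add_mset z b0) \<nu>' < 0"
      using s0 neg unfolding symmetric_about_def by (metis less_irrefl)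
    have "\<nu>' \<noteq> z" using \<nu>'(1) nuz by auto
    then have mem: "\<nu> \<in># b" "\<nu>' \<in># b"
      using coeff_diff_neg_mem[OF neg] coeff_diff_neg_mem[OF \<nu>'(2)] nuz by (auto simp: b0)
    then show False using edge_pair_eq'[of \<nu> c t ps n \<nu>' z] \<nu>'(1) nuz by (simp add: b_def z_def)
  qed
qed

section \<open>Injectivity of positions\<close>

text \<open>A final entry \<open>(0, e)\<close> only renames an end of the previous side, see
  \<open>position_snoc_0_False\<close> and \<open>position_snoc_0_True\<close>.\<close>

definition canonical :: "(nat \<times> bool) list \<Rightarrow> bool" where
  "canonical xs \<longleftrightarrow> xs \<noteq> [] \<longrightarrow> 0 < fst (last xs)"

lemma canonical_Cons: "canonical ((n, e) # xs) \<Longrightarrow> canonical xs"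
  by (auto simp: canonical_def split: if_splits)

lemma canonical_position_rest: "canonical xs \<Longrightarrow> xs \<noteq> [] \<Longrightarrow> position_rest c t xs \<noteq> {#}"
proof (induction c t xs rule: position_rest.induct)
  case (2 c t n e ps)
  show ?case
  proof (cases ps)
    case Nil
    then have "0 < n" using 2 by (simp add: canonical_def)
    then show ?thesis using size_rungs[of c t n] Nil by (auto simp del: size_rungs)
  next
    case (Cons a list)
    then show ?thesis using 2 canonical_Cons by auto
  qed
qed simp

text \<open>The ambiguity of degree one: \<open>n\<close> rungs and a right turn against
  \<open>n + 1\<close> rungs. In the second position all monomials of degree at least two contain
  the colour number \<open>n + 1\<close>, which is not a first colour; the first position has a lazy
  monomial times the colour number \<open>n\<close>.\<close>

lemma position_inj_aux:
  assumes "position_rest (\<not> c) e xs \<noteq> {#}" "first_turn xs" "position c t ((n, e) # xs) = position c t ((Suc n, e) # ys)"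
  shows False
proof -
  obtain j where j: "lazy_monomial (\<not> c) e True j \<in># position_rest (\<not> c) e xs" using lazy_monomial_in_position_rest[OF assms(1)] assms(2) by auto
  let ?\<nu> = "add_mset (rung_colour c t n) (lazy_monomial (\<not> c) e True j)"
  have "?\<nu> \<in># position c t ((Suc n, e) # ys)" using position_rest_into_position[OF j, of t n] unfolding assms(3) .
  moreover have "2 \<le> size ?\<nu>" using position_rest_nonempty_mono[OF j] by (simp add: Suc_le_eq nonempty_has_size)
  ultimately obtain \<nu>' where "?\<nu> = add_mset (rung_colour c t (Suc n)) \<nu>'" by (rule position_size_ge_2E)
  then have "rung_colour c t (Suc n) \<in># ?\<nu>" by (metis union_single_eq_member)
  moreover have "rung_colour c t (Suc n) \<noteq> rung_colour c t n" using colour_index_eqD[of t "Suc n" n] by (auto simp: rung_colour_def)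
  ultimately have "rung_colour c t (Suc n) \<in># lazy_monomial (\<not> c) e True j" by auto
  from in_lazy_monomial[OF this] have "colour_index t (Suc n) \<le> 1" by (auto simp: rung_colour_def colour_index_0)
  then show False by (simp only: colour_index_le_1_iff)
qed

text \<open>The constant term determines the turn and degree one the number of visible rungs; after
  \<open>position_inj_aux\<close> has settled the number of rungs, the common colour
  cancels.\<close>

theorem position_inj:
  assumes "canonical xs" "canonical ys" "position c t xs = position c t ys"
  shows "xs = ys"
  using assms
proof (induction xs arbitrary: c t ys)
  case Nil
  show ?case
  proof (rule ccontr)
    assume "[] \<noteq> ys"
    then have "position_rest c t ys \<noteq> {#}" using Nil canonical_position_rest by auto
    then show False using Nil(3) by (simp add: position_eq_position_rest)
  qed
next
  case (Cons p xs)
  obtain n e where p: "p = (n, e)" by (cases p)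
  have "ys \<noteq> []"
  proof
    assume "ys = []"
    moreover have "position_rest c t (p # xs) \<noteq> {#}" using Cons.prems canonical_position_rest by blast
    ultimately show False using Cons.prems(3) by (simp add: position_eq_position_rest del: position.simps(2) position_rest.simps(2))
  qed
  then obtain n' e' ys' where ys: "ys = (n', e') # ys'" by (cases ys) auto
  note eq = Cons.prems(3)[unfolded p ys]
  have e: "e = e'" using arg_cong[OF eq, of "\<lambda>M. count M {#}"] by (cases e; cases e'; simp add: count_position_empty del: position.simps)
  have m: "n + of_bool (first_turn xs) = n' + of_bool (first_turn ys')"
  proof (rule ccontr)
    assume "\<not> ?thesis"
    then consider "n + of_bool (first_turn xs) < n' + of_bool (first_turn ys')" | "n' + of_bool (first_turn ys') < n + of_bool (first_turn xs)" by linarith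
    then show False
    proof cases
      case 1
      from count_rungs_less[OF order_refl 1, of c t] show False
        using arg_cong[OF eq, of "\<lambda>M. count M {#rung_colour c t (n + of_bool (first_turn xs))#}"] by (simp add: count_position_single del: position.simps)
    next
      case 2
      from count_rungs_less[OF order_refl 2, of c t] show False
        using arg_cong[OF eq, of "\<lambda>M. count M {#rung_colour c t (n' + of_bool (first_turn ys'))#}"] by (simp add: count_position_single del: position.simps)
    qed
  qed
  have cx: "canonical xs" "canonical ys'" using Cons.prems canonical_Cons by (auto simp: p ys)
  have "n = n'"
  proof (rule ccontr)
    assume "n \<noteq> n'"
    then consider "n' = Suc n" "first_turn xs" | "n = Suc n'" "first_turn ys'"
      using m by (cases "first_turn xs"; cases "first_turn ys'") auto
    then show False
    proof cases
      case 1
      then have "xs \<noteq> []" by auto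
      then have "position_rest (\<not> c) e xs \<noteq> {#}" by (rule canonical_position_rest[OF cx(1)])
      from position_inj_aux[OF this 1(2)] show False using eq e 1 by blast
    next
      case 2
      then have "ys' \<noteq> []" by auto
      then have "position_rest (\<not> c) e' ys' \<noteq> {#}" by (rule canonical_position_rest[OF cx(2)])
      moreover have "position c t ((n', e') # ys') = position c t ((Suc n', e') # xs)"
        using eq[symmetric] e 2(1) by (simp del: position.simps)
      ultimately show False using position_inj_aux[OF _ 2(2)] by blast
    qed
  qed
  then have "image_mset (add_mset (rung_colour c t n)) (position (\<not> c) e xs) = image_mset (add_mset (rung_colour c t n)) (position (\<not> c) e ys')"
    using eq e by simp
  moreover have "inj (add_mset (rung_colour c t n))" by (auto simp: inj_def)
  ultimately have "position (\<not> c) e xs = position (\<not> c) e ys'" using multiset.inj_map injD by metis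
  then show ?case using Cons.IH cx \<open>n = n'\<close> e by (simp add: p ys)
qed

subsection \<open>Placing a non-crossing order in the tree of parallelograms\<close>

definition left_end :: "(nat \<times> bool) list \<Rightarrow> nat \<Rightarrow> colour multiset multiset" where
  "left_end ps n = position False False (ps @ [(n, False)])"

definition right_end :: "(nat \<times> bool) list \<Rightarrow> nat \<Rightarrow> colour multiset multiset" where
  "right_end ps n = position False False (ps @ [(n, True)])"

text \<open>Rungs and diagonals. The remaining sides of a parallelogram are the rungs number 0 of
  the next level.\<close>

definition linked :: "colour multiset multiset \<Rightarrow> colour multiset multiset \<Rightarrow> bool" where
  "linked p q \<longleftrightarrow> (\<exists>ps n. {p, q} = {left_end ps n, right_end ps n} \<or> {p, q} = {right_end ps n, left_end ps (Suc n)})"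

text \<open>Walks to the vertices strictly beyond rung \<open>n\<close> of the ladder
  \<open>ps\<close>; the condition on \<open>r\<close> excludes the ends of that rung.\<close>

definition beneath :: "(nat \<times> bool) list \<Rightarrow> nat \<Rightarrow> (nat \<times> bool) list set" where
  "beneath ps n = {ps @ (i, e) # r |i e r. canonical r \<and> n \<le> i \<and> (r = [] \<longrightarrow> n < i)}"

text \<open>The ends of the rung get their positions directly, since the walk
  \<open>ps @ [(n, e)]\<close> need not be canonical.\<close>

definition place :: "'a \<Rightarrow> 'a \<Rightarrow> (nat \<times> bool) list \<Rightarrow> nat \<Rightarrow> ('a \<Rightarrow> (nat \<times> bool) list) \<Rightarrow> 'a \<Rightarrow> colour multiset multiset" where
  "place u v ps n P x = (if x = u then left_end ps n else if x = v then right_end ps n else position False False (P x))"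

lemma left_end_left: "left_end (ps @ [(n, False)]) 0 = left_end ps n"
  and right_end_left: "right_end (ps @ [(n, False)]) 0 = left_end ps (Suc n)"
  and left_end_right: "left_end (ps @ [(n, True)]) 0 = right_end ps n"
  and right_end_right: "right_end (ps @ [(n, True)]) 0 = right_end ps (Suc n)"
  using position_snoc_0_False position_snoc_0_True by (auto simp: left_end_def right_end_def)

lemma linked_commute: "linked p q \<longleftrightarrow> linked q p"
  by (simp add: linked_def insert_commute)

lemma linked_unit: "linked (left_end ps n) (right_end ps n)"
  and linked_diagonal: "linked (left_end ps (Suc n)) (right_end ps n)"
  by (auto simp: linked_def insert_commute)

lemma beneath_left: "beneath (ps @ [(n, e)]) 0 \<subseteq> {ps @ (n, e) # r |r. r \<noteq> [] \<and> canonical r}"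
proof
  fix q assume "q \<in> beneath (ps @ [(n, e)]) 0"
  then obtain i e' r where q: "q = (ps @ [(n, e)]) @ (i, e') # r" "canonical r" "r = [] \<longrightarrow> 0 < i"
    unfolding beneath_def by blast
  then have "canonical ((i, e') # r)" by (auto simp: canonical_def)
  then show "q \<in> {ps @ (n, e) # r |r. r \<noteq> [] \<and> canonical r}" using q(1) by auto
qed

lemma subseq_revI: "subseq xs ys \<Longrightarrow> subseq (rev xs) (rev ys)"
proof (induction rule: list_emb.induct)
  case (list_emb_Cons xs ys y)
  then show ?case by (simp add: subseq_rev_drop_many)
next
  case (list_emb_Cons2 x y xs ys)
  then show ?case by (auto intro: list_emb_append_mono)
qed simp

lemma noncrossing_rev: "noncrossing E xs \<Longrightarrow> noncrossing E (rev xs)"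
  unfolding noncrossing_def
proof (intro allI impI)
  fix a b c d
  assume nc: "\<forall>a b c d. subseq [a, b, c, d] xs \<longrightarrow> {a, c} \<notin> E \<or> {b, d} \<notin> E" and s: "subseq [a, b, c, d] (rev xs)"
  have "subseq [d, c, b, a] xs" using subseq_revI[OF s] by simp
  then show "{a, c} \<notin> E \<or> {b, d} \<notin> E" using nc by (metis insert_commute)
qed

lemma noncrossing_subseq: "noncrossing E xs \<Longrightarrow> subseq ys xs \<Longrightarrow> noncrossing E ys"
  unfolding noncrossing_def by (meson subseq_order.order_trans)

text \<open>\<open>w\<close> is the last neighbour of \<open>u\<close> in \<open>ms\<close>, or the
  first entry if there is none. An edge from \<open>A\<close> past \<open>w\<close> would cross the
  edge from \<open>u\<close> to \<open>w\<close>, and \<open>u\<close> has no neighbour in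
  \<open>B\<close>.\<close>

lemma noncrossing_split:
  assumes nc: "noncrossing E (u # ms @ [v])" and ms: "ms \<noteq> []"
  obtains A w B where "ms = A @ w # B"
    "\<And>x y. x \<in> set (u # A) \<Longrightarrow> y \<in> set (B @ [v]) \<Longrightarrow> {x, y} \<in> E \<Longrightarrow> x = u \<and> y = v"
proof -
  obtain A w B where ABw: "ms = A @ w # B" and B: "\<And>y. y \<in> set B \<Longrightarrow> {u, y} \<notin> E" and A: "A = [] \<or> {u, w} \<in> E"
  proof (cases "\<exists>y\<in>set ms. {u, y} \<in> E")
    case True
    from split_list_last_prop[OF this] show ?thesis using that by blast
  next
    case False
    then show ?thesis using that[of "[]" "hd ms" "tl ms"] ms by (metis append_Nil list.collapse list.set_sel(2))
  qed
  show thesis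
  proof (rule that[OF ABw])
    fix x y assume xy: "x \<in> set (u # A)" "y \<in> set (B @ [v])" "{x, y} \<in> E"
    have "x = u"
    proof (rule ccontr)
      assume "x \<noteq> u"
      then have xA: "x \<in> set A" using xy(1) by simp
      then have uw: "{u, w} \<in> E" using A by auto
      have "subseq ([x] @ [w] @ [y]) (A @ [w] @ (B @ [v]))"
        using xA xy(2) by (intro list_emb_append_mono) (auto simp: subseq_singleton_left)
      then have "subseq [u, x, w, y] (u # ms @ [v])" by (simp add: ABw)
      then show False using nc uw xy(3) unfolding noncrossing_def by blast
    qed
    then show "x = u \<and> y = v" using B xy by auto
  qed
qed

definition links :: "'a set set \<Rightarrow> 'a set \<Rightarrow> ('a \<Rightarrow> colour multiset multiset) \<Rightarrow> bool" where
  "links E S f \<longleftrightarrow> (\<forall>x\<in>S. \<forall>y\<in>S. x \<noteq> y \<and> {x, y} \<in> E \<longrightarrow> linked (f x) (f y))"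

lemma links_cong: "(\<And>x. x \<in> S \<Longrightarrow> f x = g x) \<Longrightarrow> links E S f = links E S g"
  by (simp add: links_def)

lemma links_Un:
  assumes "links E S f" "links E T f" "linked (f u) (f v)"
    and cross: "\<And>x y. x \<in> S \<Longrightarrow> y \<in> T \<Longrightarrow> {x, y} \<in> E \<Longrightarrow> x \<in> T \<or> y \<in> S \<or> x = u \<and> y = v"
  shows "links E (S \<union> T) f"
  unfolding links_def
proof (intro ballI impI, elim conjE)
  fix x y assume xy: "x \<in> S \<union> T" "y \<in> S \<union> T" "x \<noteq> y" "{x, y} \<in> E"
  then have yx: "{y, x} \<in> E" by (simp add: insert_commute)
  consider "x \<in> S" "y \<in> S" | "x \<in> T" "y \<in> T" | "x = u" "y = v" | "y = u" "x = v"
    using xy(1,2) cross[OF _ _ xy(4)] cross[OF _ _ yx] by blast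
  then show "linked (f x) (f y)"
    using assms(1-3) xy(3,4) linked_commute[of "f u" "f v"] unfolding links_def by cases auto
qed

text \<open>
  The triangle over the edge from \<open>u\<close> to \<open>v\<close> has its apex \<open>w\<close> at the left end of the opposite side; if
  there are vertices between \<open>w\<close> and \<open>v\<close>, the right end of that side completes the parallelogram.
\<close>

lemma placement:
  assumes "distinct (u # ms @ [v])" "noncrossing E (u # ms @ [v])"
  shows "\<exists>P. inj_on P (set ms) \<and> P ` set ms \<subseteq> beneath ps n \<and> links E (set (u # ms @ [v])) (place u v ps n P)"
  using assms
proof (induction "length ms" arbitrary: u ms v ps n rule: less_induct)
  case less
  show ?case
  proof (cases "ms = []")
    case True
    have "links E {u, v} (place u v ps n (\<lambda>_. []))"
      using less.prems(1) linked_unit[of ps n] linked_commute[of "left_end ps n" "right_end ps n"] by (auto simp: links_def place_def)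
    then show ?thesis using True by auto
  next
    case False
    obtain A w B where ms: "ms = A @ w # B"
      and AB: "\<And>x y. x \<in> set (u # A) \<Longrightarrow> y \<in> set (B @ [v]) \<Longrightarrow> {x, y} \<in> E \<Longrightarrow> x = u \<and> y = v"
      using noncrossing_split[OF less.prems(2) False] by metis
    have sA: "subseq (u # A @ [w]) (u # ms @ [v])" and sB: "subseq (w # B @ [v]) (u # ms @ [v])"
      using subseq_rev_drop_many[OF subseq_order.order_refl, of "u # A @ [w]" "B @ [v]"]
        subseq_drop_many[OF subseq_order.order_refl, of "w # B @ [v]" "u # A"] by (simp_all add: ms)
    have dist: "distinct (u # A @ [w])" "distinct (w # B @ [v])" using less.prems(1) by (auto simp: ms)
    have uv: "u \<noteq> v" "u \<notin> set ms" "v \<notin> set ms" using less.prems(1) by auto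
    obtain PA where PA: "inj_on PA (set A)" "PA ` set A \<subseteq> beneath (ps @ [(n, False)]) 0"
      "links E (set (u # A @ [w])) (place u w (ps @ [(n, False)]) 0 PA)"
      using less.hyps[OF _ dist(1) noncrossing_subseq[OF less.prems(2) sA], of "ps @ [(n, False)]" 0]
      by (auto simp: ms simp del: set_append set_simps)
    have "\<exists>P. inj_on P (set (w # B)) \<and> P w = ps @ [(Suc n, False)] \<and>
        P ` set (w # B) \<subseteq> {ps @ [(Suc n, False)], ps @ [(Suc n, True)]} \<union> beneath ps (Suc n) \<union> beneath (ps @ [(n, True)]) 0 \<and>
        links E (set (w # B @ [v])) (place u v ps n P)"
    proof (cases "B = []")
      case True
      then show ?thesis using uv dist linked_diagonal[of ps n]
          linked_commute[of "left_end ps (Suc n)" "right_end ps n"]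
        by (intro exI[of _ "\<lambda>_. ps @ [(Suc n, False)]"]) (auto simp: links_def place_def ms simp flip: left_end_def)
    next
      case False
      \<comment> \<open>\<open>y\<close> becomes the fourth corner: \<open>C\<close> goes over the
        next rung from \<open>w\<close> to \<open>y\<close>, and \<open>D\<close> over the right
        side.\<close>
      obtain C y D where B: "B = C @ y # D"
        and CD: "\<And>x x'. x \<in> set (w # C) \<Longrightarrow> x' \<in> set (D @ [v]) \<Longrightarrow> {x, x'} \<in> E \<Longrightarrow> x = w \<and> x' = v"
        using noncrossing_split[OF noncrossing_subseq[OF less.prems(2) sB] False] by metis
      have sC: "subseq (w # C @ [y]) (u # ms @ [v])" and sD: "subseq (y # D @ [v]) (u # ms @ [v])"
        using subseq_rev_drop_many[OF subseq_order.order_refl, of "w # C @ [y]" "D @ [v]"]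
          subseq_drop_many[OF subseq_order.order_refl, of "y # D @ [v]" "w # C"]
        by (auto simp: B simp del: subseq_Cons2_iff intro: subseq_order.order_trans[OF _ sB])
      have dist': "distinct (w # C @ [y])" "distinct (v # rev D @ [y])" using dist by (auto simp: B)
      obtain PC where PC: "inj_on PC (set C)" "PC ` set C \<subseteq> beneath ps (Suc n)"
        "links E (set (w # C @ [y])) (place w y ps (Suc n) PC)"
        using less.hyps[OF _ dist'(1) noncrossing_subseq[OF less.prems(2) sC], of ps "Suc n"]
        by (auto simp: ms B simp del: set_append set_simps)
      \<comment> \<open>The right side is directed from \<open>v\<close> to \<open>y\<close>,
        against the order of the vertices.\<close>
      have "noncrossing E (v # rev D @ [y])"
        using noncrossing_rev[OF noncrossing_subseq[OF less.prems(2) sD]] by simp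
      then obtain PD where PD: "inj_on PD (set D)" "PD ` set D \<subseteq> beneath (ps @ [(n, True)]) 0"
        "links E (set (v # D @ [y])) (place v y (ps @ [(n, True)]) 0 PD)"
        using less.hyps[of "rev D" v y "ps @ [(n, True)]" 0] dist'(2) by (auto simp: ms B)
      define P where "P x = (if x = w then ps @ [(Suc n, False)] else if x = y then ps @ [(Suc n, True)]
        else if x \<in> set C then PC x else PD x)" for x
      have PCx: "P x = PC x" if "x \<in> set C" for x using that dist' by (auto simp: P_def)
      have PDx: "P x = PD x" if "x \<in> set D" for x using that dist by (auto simp: P_def B)
      have Pw: "P w = ps @ [(Suc n, False)]" "P y = ps @ [(Suc n, True)]" using dist' by (auto simp: P_def)
      have img: "P ` set C \<subseteq> beneath ps (Suc n)" "P ` set D \<subseteq> beneath (ps @ [(n, True)]) 0"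
        using PC(2) PD(2) PCx PDx by auto
      have disj: "ps @ [(Suc n, e)] \<notin> beneath ps (Suc n)" "ps @ [(Suc n, e)] \<notin> beneath (ps @ [(n, True)]) 0"
        "beneath ps (Suc n) \<inter> beneath (ps @ [(n, True)]) 0 = {}" for e
        using beneath_left[of ps n True] by (auto simp: beneath_def)
      have inj: "inj_on P (set (w # B))"
      proof -
        have "inj_on P (set C)" "inj_on P (set D)"
          using PC(1) PD(1) PCx PDx by (auto simp: inj_on_def)
        moreover have "P ` set C \<inter> P ` set D = {}" using img disj by blast
        ultimately have "inj_on P (set C \<union> set D)" by (auto simp: inj_on_Un)
        moreover have "P w \<notin> P ` (set C \<union> set D)" "P y \<notin> P ` (set C \<union> set D)" "P w \<noteq> P y"
          unfolding Pw image_Un using img disj by (blast, blast, simp)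
        ultimately have "inj_on P (insert w (insert y (set C \<union> set D)))" unfolding inj_on_insert by blast
        moreover have "set (w # B) = insert w (insert y (set C \<union> set D))" by (auto simp: B)
        ultimately show ?thesis by simp
      qed
      have plC: "place u v ps n P x = place w y ps (Suc n) PC x" if "x \<in> set (w # C @ [y])" for x
        using that dist dist' uv PCx Pw by (auto simp: place_def ms B left_end_def right_end_def)
      have plD: "place u v ps n P x = place v y (ps @ [(n, True)]) 0 PD x" if "x \<in> set (v # D @ [y])" for x
        using that dist dist' uv PDx Pw left_end_right[of ps n] right_end_right[of ps n] by (auto simp: place_def ms B left_end_def right_end_def)
      have wv: "linked (place u v ps n P w) (place u v ps n P v)"
        using uv dist linked_diagonal[of ps n] Pw by (auto simp: place_def ms left_end_def)
      have "links E (set (w # C @ [y]) \<union> set (v # D @ [y])) (place u v ps n P)"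
      proof (rule links_Un)
        show "links E (set (w # C @ [y])) (place u v ps n P)" "links E (set (v # D @ [y])) (place u v ps n P)"
          by (subst links_cong[OF plC], assumption, rule PC(3), subst links_cong[OF plD], assumption, rule PD(3))
        show "linked (place u v ps n P w) (place u v ps n P v)" by (rule wv)
        show "x \<in> set (v # D @ [y]) \<or> x' \<in> set (w # C @ [y]) \<or> x = w \<and> x' = v"
          if "x \<in> set (w # C @ [y])" "x' \<in> set (v # D @ [y])" "{x, x'} \<in> E" for x x'
          using that CD[of x x'] by auto
      qed
      moreover have "set (w # C @ [y]) \<union> set (v # D @ [y]) = set (w # B @ [v])" by (auto simp: B)
      ultimately have "links E (set (w # B @ [v])) (place u v ps n P)" by simp
      moreover have "P ` set (w # B) \<subseteq> {ps @ [(Suc n, False)], ps @ [(Suc n, True)]} \<union> beneath ps (Suc n) \<union> beneath (ps @ [(n, True)]) 0"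
        using img by (auto simp: B Pw)
      ultimately show ?thesis using inj Pw(1) by blast
    qed
    then obtain PB where PB: "inj_on PB (set (w # B))" "PB w = ps @ [(Suc n, False)]"
      "PB ` set (w # B) \<subseteq> {ps @ [(Suc n, False)], ps @ [(Suc n, True)]} \<union> beneath ps (Suc n) \<union> beneath (ps @ [(n, True)]) 0"
      "links E (set (w # B @ [v])) (place u v ps n PB)" by blast
    define P where "P x = (if x \<in> set A then PA x else PB x)" for x
    have PAx: "P x = PA x" if "x \<in> set A" for x using that by (simp add: P_def)
    have PBx: "P x = PB x" if "x \<in> set (w # B)" for x using that less.prems(1) by (auto simp: P_def ms)
    have img: "P ` set A \<subseteq> beneath (ps @ [(n, False)]) 0"
      "P ` set (w # B) \<subseteq> {ps @ [(Suc n, False)], ps @ [(Suc n, True)]} \<union> beneath ps (Suc n) \<union> beneath (ps @ [(n, True)]) 0"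
      using PA(2) PB(3) PAx PBx by (auto simp: image_subset_iff)
    have "beneath (ps @ [(n, False)]) 0 \<inter> ({ps @ [(Suc n, False)], ps @ [(Suc n, True)]} \<union> beneath ps (Suc n) \<union> beneath (ps @ [(n, True)]) 0) = {}"
      using beneath_left[of ps n True] beneath_left[of ps n False] by (auto simp: beneath_def)
    then have disj: "P ` set A \<inter> P ` set (w # B) = {}" using img by blast
    have "inj_on P (set A)" "inj_on P (set (w # B))" using PA(1) PB(1) PAx PBx by (auto simp: inj_on_def)
    then have inj: "inj_on P (set ms)" using disj by (auto simp: ms inj_on_Un)
    have b1: "beneath (ps @ [(n, e)]) 0 \<subseteq> beneath ps n" for e
      by (rule order_trans[OF beneath_left]) (auto simp: beneath_def)
    have b2: "beneath ps (Suc n) \<subseteq> beneath ps n" by (auto simp: beneath_def)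
    have b3: "ps @ [(Suc n, e)] \<in> beneath ps n" for e by (auto simp: beneath_def canonical_def)
    have "P ` set A \<subseteq> beneath ps n" using img(1) b1[of False] by (rule order_trans)
    moreover have "P ` set (w # B) \<subseteq> beneath ps n"
      by (rule order_trans[OF img(2)]) (use b1[of True] b2 b3[of False] b3[of True] in simp)
    ultimately have sub: "P ` set ms \<subseteq> beneath ps n" by (simp add: ms image_Un)
    have plA: "place u v ps n P x = place u w (ps @ [(n, False)]) 0 PA x" if "x \<in> set (u # A @ [w])" for x
      using that dist uv PAx PBx[of w] PB(2) left_end_left[of ps n] right_end_left[of ps n] less.prems(1)
      by (auto simp: place_def ms left_end_def right_end_def)
    have plB: "place u v ps n P x = place u v ps n PB x" if "x \<in> set (w # B @ [v])" for x
      using that uv PBx by (auto simp: place_def ms)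
    have "links E (set (u # A @ [w]) \<union> set (w # B @ [v])) (place u v ps n P)"
    proof (rule links_Un)
      show "links E (set (u # A @ [w])) (place u v ps n P)" "links E (set (w # B @ [v])) (place u v ps n P)"
        by (subst links_cong[OF plA], assumption, rule PA(3), subst links_cong[OF plB], assumption, rule PB(4))
      show "linked (place u v ps n P u) (place u v ps n P v)" using linked_unit[of ps n] uv by (simp add: place_def)
      show "x \<in> set (w # B @ [v]) \<or> y \<in> set (u # A @ [w]) \<or> x = u \<and> y = v"
        if "x \<in> set (u # A @ [w])" "y \<in> set (w # B @ [v])" "{x, y} \<in> E" for x y
        using that AB[of x y] by auto
    qed
    moreover have "set (u # A @ [w]) \<union> set (w # B @ [v]) = set (u # ms @ [v])" by (auto simp: ms)
    ultimately have "links E (set (u # ms @ [v])) (place u v ps n P)" by simp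
    then show ?thesis using inj sub by blast
  qed
qed

text \<open>The first and the last vertex span the base edge from 0 to 1. All other positions have a
  non-constant monomial and are separated by \<open>position_inj\<close>.\<close>

theorem outerplanar_placement:
  assumes "distinct vs" "noncrossing E vs"
  obtains pos where "inj_on pos (set vs)" "\<And>x. x \<in> set vs \<Longrightarrow> \<exists>q. pos x = position False False q"
    "links E (set vs) pos"
proof (cases "length vs \<le> 1")
  case True
  then have "x = y" if "x \<in> set vs" "y \<in> set vs" for x y
    using that by (cases vs) auto
  then show thesis using that[of "\<lambda>_. position False False []"] unfolding inj_on_def links_def by blast
next
  case False
  then obtain u ms v where vs: "vs = u # ms @ [v]"
    by (cases vs; cases "tl vs" rule: rev_cases) auto
  obtain P where P: "inj_on P (set ms)" "P ` set ms \<subseteq> beneath [] 0"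
    "links E (set vs) (place u v [] 0 P)"
    using placement[of u ms v E "[]" 0] assms unfolding vs by blast
  let ?pos = "place u v [] 0 P"
  have beneath: "canonical (P x)" "P x \<noteq> []" if "x \<in> set ms" for x
  proof -
    have "P x \<in> beneath [] 0" using P(2) that by blast
    then show "canonical (P x)" "P x \<noteq> []" by (auto simp: beneath_def canonical_def)
  qed
  have uv: "u \<noteq> v" "u \<notin> set ms" "v \<notin> set ms" using assms(1) by (auto simp: vs)
  have pm: "?pos x = position False False (P x)" if "x \<in> set ms" for x using that uv by (auto simp: place_def)
  have pu: "?pos u = {#}" "?pos v = {#{#}#}" using uv by (auto simp: place_def left_end_def right_end_def)
  have neu: "?pos x \<noteq> {#}" "?pos x \<noteq> {#{#}#}" if x: "x \<in> set ms" for x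
  proof -
    obtain \<nu> where \<nu>: "\<nu> \<in># position_rest False False (P x)" using canonical_position_rest[OF beneath[OF x], of False False] by blast
    then have "\<nu> \<in># ?pos x" "\<nu> \<noteq> {#}" using pm[OF x] position_rest_nonempty_mono[OF \<nu>] by (auto simp: position_eq_position_rest)
    then show "?pos x \<noteq> {#}" "?pos x \<noteq> {#{#}#}" by auto
  qed
  have "inj_on ?pos (set ms)"
  proof (rule inj_onI)
    fix x y assume xy: "x \<in> set ms" "y \<in> set ms" "?pos x = ?pos y"
    then have "P x = P y" using position_inj beneath pm by metis
    then show "x = y" using P(1) xy by (auto simp: inj_on_def)
  qed
  then have "inj_on ?pos (set vs)" using neu pu uv unfolding vs inj_on_def by (auto; metis)
  moreover have "\<exists>q. ?pos x = position False False q" for x unfolding place_def left_end_def right_end_def by metis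
  ultimately show thesis using that P(3) by blast
qed

subsection \<open>Generic parameters\<close>

text \<open>Values of polynomials with natural coefficients; their injectivity in the multiset says
  that \<open>\<omega>\<close> is transcendental, without mentioning signs.\<close>

definition power_sum :: "complex \<Rightarrow> nat multiset \<Rightarrow> complex" where
  "power_sum \<omega> A = (\<Sum>k\<in>#A. \<omega> ^ k)"

lemma countable_multisets: "countable (UNIV :: nat multiset set)"
proof -
  have "(UNIV :: nat multiset set) = range mset" by (metis UNIV_eq_I ex_mset rangeI)
  then show ?thesis by (metis countableI_type countable_image)
qed

lemma finite_power_sum_eq:
  assumes "A \<noteq> B"
  shows "finite {\<omega>. power_sum \<omega> A = power_sum \<omega> B}"
proof -
  define P where "P M = (\<Sum>k\<in>#M. monom 1 k :: complex poly)" for M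
  have c: "coeff (P M) j = of_nat (count M j)" for M j
    by (induction M) (auto simp: P_def)
  have e: "poly (P M) \<omega> = power_sum \<omega> M" for M \<omega>
    by (induction M) (auto simp: P_def power_sum_def poly_monom)
  have "P A \<noteq> P B"
  proof
    assume "P A = P B"
    then have "count A j = count B j" for j using c[of A j] c[of B j] by simp
    then show False using assms by (simp add: multiset_eq_iff)
  qed
  then have "finite {x. poly (P A - P B) x = 0}" by (intro poly_roots_finite) simp
  then show ?thesis by (simp add: e)
qed

lemma exists_independent_unit:
  obtains \<omega> :: complex where "cmod \<omega> = 1" "\<And>A B. power_sum \<omega> A = power_sum \<omega> B \<Longrightarrow> A = B"
proof -
  let ?bad = "\<Union>(A, B) \<in> {(A, B). A \<noteq> B}. {\<omega>. power_sum \<omega> A = power_sum \<omega> B}"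
  have "countable (UNIV :: (nat multiset \<times> nat multiset) set)"
    using countable_SIGMA[OF countable_multisets countable_multisets] by simp
  then have "countable ?bad"
    by (intro countable_UN) (auto intro: countable_subset countable_finite finite_power_sum_eq)
  moreover have "uncountable (sphere (0::complex) 1)"
    by (rule connected_uncountable[of _ 1 "-1"]) (auto intro: connected_sphere)
  ultimately have "\<not> sphere 0 1 \<subseteq> ?bad" using countable_subset by blast
  then obtain \<omega> where "\<omega> \<in> sphere 0 1" "\<omega> \<notin> ?bad" by blast
  then show thesis by (intro that[of \<omega>]) auto
qed

text \<open>Terms for the ring generated by \<open>\<omega>\<close> and its conjugate, which is
  countable because the terms are.\<close>

datatype ring_term = One | Gen | Cnj | Plus ring_term ring_term | Minus ring_term ring_term | Times ring_term ring_term

instance ring_term :: countable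
  by countable_datatype

primrec ring_eval :: "complex \<Rightarrow> ring_term \<Rightarrow> complex" where
  "ring_eval \<omega> One = 1"
| "ring_eval \<omega> Gen = \<omega>"
| "ring_eval \<omega> Cnj = cnj \<omega>"
| "ring_eval \<omega> (Plus s t) = ring_eval \<omega> s + ring_eval \<omega> t"
| "ring_eval \<omega> (Minus s t) = ring_eval \<omega> s - ring_eval \<omega> t"
| "ring_eval \<omega> (Times s t) = ring_eval \<omega> s * ring_eval \<omega> t"

definition gen_ring :: "complex \<Rightarrow> complex set" where
  "gen_ring \<omega> = range (ring_eval \<omega>)"

lemma gen_ring_intros:
  "1 \<in> gen_ring \<omega>" "\<omega> \<in> gen_ring \<omega>" "cnj \<omega> \<in> gen_ring \<omega>"
  "a \<in> gen_ring \<omega> \<Longrightarrow> b \<in> gen_ring \<omega> \<Longrightarrow> a + b \<in> gen_ring \<omega>"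
  "a \<in> gen_ring \<omega> \<Longrightarrow> b \<in> gen_ring \<omega> \<Longrightarrow> a - b \<in> gen_ring \<omega>"
  "a \<in> gen_ring \<omega> \<Longrightarrow> b \<in> gen_ring \<omega> \<Longrightarrow> a * b \<in> gen_ring \<omega>"
proof -
  have e: "ring_eval \<omega> t \<in> gen_ring \<omega>" for t by (simp add: gen_ring_def)
  show "1 \<in> gen_ring \<omega>" "\<omega> \<in> gen_ring \<omega>" "cnj \<omega> \<in> gen_ring \<omega>"
    using e[of One] e[of Gen] e[of Cnj] by simp_all
  fix a b assume "a \<in> gen_ring \<omega>" "b \<in> gen_ring \<omega>"
  then obtain s t where "a = ring_eval \<omega> s" "b = ring_eval \<omega> t" by (auto simp: gen_ring_def)
  then show "a + b \<in> gen_ring \<omega>" "a - b \<in> gen_ring \<omega>" "a * b \<in> gen_ring \<omega>"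
    using e[of "Plus s t"] e[of "Minus s t"] e[of "Times s t"] by simp_all
qed

lemma gen_ring_0: "0 \<in> gen_ring \<omega>"
  using gen_ring_intros(5)[OF gen_ring_intros(1,1)] by simp

lemma gen_ring_power: "\<omega> ^ k \<in> gen_ring \<omega>"
  by (induction k) (auto intro: gen_ring_intros)

lemma gen_ring_cnj: "a \<in> gen_ring \<omega> \<Longrightarrow> cnj a \<in> gen_ring \<omega>"
proof -
  have "cnj (ring_eval \<omega> t) \<in> gen_ring \<omega>" for t
    by (induction t) (simp_all add: gen_ring_intros)
  then show "a \<in> gen_ring \<omega> \<Longrightarrow> cnj a \<in> gen_ring \<omega>" by (auto simp: gen_ring_def)
qed

text \<open>Each nontrivial relation excludes finitely many \<open>s\<close>. Degree two is what the
  condition for diagonals leads to in \<open>diagonal_integer\<close>.\<close>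

lemma exists_generic_real:
  obtains s :: real where "s > 0"
    "\<And>a b c. a \<in> gen_ring \<omega> \<Longrightarrow> b \<in> gen_ring \<omega> \<Longrightarrow> c \<in> gen_ring \<omega> \<Longrightarrow>
      a + b * of_real s + c * of_real s ^ 2 = 0 \<Longrightarrow> a = 0 \<and> b = 0 \<and> c = 0"
proof -
  let ?K = "gen_ring \<omega>"
  let ?R = "\<lambda>(a :: complex, b, c). {s :: real. a + b * of_real s + c * of_real s ^ 2 = 0}"
  let ?bad = "\<Union>p \<in> ?K \<times> ?K \<times> ?K - {(0, 0, 0)}. ?R p"
  have K: "countable ?K" by (simp add: gen_ring_def)
  have "finite (?R p)" if "p \<noteq> (0, 0, 0)" for p :: "complex \<times> complex \<times> complex"
  proof -
    obtain a b c where p: "p = (a, b, c)" by (cases p) auto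
    have "[:a, b, c:] \<noteq> 0" using that p by auto
    then have "finite {x. poly [:a, b, c:] x = 0}" by (rule poly_roots_finite)
    then have "finite (complex_of_real -` {x. poly [:a, b, c:] x = 0})"
      by (rule finite_vimageI) (simp add: inj_on_def)
    moreover have "?R p \<subseteq> complex_of_real -` {x. poly [:a, b, c:] x = 0}"
      by (auto simp: p power2_eq_square algebra_simps)
    ultimately show ?thesis by (rule finite_subset[rotated])
  qed
  then have "countable ?bad"
  proof (intro countable_UN)
    show "countable (?K \<times> ?K \<times> ?K - {(0, 0, 0)})" by (intro countable_Diff countable_SIGMA K)
  qed (auto intro!: countable_finite)
  moreover have "uncountable {0<..<1::real}" by (simp add: uncountable_open_interval)
  ultimately have "\<not> {0<..<1} \<subseteq> ?bad" using countable_subset by blast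
  then obtain s where "s \<in> {0<..<1}" "s \<notin> ?bad" by blast
  then show thesis by (intro that[of s]) auto
qed

lemma count_image_mset_inj_on:
  assumes "inj_on f S" "set_mset A \<subseteq> S" "x \<in> S"
  shows "count (image_mset f A) (f x) = count A x"
  using assms(2)
proof (induction A)
  case (add a A)
  then show ?case using assms(1,3) by (auto simp: inj_on_eq_iff)
qed simp

lemma image_mset_inj_on:
  assumes "inj_on f S" "set_mset A \<subseteq> S" "set_mset B \<subseteq> S" "image_mset f A = image_mset f B"
  shows "A = B"
proof (rule multiset_eqI)
  fix x
  show "count A x = count B x"
  proof (cases "x \<in> S")
    case True
    then show ?thesis using count_image_mset_inj_on[OF assms(1,2)] count_image_mset_inj_on[OF assms(1,3)] assms(4) by metis
  next
    case False
    then have "x \<notin># A" "x \<notin># B" using assms by auto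
    then show ?thesis by (simp add: not_in_iff)
  qed
qed

lemma sum_mset_coeff_diff:
  fixes g :: "'a \<Rightarrow> complex"
  assumes "\<And>\<nu>. \<nu> \<noteq> z \<Longrightarrow> coeff_diff w b \<nu> = 0"
  shows "(\<Sum>\<nu>\<in>#w. g \<nu>) - (\<Sum>\<nu>\<in>#b. g \<nu>) = of_int (coeff_diff w b z) * g z"
proof -
  have "w + replicate_mset (count b z) z = b + replicate_mset (count w z) z"
    using assms by (intro multiset_eqI) (auto simp: coeff_diff_def)
  from arg_cong[OF this, of "\<lambda>M. \<Sum>\<nu>\<in>#M. g \<nu>"]
  show ?thesis by (simp add: coeff_diff_def algebra_simps)
qed

section \<open>Multisets as digits of a number\<close>

lemma base_expansion_bound:
  assumes "\<And>j. j \<in># B \<Longrightarrow> j < (k::nat)" "size B < N"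
  shows "(\<Sum>j\<in>#B. N ^ j) < (N::nat) ^ k"
proof (cases "B = {#}")
  case True then show ?thesis using assms(2) by simp
next
  case False
  then obtain x where "x \<in># B" by (meson multiset_nonemptyE)
  then have k: "k \<noteq> 0" using assms(1)[of x] by simp
  have N: "1 \<le> N" using assms(2) by simp
  have "(\<Sum>j\<in>#B. N ^ j) \<le> (\<Sum>j\<in>#B. N ^ (k - 1))"
  proof (rule sum_mset_mono)
    fix j assume "j \<in># B"
    then have "j \<le> k - 1" using assms(1)[of j] by linarith
    then show "N ^ j \<le> N ^ (k - 1)" using N by (rule power_increasing)
  qed
  also have "\<dots> = size B * N ^ (k - 1)" by simp
  also have "\<dots> < N * N ^ (k - 1)" using assms(2) N by simp
  also have "\<dots> = N ^ k" using k by (cases k) auto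
  finally show ?thesis .
qed

text \<open>After cancelling common digits, the largest power occurs on one side only and exceeds
  the whole other sum.\<close>

lemma base_expansion_unique:
  assumes "(\<Sum>j\<in>#A. N ^ j) = (\<Sum>j\<in>#B. (N::nat) ^ j)" "size A < N" "size B < N"
  shows "A = B"
  using assms
proof (induction "size A" arbitrary: A B rule: less_induct)
  case less
  show ?case
  proof (cases "\<exists>x. x \<in># A \<and> x \<in># B")
    case True
    then obtain x A' B' where AB: "A = add_mset x A'" "B = add_mset x B'" by (meson multi_member_split)
    then have "A' = B'" using less.hyps[of A' B'] less.prems by simp
    then show ?thesis using AB by simp
  next
    case False
    show ?thesis
    proof (cases "A = {#} \<and> B = {#}")
      case nonempty: False
      define j where "j = Max (set_mset (A + B))"
      have mx: "\<And>i. i \<in># A + B \<Longrightarrow> i \<le> j" unfolding j_def by (rule Max_ge) auto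
      have j: "j \<in># A + B"
        unfolding j_def by (rule Max_in) (use nonempty in auto)
      have big: "N ^ j \<le> (\<Sum>j\<in>#C. N ^ j)" if "j \<in># C" for C
        using multi_member_split[OF that] by auto
      have False
      proof (cases "j \<in># A")
        case True
        then have "i < j" if "i \<in># B" for i using that mx[of i] False by (metis le_neq_implies_less union_iff)
        from base_expansion_bound[OF this less.prems(3)] big[OF True] less.prems(1) show False by simp
      next
        case jA: False
        then have jB: "j \<in># B" using j by simp
        have "i < j" if "i \<in># A" for i using that mx[of i] jA by (metis le_neq_implies_less union_iff)
        from base_expansion_bound[OF this less.prems(2)] big[OF jB] less.prems(1) show False by simp
      qed
      then show ?thesis ..
    qed simp
  qed
qed

section \<open>Evaluation of positions at generic parameters\<close>

text \<open>\<open>M\<close> bounds the degrees of the positions. Monomials of degree up to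
  \<open>M + 1\<close> are considered, and products of two of them, of degree at most
  \<open>2 * M + 2\<close>, must stay readable in base \<open>N\<close>.\<close>

locale generic_parameters =
  fixes \<omega> :: complex and s :: real and M N :: nat
  assumes norm_\<omega>: "cmod \<omega> = 1"
    and independent: "\<And>A B. power_sum \<omega> A = power_sum \<omega> B \<Longrightarrow> A = B"
    and s_pos: "s > 0"
    and generic: "\<And>a b c. a \<in> gen_ring \<omega> \<Longrightarrow> b \<in> gen_ring \<omega> \<Longrightarrow> c \<in> gen_ring \<omega> \<Longrightarrow>
      a + b * of_real s + c * of_real s ^ 2 = 0 \<Longrightarrow> a = 0 \<and> b = 0 \<and> c = 0"
    and N: "2 * M + 2 < N"
begin

text \<open>
  Colours become powers of \<open>\<omega>\<close> with exponents \<open>N ^ j\<close>, so that monomials of degree below \<open>N\<close> can be read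
  off their exponents.
\<close>

definition wt :: "colour \<Rightarrow> nat" where
  "wt x = N ^ (2 * snd x + of_bool (fst x))"

definition expo :: "colour multiset \<Rightarrow> nat" where
  "expo \<nu> = (\<Sum>x\<in>#\<nu>. wt x)"

definition ev :: "colour multiset multiset \<Rightarrow> complex" where
  "ev F = (\<Sum>\<nu>\<in>#F. \<omega> ^ expo \<nu>)"

definition rad :: "nat \<Rightarrow> real" where
  "rad k = (if even k then 1 else s)"

text \<open>A monomial of degree \<open>k\<close> is a side on level \<open>k\<close> and has length
  \<open>rad k\<close>; \<open>ev\<close> forgets the lengths.\<close>

definition val :: "colour multiset multiset \<Rightarrow> complex" where
  "val F = (\<Sum>\<nu>\<in>#F. of_real (rad (size \<nu>)) * \<omega> ^ expo \<nu>)"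

lemma expo_simps [simp]: "expo {#} = 0" "expo (add_mset x \<nu>) = wt x + expo \<nu>" "expo (\<nu> + \<kappa>) = expo \<nu> + expo \<kappa>"
  by (simp_all add: expo_def)

lemma ev_simps [simp]: "ev {#} = 0" "ev (add_mset \<nu> F) = \<omega> ^ expo \<nu> + ev F" "ev (F + G) = ev F + ev G"
  by (simp_all add: ev_def)

lemma val_simps [simp]: "val {#} = 0" "val (add_mset \<nu> F) = of_real (rad (size \<nu>)) * \<omega> ^ expo \<nu> + val F"
  by (simp_all add: val_def)

lemma wt_pos: "0 < wt x"
  using N by (simp add: wt_def)

lemma expo_inj: "inj_on expo {\<nu>. size \<nu> < N}"
proof (rule inj_onI)
  fix \<nu> \<kappa> assume a: "\<nu> \<in> {\<nu>. size \<nu> < N}" "\<kappa> \<in> {\<nu>. size \<nu> < N}" "expo \<nu> = expo \<kappa>"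
  define f :: "colour \<Rightarrow> nat" where "f x = 2 * snd x + of_bool (fst x)" for x
  have e: "expo \<nu> = (\<Sum>j\<in>#image_mset f \<nu>. N ^ j)" for \<nu>
    by (simp add: expo_def wt_def f_def image_mset.compositionality comp_def)
  have "image_mset f \<nu> = image_mset f \<kappa>"
    by (rule base_expansion_unique) (use a e in auto)
  moreover have "inj f"
  proof (rule injI)
    fix x y :: colour assume eq: "f x = f y"
    obtain a i b j where xy: "x = (a, i)" "y = (b, j)" by (cases x; cases y) auto
    have "2 * i + of_bool a = 2 * j + (of_bool b :: nat)" using eq by (simp add: f_def xy)
    then show "x = y" unfolding xy by (cases a; cases b; simp; presburger)
  qed
  ultimately show "\<nu> = \<kappa>" by (metis injD multiset.inj_map)
qed

lemma ev_power_sum: "\<omega> ^ k * ev F = power_sum \<omega> (image_mset (\<lambda>\<nu>. k + expo \<nu>) F)"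
  by (induction F) (auto simp: power_sum_def algebra_simps power_add)

lemma ev_inj:
  assumes "\<And>\<nu>. \<nu> \<in># F \<Longrightarrow> size \<nu> < N" "\<And>\<nu>. \<nu> \<in># G \<Longrightarrow> size \<nu> < N" "ev F = ev G"
  shows "F = G"
proof -
  have "image_mset expo F = image_mset expo G"
    using ev_power_sum[of 0 F] ev_power_sum[of 0 G] assms(3) by (intro independent) simp
  then show ?thesis using image_mset_inj_on[OF expo_inj, of F G] assms(1,2) by auto
qed

lemma ev_image_add: "ev (image_mset (add_mset x) F) = ev F * \<omega> ^ wt x"
  by (induction F) (auto simp: algebra_simps power_add)

lemma ev_ring: "ev F \<in> gen_ring \<omega>"
  by (induction F) (auto intro: gen_ring_0 gen_ring_power gen_ring_intros)

lemma cnj_power: "cnj (\<omega> ^ k) * \<omega> ^ k = 1"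
proof -
  have "\<omega> ^ k * cnj (\<omega> ^ k) = of_real ((cmod (\<omega> ^ k))\<^sup>2)" by (rule complex_norm_square[symmetric])
  also have "\<dots> = 1" by (simp add: norm_power norm_\<omega>)
  finally show ?thesis by (simp only: mult.commute)
qed

lemma cnj_ev_power_sum:
  assumes "\<And>\<nu>. \<nu> \<in># F \<Longrightarrow> expo \<nu> \<le> k"
  shows "\<omega> ^ k * cnj (ev F) = power_sum \<omega> (image_mset (\<lambda>\<nu>. k - expo \<nu>) F)"
  using assms
proof (induction F)
  case (add \<nu> F)
  have "\<omega> ^ k * cnj (\<omega> ^ expo \<nu>) = \<omega> ^ (k - expo \<nu>) * (cnj (\<omega> ^ expo \<nu>) * \<omega> ^ expo \<nu>)"
    using add.prems[of \<nu>] by (simp flip: power_add)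
  also have "\<dots> = \<omega> ^ (k - expo \<nu>)" unfolding cnj_power by simp
  finally show ?case using add by (simp add: power_sum_def algebra_simps)
qed (simp add: power_sum_def)

lemma power_sum_shift: "\<omega> ^ h * power_sum \<omega> A = power_sum \<omega> (image_mset (\<lambda>k. k + h) A)"
  by (induction A) (auto simp: power_sum_def algebra_simps power_add)

text \<open>Conjugation replaces \<open>\<omega>\<close> by its inverse. Multiplying
  \<open>cnj X = X\<close> by \<open>\<omega> ^ (k + h)\<close> clears negative exponents, and
  independence then equates the multisets of exponents.\<close>

lemma symmetric_about_of_real:
  assumes w: "\<And>\<nu>. \<nu> \<in># w \<Longrightarrow> size \<nu> \<le> Suc M" and b: "\<And>\<nu>. \<nu> \<in># b \<Longrightarrow> size \<nu> \<le> Suc M" and z: "size z \<le> Suc M"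
    and X: "X = (ev w - ev b) * cnj (\<omega> ^ expo z)" "cnj X = X"
  shows "symmetric_about z w b"
proof -
  define h where "h = expo z"
  define k where "k = (\<Sum>\<nu>\<in>#w + b. expo \<nu>)"
  have le: "expo \<nu> \<le> k" if \<nu>: "\<nu> \<in># w + b" for \<nu>
  proof -
    obtain A where A: "w + b = add_mset \<nu> A" using multi_member_split[OF \<nu>] by blast
    show ?thesis unfolding k_def A by simp
  qed
  \<comment> \<open>Exponents of a monomial before and after conjugation;
    \<open>g \<kappa> = f \<nu>\<close> says that \<open>\<nu>\<close> and \<open>\<kappa>\<close>
    have the product \<open>z + z\<close>.\<close>
  define f where "f \<nu> = k + expo \<nu>" for \<nu>
  define g where "g \<nu> = k - expo \<nu> + 2 * h" for \<nu>
  have one: "cnj (\<omega> ^ h) * \<omega> ^ h = 1" by (rule cnj_power)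
  have "X * \<omega> ^ h = (ev w - ev b) * (cnj (\<omega> ^ h) * \<omega> ^ h)" by (simp add: X(1) h_def)
  then have 1: "X * \<omega> ^ h = ev w - ev b" unfolding one by simp
  have "cnj X * \<omega> ^ h = (cnj (ev w) - cnj (ev b)) * \<omega> ^ (2 * h)"
    by (simp add: X(1) h_def mult_2 power_add)
  then have eq: "ev w - ev b = (cnj (ev w) - cnj (ev b)) * \<omega> ^ (2 * h)" using 1 X(2) by simp
  have F: "\<omega> ^ k * ev A = power_sum \<omega> (image_mset f A)" for A
    unfolding f_def by (rule ev_power_sum)
  have G: "\<omega> ^ k * cnj (ev A) * \<omega> ^ (2 * h) = power_sum \<omega> (image_mset g A)" if "set_mset A \<subseteq> set_mset (w + b)" for A
  proof -
    have "\<omega> ^ k * cnj (ev A) = power_sum \<omega> (image_mset (\<lambda>\<nu>. k - expo \<nu>) A)"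
      using that le by (intro cnj_ev_power_sum) auto
    then show ?thesis using power_sum_shift[of "2 * h" "image_mset (\<lambda>\<nu>. k - expo \<nu>) A"]
      by (simp add: g_def[abs_def] image_mset.compositionality comp_def mult.commute)
  qed
  have "\<omega> ^ k * ev w + \<omega> ^ k * cnj (ev b) * \<omega> ^ (2 * h) = \<omega> ^ k * ev b + \<omega> ^ k * cnj (ev w) * \<omega> ^ (2 * h)"
    using arg_cong[OF eq, of "\<lambda>x. \<omega> ^ k * x"] by (simp add: algebra_simps)
  then have "power_sum \<omega> (image_mset f w + image_mset g b) = power_sum \<omega> (image_mset f b + image_mset g w)"
    using F[of w] F[of b] G[of w] G[of b] by (simp add: power_sum_def)
  then have ms: "image_mset f w + image_mset g b = image_mset f b + image_mset g w" by (rule independent)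
  let ?S = "set_mset (w + b)"
  have sN: "size \<nu> < N" if "\<nu> \<in> ?S" for \<nu> using that w[of \<nu>] b[of \<nu>] N by auto
  then have ie: "inj_on expo ?S" using expo_inj by (auto intro: inj_on_subset)
  have ig: "inj_on g ?S"
  proof (rule inj_onI)
    fix x y assume xy: "x \<in> ?S" "y \<in> ?S" "g x = g y"
    then have "expo x = expo y" using le[of x] le[of y] unfolding g_def by linarith
    then show "x = y" using ie xy by (auto simp: inj_on_def)
  qed
  have injf: "inj_on f ?S" using ie by (auto simp: inj_on_def f_def)
  have cf: "count (image_mset f A) (f \<nu>) = count A \<nu>" if "\<nu> \<in> ?S" "set_mset A \<subseteq> ?S" for A \<nu>
    by (rule count_image_mset_inj_on[OF injf that(2,1)])
  show ?thesis
    unfolding symmetric_about_def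
  proof (intro allI impI)
    fix \<nu> assume nz: "coeff_diff w b \<nu> \<noteq> 0"
    then have "\<nu> \<in># w \<or> \<nu> \<in># b"
      using coeff_diff_pos_mem[of w b \<nu>] coeff_diff_neg_mem[of w b \<nu>] by linarith
    then have \<nu>S: "\<nu> \<in> ?S" by simp
    have c: "count w \<nu> + count (image_mset g b) (f \<nu>) = count b \<nu> + count (image_mset g w) (f \<nu>)"
      using arg_cong[OF ms, of "\<lambda>A. count A (f \<nu>)"] cf[OF \<nu>S, of w] cf[OF \<nu>S, of b] by simp
    show "\<exists>\<kappa>. \<nu> + \<kappa> = z + z \<and> coeff_diff w b \<kappa> = coeff_diff w b \<nu>"
    proof (cases "\<exists>\<kappa>\<in>?S. g \<kappa> = f \<nu>")
      case True
      then obtain \<kappa> where \<kappa>: "\<kappa> \<in> ?S" "g \<kappa> = f \<nu>" by blast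
      then have "expo (\<nu> + \<kappa>) = expo (z + z)" using le[of \<kappa>] by (simp add: f_def g_def h_def)
      moreover have "size (\<nu> + \<kappa>) < N" "size (z + z) < N"
        using z w[of \<nu>] b[of \<nu>] w[of \<kappa>] b[of \<kappa>] \<kappa>(1) \<nu>S N by auto
      ultimately have "\<nu> + \<kappa> = z + z" using expo_inj by (auto simp: inj_on_def)
      moreover have "count (image_mset g A) (f \<nu>) = count A \<kappa>" if "set_mset A \<subseteq> ?S" for A
        using count_image_mset_inj_on[OF ig that \<kappa>(1)] \<kappa>(2) by simp
      then have "count w \<nu> + count b \<kappa> = count b \<nu> + count w \<kappa>" using c by simp
      then have "coeff_diff w b \<kappa> = coeff_diff w b \<nu>" by (simp add: coeff_diff_def)
      ultimately show ?thesis by blast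
    next
      case False
      then have "f \<nu> \<notin># image_mset g w" "f \<nu> \<notin># image_mset g b" by force+
      then have "count (image_mset g w) (f \<nu>) = 0" "count (image_mset g b) (f \<nu>) = 0" by (simp_all only: not_in_iff)
      then show ?thesis using c nz by (simp add: coeff_diff_def)
    qed
  qed
qed

lemma val_parity:
  "val F = of_real (rad d) * ev (filter_mset (\<lambda>\<nu>. even (size \<nu>) = even d) F) +
    of_real (rad (Suc d)) * ev (filter_mset (\<lambda>\<nu>. even (size \<nu>) \<noteq> even d) F)"
proof (induction F)
  case (add \<nu> F)
  then show ?case
    by (cases "even (size \<nu>) = even d") (simp_all add: rad_def algebra_simps)
qed simp

lemma ev_parity:
  "ev F = ev (filter_mset (\<lambda>\<nu>. even (size \<nu>) = even d) F) + ev (filter_mset (\<lambda>\<nu>. even (size \<nu>) \<noteq> even d) F)"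
proof (induction F)
  case (add \<nu> F)
  then show ?case by (cases "even (size \<nu>) = even d") simp_all
qed simp

lemma rad_cases: "rad d = 1 \<and> rad (Suc d) = s \<or> rad d = s \<and> rad (Suc d) = 1"
  by (simp add: rad_def)

lemma rad_linear:
  assumes "a \<in> gen_ring \<omega>" "b \<in> gen_ring \<omega>" "of_real (rad d) * a + of_real (rad (Suc d)) * b = 0"
  shows "a = 0 \<and> b = 0"
  using rad_cases[of d]
proof
  assume "rad d = 1 \<and> rad (Suc d) = s"
  then show ?thesis using generic[OF assms(1,2) gen_ring_0] assms(3) by (simp add: mult.commute)
next
  assume "rad d = s \<and> rad (Suc d) = 1"
  then show ?thesis using generic[OF assms(2,1) gen_ring_0] assms(3) by (simp add: mult.commute add.commute)
qed

lemma val_inj: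
  assumes "\<And>\<nu>. \<nu> \<in># F \<Longrightarrow> size \<nu> \<le> Suc M" "\<And>\<nu>. \<nu> \<in># G \<Longrightarrow> size \<nu> \<le> Suc M" "val F = val G"
  shows "F = G"
proof -
  let ?e = "filter_mset (\<lambda>\<nu>. even (size \<nu>) = even (0::nat))"
  let ?o = "filter_mset (\<lambda>\<nu>. even (size \<nu>) \<noteq> even (0::nat))"
  have "of_real (rad 0) * (ev (?e F) - ev (?e G)) + of_real (rad (Suc 0)) * (ev (?o F) - ev (?o G)) = 0"
    using assms(3) unfolding val_parity[of F 0] val_parity[of G 0] by (simp add: algebra_simps)
  then have "ev (?e F) = ev (?e G)" "ev (?o F) = ev (?o G)"
    using rad_linear[of "ev (?e F) - ev (?e G)" "ev (?o F) - ev (?o G)" 0] ev_ring gen_ring_intros(5) by auto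
  moreover have "ev F = ev (?e F) + ev (?o F)" "ev G = ev (?e G) + ev (?o G)" by (rule ev_parity)+
  ultimately have "ev F = ev G" by (simp only:)
  moreover have "size \<nu> < N" if "\<nu> \<in># F + G" for \<nu> using that assms(1,2)[of \<nu>] N by auto
  ultimately show ?thesis using ev_inj[of F G] by auto
qed

lemma cnj_power_ring: "cnj (\<omega> ^ k) \<in> gen_ring \<omega>"
  by (intro gen_ring_cnj gen_ring_power)

lemma rad_pos: "0 < rad d"
  using s_pos by (simp add: rad_def)

text \<open>Division by the direction gives
  \<open>rad d * X0 + rad (Suc d) * X1 = u * rad d\<close>. As \<open>s\<close> is generic,
  \<open>X0\<close> and \<open>X1\<close> are real separately, hence so is the unweighted quotient
  \<open>X0 + X1\<close>, to which \<open>unit_edge_rigid\<close> applies.\<close>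

lemma unit_edge_integer:
  fixes n ps q d and u :: real
  defines "b \<equiv> left_end ps n" and "w \<equiv> position False False q" and "z \<equiv> direction False False ps" and "d \<equiv> length ps"
  assumes w: "\<And>\<nu>. \<nu> \<in># w \<Longrightarrow> size \<nu> \<le> Suc M" and b: "\<And>\<nu>. \<nu> \<in># b \<Longrightarrow> size \<nu> \<le> Suc M" and dM: "d \<le> Suc M"
    and u: "val w - val b = of_real u * (of_real (rad d) * \<omega> ^ expo z)"
  shows "u \<in> \<int>"
proof -
  define h where "h = expo z"
  let ?e = "filter_mset (\<lambda>\<nu>. even (size \<nu>) = even d)" and ?o = "filter_mset (\<lambda>\<nu>. even (size \<nu>) \<noteq> even d)"
  define X0 where "X0 = (ev (?e w) - ev (?e b)) * cnj (\<omega> ^ h)"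
  define X1 where "X1 = (ev (?o w) - ev (?o b)) * cnj (\<omega> ^ h)"
  have R: "X0 \<in> gen_ring \<omega>" "X1 \<in> gen_ring \<omega>"
    unfolding X0_def X1_def by (intro gen_ring_intros(5,6) ev_ring cnj_power_ring)+
  have "of_real (rad d) * X0 + of_real (rad (Suc d)) * X1 = (val w - val b) * cnj (\<omega> ^ h)"
    unfolding val_parity[of w d] val_parity[of b d] X0_def X1_def by (simp only: ring_distribs mult.assoc) simp
  also have "\<dots> = of_real u * of_real (rad d) * (cnj (\<omega> ^ h) * \<omega> ^ h)"
    unfolding u h_def by (simp only: ac_simps)
  also have "\<dots> = of_real (u * rad d)" unfolding cnj_power by simp
  finally have eq: "of_real (rad d) * X0 + of_real (rad (Suc d)) * X1 = complex_of_real (u * rad d)" .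
  have "of_real (rad d) * cnj X0 + of_real (rad (Suc d)) * cnj X1 = complex_of_real (u * rad d)"
    using arg_cong[OF eq, of cnj] by simp
  then have "of_real (rad d) * (X0 - cnj X0) + of_real (rad (Suc d)) * (X1 - cnj X1) = 0"
    using eq by (simp add: algebra_simps)
  then have "X0 - cnj X0 = 0 \<and> X1 - cnj X1 = 0"
    by (rule rad_linear[rotated 2]) (intro gen_ring_intros(5) gen_ring_cnj R)+
  then have real: "cnj (X0 + X1) = X0 + X1" by simp
  have "symmetric_about z w b"
  proof (rule symmetric_about_of_real[OF w b _ _ real])
    show "X0 + X1 = (ev w - ev b) * cnj (\<omega> ^ expo z)"
      unfolding X0_def X1_def ev_parity[of w d] ev_parity[of b d] h_def by (simp add: algebra_simps)
    show "size z \<le> Suc M" using dM by (simp add: z_def d_def)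
  qed
  then have "coeff_diff w b \<nu> = 0" if "\<nu> \<noteq> z" for \<nu>
    using unit_edge_rigid[of False False ps q n \<nu>] that by (simp add: w_def b_def z_def left_end_def)
  then have "val w - val b = of_int (coeff_diff w b z) * (of_real (rad (size z)) * \<omega> ^ expo z)"
    unfolding val_def by (rule sum_mset_coeff_diff)
  then have "of_real u * (of_real (rad d) * \<omega> ^ expo z) = of_int (coeff_diff w b z) * (of_real (rad d) * \<omega> ^ expo z)"
    using u by (simp add: z_def d_def)
  moreover have "\<omega> \<noteq> 0" using norm_\<omega> by auto
  ultimately have "complex_of_real u = complex_of_real (of_int (coeff_diff w b z))" using rad_pos[of d] by simp
  then have "u = of_int (coeff_diff w b z)" unfolding of_real_eq_iff .
  then show ?thesis by simp
qed

lemma generator_not_real: "cnj (\<omega> ^ wt x) \<noteq> \<omega> ^ wt x"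
proof
  assume "cnj (\<omega> ^ wt x) = \<omega> ^ wt x"
  then have "\<omega> ^ wt x * \<omega> ^ wt x = 1" using cnj_power[of "wt x"] by simp
  then have "power_sum \<omega> {#wt x + wt x#} = power_sum \<omega> {#0#}" by (simp add: power_sum_def power_add)
  then have "{#wt x + wt x#} = {#0#}" by (rule independent)
  then show False using wt_pos[of x] by simp
qed

lemma diagonal_direction_nonzero: "of_real (rad (Suc d)) * \<omega> ^ wt x - of_real (rad d) \<noteq> 0"
proof
  assume "of_real (rad (Suc d)) * \<omega> ^ wt x - complex_of_real (rad d) = 0"
  then have "\<omega> ^ wt x = of_real (rad d / rad (Suc d))" using rad_pos[of "Suc d"] by (simp add: field_simps)
  then show False using generator_not_real[of x] by (metis complex_cnj_complex_of_real)
qed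

text \<open>Multiplying by the conjugate of \<open>r' * cx - r\<close> makes the right-hand side
  real and eliminates \<open>u\<close>; the imaginary part is a relation quadratic in
  \<open>s\<close>. Its three coefficients vanish, which provides the hypotheses of
  \<open>diagonal_rigid\<close>.\<close>

lemma diagonal_integer:
  fixes n ps q d x and u :: real
  defines "b \<equiv> left_end ps n" and "w \<equiv> position False False q" and "z \<equiv> direction False False ps" and "d \<equiv> length ps"
  assumes zx: "direction False False (ps @ [(n, False)]) = add_mset x z"
    and w: "\<And>\<nu>. \<nu> \<in># w \<Longrightarrow> size \<nu> \<le> M" and b: "\<And>\<nu>. \<nu> \<in># b \<Longrightarrow> size \<nu> \<le> M" and dM: "d \<le> M"
    and u: "val w - (val b + of_real (rad d) * \<omega> ^ expo z) =
      of_real u * ((of_real (rad (Suc d)) * \<omega> ^ wt x - of_real (rad d)) * \<omega> ^ expo z)"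
  shows "u \<in> \<int>"
proof -
  let ?e = "filter_mset (\<lambda>\<nu>. even (size \<nu>) = even d)" and ?o = "filter_mset (\<lambda>\<nu>. even (size \<nu>) \<noteq> even d)"
  define h where "h = expo z"
  define cx where "cx = \<omega> ^ wt x"
  define r r' where "r = complex_of_real (rad d)" and "r' = complex_of_real (rad (Suc d))"
  define G0 where "G0 = ev (?e w) - ev (add_mset z (?e b))"
  define G1 where "G1 = ev (?o w) - ev (?o b)"
  define \<alpha> where "\<alpha> = G0 * cnj (\<omega> ^ h)"
  define \<beta> where "\<beta> = G1 * cnj (\<omega> ^ h)"
  have sz: "size z = d" by (simp add: z_def d_def)
  have cx1: "cnj cx * cx = 1" unfolding cx_def by (rule cnj_power)
  have h1: "cnj (\<omega> ^ h) * \<omega> ^ h = 1" by (rule cnj_power)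
  have rr: "cnj r = r" "cnj r' = r'" by (simp_all add: r_def r'_def)
  have R: "\<alpha> \<in> gen_ring \<omega>" "\<beta> \<in> gen_ring \<omega>" "cnj cx \<in> gen_ring \<omega>"
    unfolding \<alpha>_def \<beta>_def G0_def G1_def cx_def
    by (intro gen_ring_intros(5,6) ev_ring cnj_power_ring)+
  have "val w - (val b + r * \<omega> ^ h) = r * G0 + r' * G1"
    unfolding val_parity[of w d] val_parity[of b d] G0_def G1_def r_def r'_def h_def
    by (simp add: algebra_simps)
  then have "r * G0 + r' * G1 = of_real u * ((r' * cx - r) * \<omega> ^ h)"
    using u unfolding h_def cx_def r_def r'_def by simp
  then have "(r * G0 + r' * G1) * cnj (\<omega> ^ h) = of_real u * ((r' * cx - r) * \<omega> ^ h) * cnj (\<omega> ^ h)"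
    by simp
  also have "\<dots> = of_real u * (r' * cx - r) * (cnj (\<omega> ^ h) * \<omega> ^ h)" by (simp only: ac_simps)
  finally have eq: "r * \<alpha> + r' * \<beta> = of_real u * (r' * cx - r)"
    unfolding h1 \<alpha>_def \<beta>_def by (simp add: algebra_simps)
  define a where "a = \<alpha> - cnj \<alpha>"
  define e where "e = (\<alpha> * cnj cx - \<beta>) - cnj (\<alpha> * cnj cx - \<beta>)"
  define c where "c = \<beta> * cnj cx - cnj (\<beta> * cnj cx)"
  have "r' ^ 2 * c + r * r' * e - r ^ 2 * a =
      (r * \<alpha> + r' * \<beta>) * (r' * cnj cx - r) - cnj ((r * \<alpha> + r' * \<beta>) * (r' * cnj cx - r))"
    by (simp add: a_def e_def c_def rr power2_eq_square algebra_simps)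
  also have "\<dots> = 0" unfolding eq by (simp add: rr algebra_simps)
  finally have quad: "r' ^ 2 * c + r * r' * e - r ^ 2 * a = 0" .
  have Re: "a \<in> gen_ring \<omega>" "e \<in> gen_ring \<omega>" "c \<in> gen_ring \<omega>" "- a \<in> gen_ring \<omega>"
  proof -
    show "a \<in> gen_ring \<omega>" unfolding a_def by (intro gen_ring_intros(5) gen_ring_cnj R)
    then show "- a \<in> gen_ring \<omega>" using gen_ring_intros(5)[OF gen_ring_0] by simp
    show "e \<in> gen_ring \<omega>" "c \<in> gen_ring \<omega>"
      unfolding e_def c_def by (intro gen_ring_intros(5,6) gen_ring_cnj R)+
  qed
  have z0: "a = 0 \<and> e = 0 \<and> c = 0"
    using rad_cases[of d]
  proof
    assume "rad d = 1 \<and> rad (Suc d) = s"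
    then show ?thesis using generic[OF Re(4,2,3)] quad by (simp add: r_def r'_def algebra_simps)
  next
    assume "rad d = s \<and> rad (Suc d) = 1"
    then show ?thesis using generic[OF Re(3,2,4)] quad by (simp add: r_def r'_def algebra_simps)
  qed
  define \<gamma> where "\<gamma> = \<beta> * cnj cx"
  have real: "cnj \<alpha> = \<alpha>" "cnj \<gamma> = \<gamma>" using z0 by (simp_all add: a_def c_def \<gamma>_def)
  have \<beta>: "\<beta> = \<gamma> * cx" using cx1 by (simp add: \<gamma>_def mult.assoc)
  \<comment> \<open>The mixed coefficient \<open>e\<close>. Since \<open>cx\<close> is not real, it
    yields \<open>\<alpha> = - \<gamma>\<close>.\<close>
  have "\<alpha> * cnj cx - \<gamma> * cx = \<alpha> * cx - \<gamma> * cnj cx" using z0 real unfolding e_def \<beta> by simp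
  then have "(\<alpha> + \<gamma>) * (cnj cx - cx) = 0" by (simp add: algebra_simps)
  then have ag: "\<alpha> = - \<gamma>" using generator_not_real[of x] by (simp add: cx_def eq_neg_iff_add_eq_0)
  have s0: "symmetric_about z (?e w) (add_mset z (?e b))"
  proof (rule symmetric_about_of_real[OF _ _ _ _ real(1)])
    show "\<alpha> = (ev (?e w) - ev (add_mset z (?e b))) * cnj (\<omega> ^ expo z)" by (simp only: \<alpha>_def G0_def h_def)
  qed (use w b dM sz in \<open>auto intro: le_SucI\<close>)
  have s1: "symmetric_about (add_mset x z) (?o w) (?o b)"
  proof (rule symmetric_about_of_real[OF _ _ _ _ real(2)])
    show "\<gamma> = (ev (?o w) - ev (?o b)) * cnj (\<omega> ^ expo (add_mset x z))"
      by (simp add: \<gamma>_def \<beta>_def G1_def h_def cx_def power_add)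
  qed (use w b dM sz in \<open>auto intro: le_SucI\<close>)
  have "G0 = \<alpha> * \<omega> ^ h" "G1 = \<beta> * \<omega> ^ h" using h1 by (simp_all add: \<alpha>_def \<beta>_def mult.assoc)
  then have "G0 * cx + G1 = 0" by (simp add: ag \<beta>)
  then have "ev (image_mset (add_mset x) (?e w) + ?o w) = ev (image_mset (add_mset x) (add_mset z (?e b)) + ?o b)"
    unfolding G0_def G1_def ev_simps(3) ev_image_add cx_def by (simp add: algebra_simps)
  then have me: "image_mset (add_mset x) (?e w) + ?o w = image_mset (add_mset x) (add_mset z (?e b)) + ?o b"
  proof (rule ev_inj[rotated 2])
    fix \<nu>
    show "size \<nu> < N" if "\<nu> \<in># image_mset (add_mset x) (?e w) + ?o w" using that w N by fastforce
    show "size \<nu> < N" if "\<nu> \<in># image_mset (add_mset x) (add_mset z (?e b)) + ?o b"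
      using that b dM sz N by fastforce
  qed
  have "coeff_diff (?o w) (?o b) \<kappa> = 0" if "\<kappa> \<noteq> add_mset x z" for \<kappa>
    using diagonal_rigid[OF zx[unfolded z_def] refl refl refl refl, of w] s0 s1 me that
    unfolding b_def z_def d_def left_end_def by blast
  then have "G1 = of_int (coeff_diff (?o w) (?o b) (add_mset x z)) * \<omega> ^ expo (add_mset x z)"
    unfolding G1_def ev_def by (rule sum_mset_coeff_diff)
  then obtain k :: int where k: "G1 = of_int k * (cx * \<omega> ^ h)" by (simp add: cx_def h_def power_add) blast
  have "\<gamma> = of_int k * (cnj cx * cx) * (cnj (\<omega> ^ h) * \<omega> ^ h)"
    unfolding \<gamma>_def \<beta>_def k by (simp only: ac_simps)
  then have "\<gamma> = of_int k" unfolding cx1 h1 by simp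
  then have "of_real u * (r' * cx - r) = of_int k * (r' * cx - r)"
    unfolding eq[symmetric] ag \<beta> by (simp add: algebra_simps)
  then have "complex_of_real u = complex_of_real (of_int k)"
    using diagonal_direction_nonzero[of d x] by (simp add: cx_def r_def r'_def)
  then have "u = of_int k" unfolding of_real_eq_iff .
  then show ?thesis by simp
qed

end

section \<open>Edge lengths and the drawing\<close>

context generic_parameters
begin

text \<open>The parity in the colour decides which of the two sides has length \<open>s\<close>, so
  the colour alone determines the length of the diagonal.\<close>

definition diagonal_length :: "colour \<Rightarrow> real" where
  "diagonal_length x = cmod (of_real (if fst x then 1 else s) * \<omega> ^ wt x - of_real (if fst x then s else 1))"

definition lengths :: "real set" where
  "lengths = {1, s} \<union> diagonal_length ` (UNIV \<times> {..<5})"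

lemma card_lengths: "finite lengths" "card lengths \<le> 12"
proof -
  show "finite lengths" by (simp add: lengths_def)
  have "card lengths \<le> card {1, s} + card (diagonal_length ` (UNIV \<times> {..<5}))"
    unfolding lengths_def by (rule card_Un_le)
  also have "card (diagonal_length ` (UNIV \<times> {..<5})) \<le> card ((UNIV :: bool set) \<times> {..<5::nat})"
    by (rule card_image_le) simp
  also have "\<dots> = 10" by (simp add: card_cartesian_product)
  also have "card {1, s} \<le> 2" by (simp add: card_insert_if)
  finally show "card lengths \<le> 12" by simp
qed

lemma norm_power_\<omega>: "cmod (\<omega> ^ k) = 1"
  by (simp add: norm_power norm_\<omega>)

lemma val_right_end: "val (right_end ps n) = val (left_end ps n) + of_real (rad (length ps)) * \<omega> ^ expo (direction False False ps)"
  by (simp add: right_end_def left_end_def position_snoc_True)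

lemma colour_step:
  obtains x where "direction False False (ps @ [(n, False)]) = add_mset x (direction False False ps)"
    "fst x = odd (length ps)" "snd x < 5"
  using direction_snoc_class[of False False ps n False] colour_index_less by (auto simp: rung_colour_def)

lemma val_left_end_Suc:
  assumes "direction False False (ps @ [(n, False)]) = add_mset x (direction False False ps)"
  shows "val (left_end ps (Suc n)) = val (left_end ps n) + of_real (rad (Suc (length ps))) * (\<omega> ^ wt x * \<omega> ^ expo (direction False False ps))"
  by (simp add: left_end_def position_snoc_Suc assms power_add)

lemma linked_length:
  assumes "linked p q"
  shows "cmod (val p - val q) \<in> lengths"
proof -
  obtain ps n where "{p, q} = {left_end ps n, right_end ps n} \<or> {p, q} = {right_end ps n, left_end ps (Suc n)}"
    using assms unfolding linked_def by blast
  then have "cmod (val p - val q) = cmod (val (right_end ps n) - val (left_end ps n)) \<or>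
      cmod (val p - val q) = cmod (val (left_end ps (Suc n)) - val (right_end ps n))"
    by (auto simp: doubleton_eq_iff norm_minus_commute)
  moreover have "cmod (val (right_end ps n) - val (left_end ps n)) \<in> lengths"
    using s_pos by (simp add: val_right_end norm_mult norm_power_\<omega> lengths_def rad_def)
  moreover have "cmod (val (left_end ps (Suc n)) - val (right_end ps n)) \<in> lengths"
  proof -
    obtain x where x: "direction False False (ps @ [(n, False)]) = add_mset x (direction False False ps)"
      "fst x = odd (length ps)" "snd x < 5" by (rule colour_step)
    have "val (left_end ps (Suc n)) - val (right_end ps n) =
      (of_real (rad (Suc (length ps))) * \<omega> ^ wt x - of_real (rad (length ps))) * \<omega> ^ expo (direction False False ps)"
      unfolding val_left_end_Suc[OF x(1)] val_right_end by (simp add: algebra_simps)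
    then have "cmod (val (left_end ps (Suc n)) - val (right_end ps n)) = diagonal_length x"
      using x(2) by (simp add: norm_mult norm_power_\<omega> diagonal_length_def rad_def)
    then show ?thesis using x(3) by (cases x) (auto simp: lengths_def)
  qed
  ultimately show ?thesis by auto
qed

lemma linked_avoids:
  assumes pq: "linked p q" and w: "w = position False False q0"
    and M: "\<And>\<nu>. \<nu> \<in># p + q + w \<Longrightarrow> size \<nu> \<le> M"
  shows "val w \<notin> open_segment (val p) (val q)"
proof
  assume "val w \<in> open_segment (val p) (val q)"
  obtain ps n where cases: "{p, q} = {left_end ps n, right_end ps n} \<or> {p, q} = {right_end ps n, left_end ps (Suc n)}"
    using pq unfolding linked_def by blast
  have seg: "val w \<in> open_segment (val a) (val b)" if "{p, q} = {a, b}" for a b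
    using that \<open>val w \<in> open_segment (val p) (val q)\<close> by (auto simp: doubleton_eq_iff open_segment_commute)
  have size: "size \<nu> \<le> M" if "\<nu> \<in># a" "{p, q} = {a, b} \<or> {p, q} = {b, a}" for \<nu> a b
    using that M[of \<nu>] by (auto simp: doubleton_eq_iff)
  have wM: "size \<nu> \<le> M" if "\<nu> \<in># position False False q0" for \<nu> using M[of \<nu>] that w by simp
  have mid: "\<exists>u. 0 < u \<and> u < 1 \<and> val w - a = of_real u * (b - a)" if "val w \<in> open_segment a b" for a b
    using that by (auto simp: in_segment scaleR_conv_of_real algebra_simps)
  have right_end: "right_end ps n = add_mset (direction False False ps) (left_end ps n)"
    by (simp add: right_end_def left_end_def position_snoc_True)
  have no_int: False if "u \<in> \<int>" "0 < u" "u < 1" for u :: real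
    using that by (auto elim!: Ints_cases)
  have right_end_size: "size \<nu> \<le> M" if "\<nu> \<in># right_end ps n" for \<nu>
    using cases size[OF that] by blast
  then have left_end_size: "size \<nu> \<le> M" if "\<nu> \<in># left_end ps n" for \<nu> using that by (simp add: right_end)
  \<comment> \<open>The right end has the direction itself as a monomial.\<close>
  have len: "length ps \<le> M" using right_end_size[of "direction False False ps"] by (simp add: right_end)
  from cases show False
  proof
    assume "{p, q} = {left_end ps n, right_end ps n}"
    from mid[OF seg[OF this]] obtain u where u: "0 < u" "u < 1"
      "val w - val (left_end ps n) = of_real u * (val (right_end ps n) - val (left_end ps n))" by blast
    have "u \<in> \<int>"
      by (rule unit_edge_integer[where q = q0 and ps = ps and n = n])
        (use u(3) wM left_end_size len in \<open>auto simp: w val_right_end intro: le_SucI\<close>)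
    then show False using no_int u by blast
  next
    assume "{p, q} = {right_end ps n, left_end ps (Suc n)}"
    from mid[OF seg[OF this]] obtain u where u: "0 < u" "u < 1"
      "val w - val (right_end ps n) = of_real u * (val (left_end ps (Suc n)) - val (right_end ps n))" by blast
    obtain x where x: "direction False False (ps @ [(n, False)]) = add_mset x (direction False False ps)"
      by (rule colour_step)
    have "val (left_end ps (Suc n)) - val (right_end ps n) =
      (of_real (rad (Suc (length ps))) * \<omega> ^ wt x - of_real (rad (length ps))) * \<omega> ^ expo (direction False False ps)"
      unfolding val_left_end_Suc[OF x] val_right_end by (simp add: algebra_simps)
    with u(3) have "val w - (val (left_end ps n) + of_real (rad (length ps)) * \<omega> ^ expo (direction False False ps)) =
      of_real u * ((of_real (rad (Suc (length ps))) * \<omega> ^ wt x - of_real (rad (length ps))) * \<omega> ^ expo (direction False False ps))"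
      unfolding val_right_end by simp
    from diagonal_integer[OF x wM left_end_size len this[unfolded w]] have "u \<in> \<int>" by blast
    then show False using no_int u by blast
  qed
qed

end

lemma (in outerplane) no_theta: "no_theta E"
  unfolding no_theta_def using no_three_paths by meson

lemma (in outerplane) no_crossing_in_cycle: "no_crossing_in_cycle E"
  unfolding no_crossing_in_cycle_def using no_crossing_chords by meson

theorem theorem1:
  fixes V :: "'a set" and E :: "'a set set"
  assumes "finite_simple_graph V E"
    and "outerplanar V E"
  shows "distance_number V E \<le> 13"
proof -
  obtain f \<gamma> where "plane_embedding V E f \<gamma>" "f ` V \<subseteq> frontier (outside (embedding_image V E f \<gamma>))"
    using assms(2) unfolding outerplanar_def by blast
  then interpret outerplane V E f \<gamma> using assms(1) by unfold_locales
  have fin: "finite V" using assms(1) by (simp add: finite_simple_graph_def)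
  obtain vs where vs: "distinct vs" "set vs = V" "noncrossing E vs"
    using noncrossing_order[OF no_theta no_crossing_in_cycle fin] by blast
  obtain pos where pos: "inj_on pos V" "\<And>x. x \<in> V \<Longrightarrow> \<exists>q. pos x = position False False q" "links E V pos"
    using outerplanar_placement[OF vs(1,3)] unfolding vs(2) by blast
  \<comment> \<open>The inserted 0 covers the empty graph.\<close>
  define M where "M = Max (insert 0 (size ` (\<Union>x\<in>V. set_mset (pos x))))"
  have M: "size \<nu> \<le> M" if "\<nu> \<in># pos x" "x \<in> V" for \<nu> x
    unfolding M_def using that fin by (intro Max_ge) auto
  obtain \<omega> :: complex where \<omega>: "cmod \<omega> = 1" "\<And>A B. power_sum \<omega> A = power_sum \<omega> B \<Longrightarrow> A = B"
    using exists_independent_unit by blast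
  obtain s :: real where s: "s > 0"
    "\<And>a b c. a \<in> gen_ring \<omega> \<Longrightarrow> b \<in> gen_ring \<omega> \<Longrightarrow> c \<in> gen_ring \<omega> \<Longrightarrow>
      a + b * of_real s + c * of_real s ^ 2 = 0 \<Longrightarrow> a = 0 \<and> b = 0 \<and> c = 0"
    using exists_generic_real by blast
  interpret generic_parameters \<omega> s M "2 * M + 3"
    by unfold_locales (use \<omega> s in auto)
  define \<psi> where "\<psi> x = val (pos x)" for x
  have edge: "x \<in> V" "y \<in> V" "x \<noteq> y" if "{x, y} \<in> E" for x y
    using edgeD[OF that] by (auto simp: card_insert_if split: if_splits)
  have linked: "linked (pos x) (pos y)" if "{x, y} \<in> E" for x y
    using pos(3) edge[OF that] that unfolding links_def by blast
  have "is_drawing V E \<psi>"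
    unfolding is_drawing_def
  proof (intro conjI allI impI)
    show "inj_on \<psi> V"
    proof (rule inj_onI)
      fix x y assume xy: "x \<in> V" "y \<in> V" "\<psi> x = \<psi> y"
      have "pos x = pos y"
        by (rule val_inj) (use xy M in \<open>auto simp: \<psi>_def intro: le_SucI\<close>)
      then show "x = y" using pos(1) xy by (auto simp: inj_on_def)
    qed
    fix x y w assume xy: "{x, y} \<in> E" "w \<in> V"
    obtain q where q: "pos w = position False False q" using pos(2) xy by blast
    show "\<psi> w \<notin> open_segment (\<psi> x) (\<psi> y)"
      unfolding \<psi>_def by (rule linked_avoids[OF linked[OF xy(1)] q]) (use M edge[OF xy(1)] xy(2) in auto)
  qed
  then have "distance_number V E \<le> enat (card (edge_lengths E \<psi>))"
    unfolding distance_number_def by (intro INF_lower) simp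
  also have "edge_lengths E \<psi> \<subseteq> lengths"
    unfolding edge_lengths_def \<psi>_def using linked_length[OF linked] by blast
  then have "card (edge_lengths E \<psi>) \<le> 12"
    using card_mono[OF card_lengths(1)] card_lengths(2) le_trans by blast
  then have "enat (card (edge_lengths E \<psi>)) \<le> enat 13" by simp
  finally show ?thesis by (simp add: numeral_eq_enat)
qed

end
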